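(* Over $\mathsf{RCA}_0^*$, the following are equivalent (that is, each equivalence is provable in $\mathsf{RCA}_0^*$): (1) $\mathsf{I}\Sigma^0_2$; (2) Brown's lemma: for every $r$, every coloring $C\colon \mathbb{N}\to r$ has a $C$-homogeneous piecewise syndetic set; (3) Partition regularity of piecewise syndetic sets: if $X\subseteq\mathbb{N}$ is piecewise syndetic and $X=X_0\cup\dots\cup X_{r-1}$ is a finite partition of $X$, then $X_i$ is piecewise syndetic for some $i<r$; (4) Weak Brown's lemma: for every coloring $C\colon\mathbb{N}\to r$ there exists $d\in\mathbb{N}$ such that there are arbitrarily large (finite) $C$-homogeneous sets $H$ with $\mathrm{gs}(H)\leq d$.
   Context: Everything is in the language of second-order arithmetic. $\mathsf{RCA}_0^*$ consists of the usual basic axioms for addition, multiplication and exponentiation, together with $\Sigma^0_0$-induction and $\Delta^0_1$-comprehension. $\mathsf{I}\Sigma^0_2$ is the induction scheme for $\Sigma^0_2$-formulas (with set parameters). A natural number $r$ is identified with $\{0,\dots,r-1\}$. For a coloring $C$ with domain $\mathbb{N}$, a set $H\subseteq\mathbb{N}$ is $C$-homogeneous if $C$ is constant on $H$. Finite sets are coded by numbers. A set has gaps bounded by $d$ if the difference between any two consecutive elements is $\leq d$. For a finite set $H\subseteq\mathbb{N}$, the gap size $\mathrm{gs}(H)$ is the largest difference between two consecutive elements of $H$; if $|H|\leq 1$, $\mathrm{gs}(H)=1$. A set $X\subseteq\mathbb{N}$ is piecewise syndetic if there exists $d\in\mathbb{N}$ such that $X$ contains arbitrarily large finite sets with gaps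 bounded by $d$ (i.e. for every $n$ there is a finite $H\subseteq X$ with $|H|\geq n$ and gaps bounded by $d$). *)

theory Defs
  imports Main
begin

section \<open>The language of second-order arithmetic with exponentiation\<close>

text \<open>
  Two-sorted first-order syntax with de Bruijn indices.  Number variables and set variables are
  indexed separately: AllN binds number variable 0 and AllS binds set variable 0, and
  neither affects the indices of the other sort.  The only set terms are set variables, so a
  set term is just its index.  There is no primitive equality between sets.
\<close>

datatype tm =
    Var nat
  | Zero
  | One
  | Plus tm tm
  | Times tm tm
  | Exp tm tm

datatype fm =
    Bot
  | Eq tm tm
  | Less tm tm
  | Mem tm nat
  | Imp fm fm
  | AllN fm
  | AllS fm

abbreviation Neg :: "fm \<Rightarrow> fm" where "Neg p \<equiv> Imp p Bot"
abbreviation And :: "fm \<Rightarrow> fm \<Rightarrow> fm" where "And p q \<equiv> Neg (Imp p (Neg q))"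
abbreviation Or :: "fm \<Rightarrow> fm \<Rightarrow> fm" where "Or p q \<equiv> Imp (Neg p) q"
abbreviation Iff :: "fm \<Rightarrow> fm \<Rightarrow> fm" where "Iff p q \<equiv> And (Imp p q) (Imp q p)"
abbreviation ExN :: "fm \<Rightarrow> fm" where "ExN p \<equiv> Neg (AllN (Neg p))"
abbreviation ExS :: "fm \<Rightarrow> fm" where "ExS p \<equiv> Neg (AllS (Neg p))"

notation And (infixr "\<^bold>\<and>" 35)
notation Or (infixr "\<^bold>\<or>" 30)
notation Imp (infixr "\<^bold>\<longrightarrow>" 25)
notation Iff (infixr "\<^bold>\<longleftrightarrow>" 25)

text \<open>Simultaneous capture-avoiding substitution of terms for the number variables and of set
  variables for the set variables.\<close>

primrec tsubst :: "(nat \<Rightarrow> tm) \<Rightarrow> tm \<Rightarrow> tm" where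
  "tsubst s (Var i) = s i"
| "tsubst s Zero = Zero"
| "tsubst s One = One"
| "tsubst s (Plus t u) = Plus (tsubst s t) (tsubst s u)"
| "tsubst s (Times t u) = Times (tsubst s t) (tsubst s u)"
| "tsubst s (Exp t u) = Exp (tsubst s t) (tsubst s u)"

definition lift :: "nat \<Rightarrow> tm \<Rightarrow> tm" where
  "lift k t = tsubst (\<lambda>i. Var (i + k)) t"

primrec fsubst :: "(nat \<Rightarrow> tm) \<Rightarrow> (nat \<Rightarrow> nat) \<Rightarrow> fm \<Rightarrow> fm" where
  "fsubst s r Bot = Bot"
| "fsubst s r (Eq t u) = Eq (tsubst s t) (tsubst s u)"
| "fsubst s r (Less t u) = Less (tsubst s t) (tsubst s u)"
| "fsubst s r (Mem t X) = Mem (tsubst s t) (r X)"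
| "fsubst s r (Imp p q) = Imp (fsubst s r p) (fsubst s r q)"
| "fsubst s r (AllN p) = AllN (fsubst (case_nat (Var 0) (\<lambda>i. lift 1 (s i))) r p)"
| "fsubst s r (AllS p) = AllS (fsubst s (case_nat 0 (\<lambda>X. Suc (r X))) p)"

definition liftN :: "fm \<Rightarrow> fm" where
  "liftN = fsubst (\<lambda>i. Var (Suc i)) id"

definition liftS :: "fm \<Rightarrow> fm" where
  "liftS = fsubst Var Suc"

definition instN :: "tm \<Rightarrow> fm \<Rightarrow> fm" where
  "instN t = fsubst (case_nat t Var) id"

definition instS :: "nat \<Rightarrow> fm \<Rightarrow> fm" where
  "instS Y = fsubst Var (case_nat Y id)"

text \<open>All free number (set) variables have index below n (m).\<close>

primrec closed_tm :: "nat \<Rightarrow> tm \<Rightarrow> bool" where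
  "closed_tm n (Var i) \<longleftrightarrow> i < n"
| "closed_tm n Zero \<longleftrightarrow> True"
| "closed_tm n One \<longleftrightarrow> True"
| "closed_tm n (Plus t u) \<longleftrightarrow> closed_tm n t \<and> closed_tm n u"
| "closed_tm n (Times t u) \<longleftrightarrow> closed_tm n t \<and> closed_tm n u"
| "closed_tm n (Exp t u) \<longleftrightarrow> closed_tm n t \<and> closed_tm n u"

primrec closed_fm :: "nat \<Rightarrow> nat \<Rightarrow> fm \<Rightarrow> bool" where
  "closed_fm n m Bot \<longleftrightarrow> True"
| "closed_fm n m (Eq t u) \<longleftrightarrow> closed_tm n t \<and> closed_tm n u"
| "closed_fm n m (Less t u) \<longleftrightarrow> closed_tm n t \<and> closed_tm n u"
| "closed_fm n m (Mem t X) \<longleftrightarrow> closed_tm n t \<and> X < m"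
| "closed_fm n m (Imp p q) \<longleftrightarrow> closed_fm n m p \<and> closed_fm n m q"
| "closed_fm n m (AllN p) \<longleftrightarrow> closed_fm (Suc n) m p"
| "closed_fm n m (AllS p) \<longleftrightarrow> closed_fm n (Suc m) p"

text \<open>Universal closures of a formula (unique up to vacuous quantifiers).\<close>

definition closures :: "fm \<Rightarrow> fm set" where
  "closures p = {(AllN ^^ n) ((AllS ^^ m) p) | n m. closed_fm n m p}"


section \<open>Derivability\<close>

text \<open>Classical natural deduction for two-sorted first-order logic with equality on numbers.
  In the introduction rules for the quantifiers, lifting the context makes variable 0 the
  eigenvariable.\<close>

inductive derives :: "fm set \<Rightarrow> fm \<Rightarrow> bool" (infix "\<turnstile>" 20) where
  Assm: "p \<in> G \<Longrightarrow> G \<turnstile> p"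
| ImpI: "insert p G \<turnstile> q \<Longrightarrow> G \<turnstile> Imp p q"
| ImpE: "G \<turnstile> Imp p q \<Longrightarrow> G \<turnstile> p \<Longrightarrow> G \<turnstile> q"
| Class: "insert (Neg p) G \<turnstile> Bot \<Longrightarrow> G \<turnstile> p"
| AllNI: "liftN ` G \<turnstile> p \<Longrightarrow> G \<turnstile> AllN p"
| AllNE: "G \<turnstile> AllN p \<Longrightarrow> G \<turnstile> instN t p"
| AllSI: "liftS ` G \<turnstile> p \<Longrightarrow> G \<turnstile> AllS p"
| AllSE: "G \<turnstile> AllS p \<Longrightarrow> G \<turnstile> instS Y p"
| EqI: "G \<turnstile> Eq t t"
| EqE: "G \<turnstile> Eq t u \<Longrightarrow> G \<turnstile> instN t p \<Longrightarrow> G \<turnstile> instN u p"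

text \<open>Equivalence over T of two axiom schemes.  For two single sentences this amounts, by the
  deduction theorem, to derivability of their biconditional from T.\<close>

definition equivalent_over :: "fm set \<Rightarrow> fm set \<Rightarrow> fm set \<Rightarrow> bool" where
  "equivalent_over T A B \<longleftrightarrow> (\<forall>p\<in>B. T \<union> A \<turnstile> p) \<and> (\<forall>p\<in>A. T \<union> B \<turnstile> p)"


section \<open>The arithmetical hierarchy and the axiom systems\<close>

definition Leq :: "tm \<Rightarrow> tm \<Rightarrow> fm" where
  "Leq t u = Or (Less t u) (Eq t u)"

text \<open>Bounded quantifiers; the bound is lifted, hence does not contain the bound variable.\<close>

definition AllB :: "tm \<Rightarrow> fm \<Rightarrow> fm" where
  "AllB t p = AllN (Less (Var 0) (lift 1 t) \<^bold>\<longrightarrow> p)"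

definition ExB :: "tm \<Rightarrow> fm \<Rightarrow> fm" where
  "ExB t p = ExN (Less (Var 0) (lift 1 t) \<^bold>\<and> p)"

text \<open>Free set variables are allowed.  The remaining connectives are covered because they
  are abbreviations in terms of Bot and Imp.\<close>

inductive Sigma00 :: "fm \<Rightarrow> bool" where
  "Sigma00 Bot"
| "Sigma00 (Eq t u)"
| "Sigma00 (Less t u)"
| "Sigma00 (Mem t X)"
| "Sigma00 p \<Longrightarrow> Sigma00 q \<Longrightarrow> Sigma00 (Imp p q)"
| "Sigma00 p \<Longrightarrow> Sigma00 (AllB t p)"
| "Sigma00 p \<Longrightarrow> Sigma00 (ExB t p)"

definition Sigma01 :: "fm \<Rightarrow> bool" where
  "Sigma01 p \<longleftrightarrow> (\<exists>q. Sigma00 q \<and> p = ExN q)"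

definition Pi01 :: "fm \<Rightarrow> bool" where
  "Pi01 p \<longleftrightarrow> (\<exists>q. Sigma00 q \<and> p = AllN q)"

definition Sigma02 :: "fm \<Rightarrow> bool" where
  "Sigma02 p \<longleftrightarrow> (\<exists>q. Sigma00 q \<and> p = ExN (AllN q))"

text \<open>Basic axioms for the successor, addition, multiplication, order and exponentiation.\<close>

definition basic_axioms :: "fm set" where
  "basic_axioms =
    (let m = Var 1; n = Var 0 in
     {AllN (Neg (Eq (Plus n One) Zero)),
      AllN (AllN (Eq (Plus m One) (Plus n One) \<^bold>\<longrightarrow> Eq m n)),
      AllN (Eq (Plus n Zero) n),
      AllN (AllN (Eq (Plus m (Plus n One)) (Plus (Plus m n) One))),
      AllN (Eq (Times n Zero) Zero),
      AllN (AllN (Eq (Times m (Plus n One)) (Plus (Times m n) m))),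
      AllN (Neg (Less n Zero)),
      AllN (AllN (Less m (Plus n One) \<^bold>\<longleftrightarrow> (Less m n \<^bold>\<or> Eq m n))),
      AllN (Eq (Exp n Zero) One),
      AllN (AllN (Eq (Exp m (Plus n One)) (Times (Exp m n) m)))})"

text \<open>Induction on number variable 0 of p: the second premise replaces it by its successor,
  the other variables being kept.\<close>

definition induction_for :: "fm \<Rightarrow> fm" where
  "induction_for p =
    (instN Zero p
      \<^bold>\<and> AllN (p \<^bold>\<longrightarrow> fsubst (case_nat (Plus (Var 0) One) (\<lambda>i. Var (Suc i))) id p)
     \<^bold>\<longrightarrow> AllN p)"

text \<open>The comprehended variable is number variable 0 of p and q; the lifting ensures that
  the new set does not occur in p.\<close>

definition comprehension_for :: "fm \<Rightarrow> fm \<Rightarrow> fm" where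
  "comprehension_for p q =
    (AllN (p \<^bold>\<longleftrightarrow> q) \<^bold>\<longrightarrow> ExS (AllN (Mem (Var 0) 0 \<^bold>\<longleftrightarrow> liftS p)))"

definition ISigma00 :: "fm set" where
  "ISigma00 = (\<Union>p \<in> {p. Sigma00 p}. closures (induction_for p))"

definition ISigma02 :: "fm set" where
  "ISigma02 = (\<Union>p \<in> {p. Sigma02 p}. closures (induction_for p))"

definition Delta01_CA :: "fm set" where
  "Delta01_CA = (\<Union>(p, q) \<in> {(p, q). Sigma01 p \<and> Pi01 q}. closures (comprehension_for p q))"

definition RCA0star :: "fm set" where
  "RCA0star = basic_axioms \<union> ISigma00 \<union> Delta01_CA"


section \<open>Coding of pairs and of finite sets\<close>

text \<open>There is exactly one x with p(x), written as: for some y, for all x, p(x) iff x = y.\<close>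

definition Ex1N :: "fm \<Rightarrow> fm" where
  "Ex1N p = ExN (AllN (fsubst (case_nat (Var 0) (\<lambda>i. Var (i + 2))) id p
                        \<^bold>\<longleftrightarrow> Eq (Var 0) (Var 1)))"

definition Two :: tm where
  "Two = Plus One One"

text \<open>The pairing function (i, j) = (i + j)^2 + i.\<close>

definition Pairing :: "tm \<Rightarrow> tm \<Rightarrow> tm" where
  "Pairing t u = Plus (Times (Plus t u) (Plus t u)) t"

text \<open>The number h codes the finite set of positions of the digit 1 in its binary expansion:
  x belongs to it iff h = (2 q + 1) 2^x + r for some q and some r < 2^x.\<close>

definition FMem :: "tm \<Rightarrow> tm \<Rightarrow> fm" where
  "FMem x h =
    ExB (Plus h One) (ExB (Exp Two (lift 1 x))
      (let q = Var 1; r = Var 0 in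
       Eq (lift 2 h)
          (Plus (Times (Plus (Times Two q) One) (Exp Two (lift 2 x))) r)))"

text \<open>The finite set h has exactly m elements: some finite set f of pairs is the graph of a
  bijection from \<open>{0, ..., m - 1}\<close> onto h.\<close>

definition FCard :: "tm \<Rightarrow> tm \<Rightarrow> fm" where
  "FCard h m =
    ExN
     (AllN (AllN (FMem (Pairing (Var 1) (Var 0)) (Var 2)
         \<^bold>\<longrightarrow> Less (Var 1) (lift 3 m) \<^bold>\<and> FMem (Var 0) (lift 3 h)))
      \<^bold>\<and> AllB (lift 1 m) (Ex1N (FMem (Pairing (Var 1) (Var 0)) (Var 2)))
      \<^bold>\<and> AllN (FMem (Var 0) (lift 2 h)
         \<^bold>\<longrightarrow> Ex1N (FMem (Pairing (Var 0) (Var 1)) (Var 2))))"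

definition FCard_ge :: "tm \<Rightarrow> tm \<Rightarrow> fm" where
  "FCard_ge h n = ExN (FCard (lift 1 h) (Var 0) \<^bold>\<and> Leq (lift 1 n) (Var 0))"

definition FCard_le :: "tm \<Rightarrow> tm \<Rightarrow> fm" where
  "FCard_le h n = ExN (FCard (lift 1 h) (Var 0) \<^bold>\<and> Leq (Var 0) (lift 1 n))"

definition FSubset :: "tm \<Rightarrow> nat \<Rightarrow> fm" where
  "FSubset h X = AllN (FMem (Var 0) (lift 1 h) \<^bold>\<longrightarrow> Mem (Var 0) X)"


section \<open>Gaps and piecewise syndetic sets\<close>

text \<open>x < y are consecutive elements of the finite set h.\<close>

definition Consecutive :: "tm \<Rightarrow> tm \<Rightarrow> tm \<Rightarrow> fm" where
  "Consecutive h x y =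
    (FMem x h \<^bold>\<and> FMem y h \<^bold>\<and> Less x y
     \<^bold>\<and> Neg (ExN (FMem (Var 0) (lift 1 h) \<^bold>\<and> Less (lift 1 x) (Var 0) \<^bold>\<and> Less (Var 0) (lift 1 y))))"

definition Gaps_le :: "tm \<Rightarrow> tm \<Rightarrow> fm" where
  "Gaps_le h d =
    AllN (AllN (Consecutive (lift 2 h) (Var 1) (Var 0)
      \<^bold>\<longrightarrow> Leq (Var 0) (Plus (Var 1) (lift 2 d))))"

text \<open>gs(h) = g.\<close>

definition GapSize :: "tm \<Rightarrow> tm \<Rightarrow> fm" where
  "GapSize h g =
    ((FCard_le h One \<^bold>\<and> Eq g One)
     \<^bold>\<or> (Neg (FCard_le h One)
        \<^bold>\<and> ExN (ExN (Consecutive (lift 2 h) (Var 1) (Var 0)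
             \<^bold>\<and> Eq (Var 0) (Plus (Var 1) (lift 2 g))))
        \<^bold>\<and> Gaps_le h g))"

definition GapSize_le :: "tm \<Rightarrow> tm \<Rightarrow> fm" where
  "GapSize_le h d = ExN (GapSize (lift 1 h) (Var 0) \<^bold>\<and> Leq (Var 0) (lift 1 d))"

text \<open>There is d such that for all n there is h with h contained in X, |h| \<open>\<ge>\<close> n and gaps
  of h bounded by d.\<close>

definition PiecewiseSyndetic :: "nat \<Rightarrow> fm" where
  "PiecewiseSyndetic X =
    ExN (AllN (ExN
      (let d = Var 2; n = Var 1; h = Var 0 in
       FSubset h X \<^bold>\<and> FCard_ge h n \<^bold>\<and> Gaps_le h d)))"


section \<open>Brown's lemma and partition regularity\<close>

text \<open>The set C is (the graph of) a function from the natural numbers to r.\<close>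

definition Coloring :: "nat \<Rightarrow> tm \<Rightarrow> fm" where
  "Coloring C r =
    (AllN (Mem (Var 0) C
        \<^bold>\<longrightarrow> ExN (ExB (lift 2 r) (Eq (Var 2) (Pairing (Var 1) (Var 0)))))
     \<^bold>\<and> AllN (Ex1N (Less (Var 0) (lift 2 r) \<^bold>\<and> Mem (Pairing (Var 1) (Var 0)) C)))"

text \<open>C has some constant value c on the set H, respectively on the finite set h.\<close>

definition Homogeneous :: "nat \<Rightarrow> nat \<Rightarrow> fm" where
  "Homogeneous C H = ExN (AllN (Mem (Var 0) H \<^bold>\<longrightarrow> Mem (Pairing (Var 0) (Var 1)) C))"

definition FHomogeneous :: "nat \<Rightarrow> tm \<Rightarrow> fm" where
  "FHomogeneous C h = ExN (AllN (FMem (Var 0) (lift 2 h) \<^bold>\<longrightarrow> Mem (Pairing (Var 0) (Var 1)) C))"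

text \<open>The sets \<open>Z_i = {x. (x, i) \<in> Z}\<close>, for i < r, are pairwise disjoint with union X.
  The number r is a number of the theory, and parts may be empty.\<close>

definition Partition :: "nat \<Rightarrow> nat \<Rightarrow> tm \<Rightarrow> fm" where
  "Partition X Z r =
    (AllN (Mem (Var 0) X \<^bold>\<longleftrightarrow> ExB (lift 1 r) (Mem (Pairing (Var 1) (Var 0)) Z))
     \<^bold>\<and> AllN (AllB (lift 1 r) (AllB (lift 2 r)
          (Mem (Pairing (Var 2) (Var 1)) Z \<^bold>\<and> Mem (Pairing (Var 2) (Var 0)) Z
           \<^bold>\<longrightarrow> Eq (Var 1) (Var 0)))))"

text \<open>For all r and C: if C is a coloring with r colors, then there is a C-homogeneous
  piecewise syndetic set H.\<close>

definition Brown :: fm where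
  "Brown =
    AllN (AllS (Coloring 0 (Var 0)
      \<^bold>\<longrightarrow> ExS (Homogeneous 1 0 \<^bold>\<and> PiecewiseSyndetic 0)))"

text \<open>For all r, X and Z: if X is piecewise syndetic and partitioned by Z into r parts, then for
  some i < r the i-th part Y is piecewise syndetic.  In the scope of ExS, the indices of the set
  variables Y, Z, X are 0, 1, 2.\<close>

definition PartitionRegularity :: fm where
  "PartitionRegularity =
    AllN (AllS (AllS (PiecewiseSyndetic 1 \<^bold>\<and> Partition 1 0 (Var 0)
      \<^bold>\<longrightarrow> ExB (Var 0) (ExS
             (AllN (Mem (Var 0) 0 \<^bold>\<longleftrightarrow> Mem (Pairing (Var 0) (Var 1)) 1)
              \<^bold>\<and> PiecewiseSyndetic 0)))))"

text \<open>For all r and C: if C is a coloring with r colors, then there is d such that for all n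
  there is a C-homogeneous finite h with |h| \<open>\<ge>\<close> n and gs(h) \<open>\<le>\<close> d.\<close>

definition WeakBrown :: fm where
  "WeakBrown =
    AllN (AllS (Coloring 0 (Var 0)
      \<^bold>\<longrightarrow> ExN (AllN (ExN
            (let d = Var 2; n = Var 1; h = Var 0 in
             FHomogeneous 0 h \<^bold>\<and> FCard_ge h n \<^bold>\<and> GapSize_le h d)))))"

end

theory Submission
  imports Defs "HOL-Library.Countable_Set"
begin

text \<open>By the completeness theorem it suffices to show that in every model of \<open>RCA\<^sub>0\<^sup>*\<close> the
  statements imply each other in the order Brown's lemma, weak Brown's lemma, Sigma-2 induction,
  partition regularity, Brown's lemma.  Sigma-2 induction is used to discard the parts of a partition
  one by one while keeping control of the gaps.  Conversely, given numbers \<open>w\<^sub>i(x)\<close> for i < r,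
  colour x by the set of all i such that the quotient of x by \<open>w\<^sub>i(x)\<close> is odd.  If \<open>w\<^sub>i(x)\<close>
  has a limit above d, then sets with gaps bounded by d that are homogeneous for this colouring have
  bounded size.  Weak Brown's lemma thus bounds all existing limits by a single number d.  Applied to
  approximations of least witnesses, this gives first strong bounding for Sigma-1 formulas and then
  a bound on the witnesses of a Sigma-2 formula, which reduces Sigma-2 induction to bounded
  induction.\<close>

section \<open>Substitution and semantics\<close>

text \<open>What makes a single application of weak Brown's lemma strong is uniformity: the r block
  colourings are superposed in one colouring with \<open>2 \<up> r\<close> colours, so one d serves
  every i < r, although it is not decided for which i the approximation converges. Two rounds are
  needed because the guess at the least y with P i y z for all z settles only once all refutable
  smaller candidates are refuted by a common stage. Such a stage is what strong bounding supplies,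
  and strong bounding itself concerns guesses that never change after they appear. The other
  obstacle is that the base theory has induction for bounded formulas only. Hence the formulas in
  bounded inductions carry explicit bounds on all quantifiers, functions and cardinalities are
  handled through codes instead of recursion, and exponentiation supplies the bound
  \<open>2 \<up> n\<close> for codes of subsets of n. Counting is kept to a minimum: sets with
  bounded gaps are traded for long intervals in which every short window is hit, the link being a
  pigeonhole principle for coded relations.\<close>

declare One_nat_def [simp del]

lemma tsubst_tsubst: "tsubst s (tsubst r t) = tsubst (tsubst s \<circ> r) t"
  by (induction t) auto

lemma tsubst_Var [simp]: "tsubst Var t = t"
  by (induction t) auto

lemma tsubst_case_nat_lift: "tsubst (case_nat u s) (lift 1 t) = tsubst s t"
  by (simp add: lift_def tsubst_tsubst comp_def One_nat_def)

lemma tsubst_lift1: "tsubst (case_nat (Var 0) (\<lambda>i. lift 1 (s i))) (lift 1 t) = lift 1 (tsubst s t)"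
  by (simp add: lift_def tsubst_tsubst comp_def One_nat_def)

lemma fsubst_fsubst: "fsubst s r (fsubst s' r' p) = fsubst (tsubst s \<circ> s') (r \<circ> r') p"
proof (induction p arbitrary: s r s' r')
  case (AllN p)
  have "tsubst (case_nat (Var 0) (\<lambda>i. lift 1 (s i))) \<circ> case_nat (Var 0) (\<lambda>i. lift 1 (s' i))
      = case_nat (Var 0) (\<lambda>i. lift 1 ((tsubst s \<circ> s') i))"
    by (rule ext) (auto simp: tsubst_lift1 split: nat.split)
  then show ?case by (simp add: AllN)
next
  case (AllS p)
  have "case_nat 0 (\<lambda>X. Suc (r X)) \<circ> case_nat 0 (\<lambda>X. Suc (r' X))
      = case_nat 0 (\<lambda>X. Suc ((r \<circ> r') X))"
    by (rule ext) (auto split: nat.split)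
  then show ?case by (simp add: AllS)
qed (auto simp: tsubst_tsubst comp_def)

lemma fsubst_Var [simp]: "fsubst Var id p = p"
proof (induction p)
  case (AllN p)
  have "case_nat (Var 0) (\<lambda>i. lift 1 (Var i)) = Var"
    by (auto simp: lift_def fun_eq_iff split: nat.split)
  then show ?case using AllN by simp
next
  case (AllS p)
  have "case_nat 0 (\<lambda>X. Suc (id X)) = id"
    by (auto simp: fun_eq_iff split: nat.split)
  then show ?case using AllS by (metis fsubst.simps(7))
qed simp_all

lemma tsubst_cong_closed: "closed_tm n t \<Longrightarrow> (\<And>i. i < n \<Longrightarrow> s i = s' i) \<Longrightarrow> tsubst s t = tsubst s' t"
  by (induction t) auto

lemma fsubst_cong_closed:
  "closed_fm n m p \<Longrightarrow> (\<And>i. i < n \<Longrightarrow> s i = s' i) \<Longrightarrow> (\<And>X. X < m \<Longrightarrow> r X = r' X)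
   \<Longrightarrow> fsubst s r p = fsubst s' r' p"
proof (induction p arbitrary: n m s s' r r')
  case (AllN p)
  show ?case
    using AllN.prems
    by (auto intro!: AllN.IH[of "Suc n" m] split: nat.split)
next
  case (AllS p)
  show ?case
    using AllS.prems
    by (auto intro!: AllS.IH[of n "Suc m"] split: nat.split)
next
  case (Imp p q)
  show ?case using Imp.IH[of n m s s' r r'] Imp.prems by auto
qed (auto intro: tsubst_cong_closed)

lemma closed_tm_mono: "closed_tm n t \<Longrightarrow> n \<le> n' \<Longrightarrow> closed_tm n' t"
  by (induction t) auto

lemma closed_fm_mono: "closed_fm n m p \<Longrightarrow> n \<le> n' \<Longrightarrow> m \<le> m' \<Longrightarrow> closed_fm n' m' p"
proof (induction p arbitrary: n m n' m')
  case (AllN p)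
  then show ?case by (metis Suc_le_mono closed_fm.simps(6))
next
  case (AllS p)
  then show ?case by (metis Suc_le_mono closed_fm.simps(7))
next
  case (Imp p q)
  then show ?case by (metis closed_fm.simps(5))
qed (auto intro: closed_tm_mono)

lemma ex_closed_tm: "\<exists>n. closed_tm n t"
proof (induction t)
  case (Var x)
  then show ?case by (auto intro: exI[of _ "Suc x"])
next
  case (Plus t u)
  then show ?case by (metis closed_tm.simps(4) closed_tm_mono nat_le_linear)
next
  case (Times t u)
  then show ?case by (metis closed_tm.simps(5) closed_tm_mono nat_le_linear)
next
  case (Exp t u)
  then show ?case by (metis closed_tm.simps(6) closed_tm_mono nat_le_linear)
qed auto

lemma ex_closed_fm: "\<exists>n. closed_fm n n p"
proof (induction p)
  case (Eq t u)
  then show ?case by (metis closed_fm.simps(2) closed_tm_mono nat_le_linear ex_closed_tm)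
next
  case (Less t u)
  then show ?case by (metis closed_fm.simps(3) closed_tm_mono nat_le_linear ex_closed_tm)
next
  case (Mem t X)
  obtain n where "closed_tm n t" using ex_closed_tm by blast
  then show ?case by (auto intro!: exI[of _ "max n (Suc X)"] intro: closed_tm_mono)
next
  case (Imp p q)
  then obtain n n' where "closed_fm n n p" "closed_fm n' n' q" by blast
  then have "closed_fm (max n n') (max n n') (Imp p q)" by (auto intro: closed_fm_mono)
  then show ?case by blast
next
  case (AllN p)
  then obtain n where "closed_fm n n p" by blast
  then show ?case by (auto intro!: exI[of _ n] intro: closed_fm_mono)
next
  case (AllS p)
  then obtain n where "closed_fm n n p" by blast
  then show ?case by (auto intro!: exI[of _ n] intro: closed_fm_mono)
qed auto

text \<open>Set quantifiers range over an arbitrary family \<open>msets\<close> (Henkin semantics);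
  for the full power set the completeness theorem would fail.\<close>

record 'a model =
  mzero :: 'a
  mone :: 'a
  mplus :: "'a \<Rightarrow> 'a \<Rightarrow> 'a"
  mtimes :: "'a \<Rightarrow> 'a \<Rightarrow> 'a"
  mexp :: "'a \<Rightarrow> 'a \<Rightarrow> 'a"
  mless :: "'a \<Rightarrow> 'a \<Rightarrow> bool"
  msets :: "'a set set"

primrec ev :: "'a model \<Rightarrow> (nat \<Rightarrow> 'a) \<Rightarrow> tm \<Rightarrow> 'a" where
  "ev M e (Var i) = e i"
| "ev M e Zero = mzero M"
| "ev M e One = mone M"
| "ev M e (Plus t u) = mplus M (ev M e t) (ev M e u)"
| "ev M e (Times t u) = mtimes M (ev M e t) (ev M e u)"
| "ev M e (Exp t u) = mexp M (ev M e t) (ev M e u)"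

primrec sat :: "'a model \<Rightarrow> (nat \<Rightarrow> 'a) \<Rightarrow> (nat \<Rightarrow> 'a set) \<Rightarrow> fm \<Rightarrow> bool" where
  "sat M e E Bot = False"
| "sat M e E (Eq t u) = (ev M e t = ev M e u)"
| "sat M e E (Less t u) = mless M (ev M e t) (ev M e u)"
| "sat M e E (Mem t X) = (ev M e t \<in> E X)"
| "sat M e E (Imp p q) = (sat M e E p \<longrightarrow> sat M e E q)"
| "sat M e E (AllN p) = (\<forall>x. sat M (case_nat x e) E p)"
| "sat M e E (AllS p) = (\<forall>X\<in>msets M. sat M e (case_nat X E) p)"

lemma ev_tsubst: "ev M e (tsubst s t) = ev M (\<lambda>i. ev M e (s i)) t"
  by (induction t) auto

lemma ev_lift: "ev M e (lift k t) = ev M (\<lambda>i. e (i + k)) t"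
  by (simp add: lift_def ev_tsubst)

lemma ev_lift1: "ev M (case_nat x e) (lift 1 t) = ev M e t"
  by (simp add: ev_lift One_nat_def)

lemma sat_fsubst: "sat M e E (fsubst s r p) = sat M (\<lambda>i. ev M e (s i)) (\<lambda>X. E (r X)) p"
proof (induction p arbitrary: e E s r)
  case (AllN p)
  have "(\<lambda>i. ev M (case_nat x e) (case_nat (Var 0) (\<lambda>i. lift 1 (s i)) i))
      = case_nat x (\<lambda>i. ev M e (s i))" for x
    by (rule ext) (auto simp: ev_lift1 split: nat.split)
  then show ?case by (simp add: AllN)
next
  case (AllS p)
  have "(\<lambda>Y. case_nat X E (case_nat 0 (\<lambda>X. Suc (r X)) Y)) = case_nat X (\<lambda>Y. E (r Y))" for X
    by (rule ext) (auto split: nat.split)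
  then show ?case by (simp add: AllS)
qed (auto simp: ev_tsubst)

lemma sat_cong_closed:
  assumes "closed_fm n m p" "\<And>i. i < n \<Longrightarrow> e i = e' i" "\<And>X. X < m \<Longrightarrow> E X = E' X"
  shows "sat M e E p = sat M e' E' p"
proof -
  have tm: "ev M e t = ev M e' t" if "closed_tm n t" "\<And>i. i < n \<Longrightarrow> e i = e' i" for n t e e'
    using that by (induction t) auto
  show ?thesis using assms
  proof (induction p arbitrary: n m e e' E E')
    case (AllN p)
    have "sat M (case_nat x e) E p = sat M (case_nat x e') E' p" for x
      using AllN.prems by (intro AllN.IH[of "Suc n" m]) (auto split: nat.split)
    then show ?case by simp
  next
    case (AllS p)
    have "sat M e (case_nat x E) p = sat M e' (case_nat x E') p" for x
      using AllS.prems by (intro AllS.IH[of n "Suc m"]) (auto split: nat.split)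
    then show ?case by simp
  next
    case (Imp p q)
    then show ?case by (metis closed_fm.simps(5) sat.simps(5))
  next
    case (Eq t u) then show ?case using tm[of n t e e'] tm[of n u e e'] by simp
  next
    case (Less t u) then show ?case using tm[of n t e e'] tm[of n u e e'] by simp
  next
    case (Mem t X) then show ?case using tm[of n t e e'] by simp
  qed simp
qed

definition valid :: "'a model \<Rightarrow> fm \<Rightarrow> bool" where
  "valid M p \<longleftrightarrow> (\<forall>e E. range E \<subseteq> msets M \<longrightarrow> sat M e E p)"

text \<open>If \<open>msets M\<close> were empty there would be no assignment to the set variables
  and every formula would be valid in M.\<close>

definition models :: "'a model \<Rightarrow> fm set \<Rightarrow> bool" (infix "\<Turnstile>" 50) where
  "M \<Turnstile> T \<longleftrightarrow> msets M \<noteq> {} \<and> (\<forall>p\<in>T. valid M p)"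

lemma case_nat_Suc_eta: "case_nat (f 0) (\<lambda>i. f (Suc i)) = f"
  by (rule ext) (simp split: nat.split)

lemma valid_AllN [simp]: "valid M (AllN p) = valid M p"
  unfolding valid_def sat.simps by (metis case_nat_Suc_eta)

lemma valid_AllS [simp]: "valid M (AllS p) = valid M p"
proof
  assume *: "valid M (AllS p)"
  show "valid M p" unfolding valid_def
  proof (intro allI impI)
    fix e and E :: "nat \<Rightarrow> 'a set"
    assume "range E \<subseteq> msets M"
    moreover from this have "range (\<lambda>i. E (Suc i)) \<subseteq> msets M" "E 0 \<in> msets M" by auto
    ultimately have "sat M e (case_nat (E 0) (\<lambda>i. E (Suc i))) p"
      using * unfolding valid_def sat.simps by blast
    then show "sat M e E p" by (simp add: case_nat_Suc_eta)
  qed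
next
  assume "valid M p"
  moreover have "range (case_nat X E) \<subseteq> msets M" if "X \<in> msets M" "range E \<subseteq> msets M" for X E
    using that by (fastforce split: nat.splits)
  ultimately show "valid M (AllS p)" by (simp add: valid_def)
qed

text \<open>Validity already quantifies over all assignments, so it absorbs leading universal
  quantifiers. Axiom schemes can therefore be treated through their open instances.\<close>

lemma valid_closures: "q \<in> closures p \<Longrightarrow> valid M q = valid M p"
proof -
  have "valid M ((AllN ^^ n) q) = valid M q" "valid M ((AllS ^^ n) q) = valid M q" for n q
    by (induction n) auto
  then show "q \<in> closures p \<Longrightarrow> valid M q = valid M p" by (auto simp: closures_def)
qed

lemma closures_nonempty: "closures p \<noteq> {}"
  using ex_closed_fm[of p] by (auto simp: closures_def)

lemma closed_closures: "q \<in> closures p \<Longrightarrow> closed_fm 0 0 q"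
proof -
  have *: "closed_fm 0 m ((AllN ^^ n) q)" if "closed_fm n m q" for n m q
    using that by (induction n arbitrary: q) (auto simp: funpow_swap1)
  have **: "closed_fm n 0 ((AllS ^^ m) q)" if "closed_fm n m q" for n m q
    using that by (induction m arbitrary: q) (auto simp: funpow_swap1)
  assume "q \<in> closures p"
  then show ?thesis using * ** by (auto simp: closures_def)
qed

lemma models_Un [simp]: "M \<Turnstile> A \<union> B \<longleftrightarrow> M \<Turnstile> A \<and> M \<Turnstile> B"
  by (auto simp: models_def)

section \<open>Derivations\<close>

lemma derives_mono: "G \<turnstile> p \<Longrightarrow> G \<subseteq> H \<Longrightarrow> H \<turnstile> p"
proof (induction arbitrary: H rule: derives.induct)
  case (Assm p G)
  then show ?case by (intro derives.Assm) blast
next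
  case (ImpI p G q)
  show ?case by (rule derives.ImpI, rule ImpI.IH) (use ImpI.prems in blast)
next
  case (ImpE G p q)
  then show ?case by (blast intro: derives.ImpE[of H p q])
next
  case (Class p G)
  show ?case by (rule derives.Class, rule Class.IH) (use Class.prems in blast)
next
  case (AllNI G p)
  show ?case by (rule derives.AllNI, rule AllNI.IH) (use AllNI.prems in blast)
next
  case (AllNE G p t)
  show ?case by (rule derives.AllNE, rule AllNE.IH) fact
next
  case (AllSI G p)
  show ?case by (rule derives.AllSI, rule AllSI.IH) (use AllSI.prems in blast)
next
  case (AllSE G p Y)
  show ?case by (rule derives.AllSE, rule AllSE.IH) fact
next
  case (EqI G t)
  show ?case by (rule derives.EqI)
next
  case (EqE G t u p)
  show ?case using EqE.IH[OF EqE.prems] by (rule derives.EqE)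
qed

lemma fsubst_liftN:
  "fsubst (case_nat (Var 0) (\<lambda>i. lift 1 (s i))) r (liftN p) = liftN (fsubst s r p)"
  by (simp add: liftN_def fsubst_fsubst comp_def lift_def id_def One_nat_def)

lemma fsubst_liftS:
  "fsubst s (case_nat 0 (\<lambda>X. Suc (r X))) (liftS p) = liftS (fsubst s r p)"
  by (simp add: liftS_def fsubst_fsubst comp_def)

lemma fsubst_instN:
  "fsubst s r (instN t p) = instN (tsubst s t) (fsubst (case_nat (Var 0) (\<lambda>i. lift 1 (s i))) r p)"
proof -
  have "tsubst s \<circ> case_nat t Var
      = tsubst (case_nat (tsubst s t) Var) \<circ> case_nat (Var 0) (\<lambda>i. lift 1 (s i))"
    by (rule ext) (simp add: tsubst_case_nat_lift split: nat.split)
  then show ?thesis by (simp add: instN_def fsubst_fsubst)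
qed

lemma fsubst_instS:
  "fsubst s r (instS Y p) = instS (r Y) (fsubst s (case_nat 0 (\<lambda>X. Suc (r X))) p)"
proof -
  have "r \<circ> case_nat Y id = case_nat (r Y) id \<circ> case_nat 0 (\<lambda>X. Suc (r X))"
    by (rule ext) (simp split: nat.split)
  then show ?thesis by (simp add: instS_def fsubst_fsubst comp_def)
qed

text \<open>Serves to rename a fresh variable into variable 0, the eigenvariable that the
  introduction rules for quantifiers prescribe.\<close>

lemma derives_fsubst: "G \<turnstile> p \<Longrightarrow> fsubst s r ` G \<turnstile> fsubst s r p"
proof (induction arbitrary: s r rule: derives.induct)
  case (Assm p G) then show ?case by (auto intro: derives.Assm)
next
  case (ImpI p G q) then show ?case by (auto intro!: derives.ImpI)
next
  case (ImpE G p q) then show ?case using derives.ImpE[of "fsubst s r ` G" "fsubst s r p"] by simp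
next
  case (Class p G)
  then show ?case using derives.Class[of "fsubst s r p" "fsubst s r ` G"] by auto
next
  case (AllNI G p)
  from AllNI.IH[of "case_nat (Var 0) (\<lambda>i. lift 1 (s i))" r]
  show ?case by (auto intro!: derives.AllNI simp: image_image fsubst_liftN)
next
  case (AllNE G p t)
  then show ?case by (auto simp: fsubst_instN intro!: derives.AllNE)
next
  case (AllSI G p)
  from AllSI.IH[of s "case_nat 0 (\<lambda>X. Suc (r X))"]
  show ?case by (auto intro!: derives.AllSI simp: image_image fsubst_liftS)
next
  case (AllSE G p Y)
  then show ?case by (auto simp: fsubst_instS intro!: derives.AllSE)
next
  case (EqI G t) then show ?case by (auto intro: derives.EqI)
next
  case (EqE G t u p)
  then show ?case using derives.EqE[of "fsubst s r ` G" "tsubst s t" "tsubst s u"]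
    by (auto simp: fsubst_instN)
qed

lemma derives_finite: "G \<turnstile> p \<Longrightarrow> \<exists>F. finite F \<and> F \<subseteq> G \<and> (F \<turnstile> p)"
proof (induction rule: derives.induct)
  case (Assm p G)
  then show ?case by (intro exI[of _ "{p}"]) (simp add: derives.Assm)
next
  case (ImpI p G q)
  then obtain F where F: "finite F" "F \<subseteq> insert p G" "F \<turnstile> q" by blast
  have "F - {p} \<turnstile> Imp p q"
    by (rule derives.ImpI, rule derives_mono[OF F(3)]) blast
  with F show ?case by (intro exI[of _ "F - {p}"]) auto
next
  case (ImpE G p q)
  then obtain F F' where F: "finite F" "F \<subseteq> G" "F \<turnstile> Imp p q" "finite F'" "F' \<subseteq> G" "F' \<turnstile> p"
    by blast
  have "F \<union> F' \<turnstile> q"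
    by (rule derives.ImpE[OF derives_mono[OF F(3)] derives_mono[OF F(6)]]) auto
  with F show ?case by (intro exI[of _ "F \<union> F'"]) auto
next
  case (Class p G)
  then obtain F where F: "finite F" "F \<subseteq> insert (Neg p) G" "F \<turnstile> Bot" by blast
  have "F - {Neg p} \<turnstile> p"
    by (rule derives.Class, rule derives_mono[OF F(3)]) blast
  with F show ?case by (intro exI[of _ "F - {Neg p}"]) auto
next
  case (AllNI G p)
  then obtain F where F: "finite F" "F \<subseteq> liftN ` G" "F \<turnstile> p" by blast
  then obtain F' where F': "F' \<subseteq> G" "finite F'" "F = liftN ` F'"
    using finite_subset_image by metis
  have "F' \<turnstile> AllN p" using F(3) unfolding F'(3) by (rule derives.AllNI)
  with F' show ?case by (intro exI[of _ F']) simp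
next
  case (AllNE G p t)
  then obtain F where F: "finite F" "F \<subseteq> G" "F \<turnstile> AllN p" by blast
  from derives.AllNE[OF F(3)] F show ?case by (intro exI[of _ F]) simp
next
  case (AllSI G p)
  then obtain F where F: "finite F" "F \<subseteq> liftS ` G" "F \<turnstile> p" by blast
  then obtain F' where F': "F' \<subseteq> G" "finite F'" "F = liftS ` F'"
    using finite_subset_image by metis
  have "F' \<turnstile> AllS p" using F(3) unfolding F'(3) by (rule derives.AllSI)
  with F' show ?case by (intro exI[of _ F']) simp
next
  case (AllSE G p Y)
  then obtain F where F: "finite F" "F \<subseteq> G" "F \<turnstile> AllS p" by blast
  from derives.AllSE[OF F(3)] F show ?case by (intro exI[of _ F]) simp
next
  case (EqI G t)
  show ?case by (intro exI[of _ "{}"]) (simp add: derives.EqI)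
next
  case (EqE G t u p)
  then obtain F F' where F: "finite F" "F \<subseteq> G" "F \<turnstile> Eq t u" "finite F'" "F' \<subseteq> G" "F' \<turnstile> instN t p"
    by blast
  have "F \<union> F' \<turnstile> instN u p"
    by (rule derives.EqE[OF derives_mono[OF F(3)] derives_mono[OF F(6)]]) auto
  with F show ?case by (intro exI[of _ "F \<union> F'"]) auto
qed

lemma derives_cut: "G \<turnstile> p \<Longrightarrow> insert p G \<turnstile> q \<Longrightarrow> G \<turnstile> q"
  by (rule derives.ImpE[OF derives.ImpI])

section \<open>Completeness\<close>

lemma case_nat_1 [simp]: "case_nat a f 1 = f 0"
  by (simp add: One_nat_def)

instance tm :: countable
  by countable_datatype

instance fm :: countable
  by countable_datatype

definition consistent :: "fm set \<Rightarrow> bool" where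
  "consistent G \<longleftrightarrow> \<not> (G \<turnstile> Bot)"

text \<open>Variable n is free in no member of G and so can act as a Henkin constant; the language
  need not be extended.\<close>

lemma consistent_witnessN:
  assumes G: "\<forall>p\<in>G. closed_fm n n p" and q: "Neg (AllN q) \<in> G" and con: "consistent G"
  shows "consistent (insert (Neg (instN (Var n) q)) G)"
proof (rule ccontr)
  assume "\<not> ?thesis"
  then have "G \<turnstile> instN (Var n) q"
    by (simp add: consistent_def derives.Class)
  \<comment> \<open>On G, whose free variables lie below n, this agrees with \<open>liftN\<close>,
    and it undoes the instantiation of q at n. The derivation of the instance thereby becomes the
    premise of \<open>AllNI\<close>.\<close>
  let ?s = "\<lambda>i. if i = n then Var 0 else Var (Suc i)"
  have "fsubst ?s id ` G \<turnstile> fsubst ?s id (instN (Var n) q)"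
    by (rule derives_fsubst) fact
  moreover have "fsubst ?s id ` G = liftN ` G"
    using G by (intro image_cong refl) (auto simp: liftN_def intro!: fsubst_cong_closed)
  moreover have "fsubst ?s id (instN (Var n) q) = q"
  proof -
    have "closed_fm (Suc n) n q" using G q by fastforce
    then have "fsubst (tsubst ?s \<circ> case_nat (Var n) Var) id q = fsubst Var id q"
      by (rule fsubst_cong_closed) (auto split: nat.split)
    then show ?thesis by (simp add: instN_def fsubst_fsubst)
  qed
  ultimately have "G \<turnstile> AllN q" by (simp add: derives.AllNI)
  then have "G \<turnstile> Bot" using derives.ImpE[OF derives.Assm[OF q]] by blast
  then show False using con by (simp add: consistent_def)
qed

lemma consistent_witnessS:
  assumes G: "\<forall>p\<in>G. closed_fm n n p" and q: "Neg (AllS q) \<in> G" and con: "consistent G"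
  shows "consistent (insert (Neg (instS n q)) G)"
proof (rule ccontr)
  assume "\<not> ?thesis"
  then have "G \<turnstile> instS n q"
    by (simp add: consistent_def derives.Class)
  let ?r = "\<lambda>X. if X = n then 0 else Suc X"
  have "fsubst Var ?r ` G \<turnstile> fsubst Var ?r (instS n q)"
    by (rule derives_fsubst) fact
  moreover have "fsubst Var ?r ` G = liftS ` G"
    using G by (intro image_cong refl) (auto simp: liftS_def intro!: fsubst_cong_closed)
  moreover have "fsubst Var ?r (instS n q) = q"
  proof -
    have "closed_fm n (Suc n) q" using G q by fastforce
    then have "fsubst Var (?r \<circ> case_nat n id) q = fsubst Var id q"
      by (rule fsubst_cong_closed) (auto split: nat.split)
    then show ?thesis by (simp add: instS_def fsubst_fsubst comp_def)
  qed
  ultimately have "G \<turnstile> AllS q" by (simp add: derives.AllSI)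
  then have "G \<turnstile> Bot" using derives.ImpE[OF derives.Assm[OF q]] by blast
  then show False using con by (simp add: consistent_def)
qed

text \<open>Existential quantifiers are abbreviations, so negated universal formulas are the only
  ones that call for a witness.\<close>

definition witnessed :: "fm \<Rightarrow> fm set \<Rightarrow> bool" where
  "witnessed p G \<longleftrightarrow>
    (\<forall>q. p = Neg (AllN q) \<longrightarrow> (\<exists>t. Neg (instN t q) \<in> G)) \<and>
    (\<forall>q. p = Neg (AllS q) \<longrightarrow> (\<exists>Y. Neg (instS Y q) \<in> G))"

text \<open>The bound on the free variables is carried from stage to stage, since it is what
  guarantees a fresh variable for the next witness.\<close>

lemma henkin_step:
  assumes con: "consistent G" and G: "\<forall>p\<in>G. closed_fm n n p"
  shows "\<exists>G' n'. consistent G' \<and> (\<forall>q\<in>G'. closed_fm n' n' q) \<and> G \<subseteq> G' \<and>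
    (p \<in> G' \<and> witnessed p G' \<or> \<not> consistent (insert p G))"
proof (cases "consistent (insert p G)")
  case True
  obtain k where "closed_fm k k p" using ex_closed_fm by blast
  then obtain m where m: "\<forall>q\<in>insert p G. closed_fm m m q"
    using G closed_fm_mono by (metis insertE nat_le_linear)
  consider (N) q where "p = Neg (AllN q)" | (S) q where "p = Neg (AllS q)"
    | (other) "\<forall>q. p \<noteq> Neg (AllN q) \<and> p \<noteq> Neg (AllS q)" by blast
  then have "\<exists>w. consistent (insert w (insert p G)) \<and> witnessed p (insert w (insert p G))"
  proof cases
    case N
    then show ?thesis using consistent_witnessN[OF m _ True, of q]
      by (intro exI[of _ "Neg (instN (Var m) q)"]) (auto simp: witnessed_def)
  next
    case S
    then show ?thesis using consistent_witnessS[OF m _ True, of q]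
      by (intro exI[of _ "Neg (instS m q)"]) (auto simp: witnessed_def)
  next
    case other
    then show ?thesis using True by (intro exI[of _ p]) (auto simp: witnessed_def)
  qed
  then obtain w where w: "consistent (insert w (insert p G))" "witnessed p (insert w (insert p G))"
    by blast
  obtain k' where "closed_fm k' k' w" using ex_closed_fm by blast
  then obtain m' where "\<forall>q\<in>insert w (insert p G). closed_fm m' m' q"
    using m closed_fm_mono by (metis insertE nat_le_linear)
  with w show ?thesis by blast
next
  case False
  then show ?thesis using con G by blast
qed


locale henkin =
  fixes H :: "fm set"
  assumes con: "consistent H"
    and maximal: "p \<in> H \<or> \<not> consistent (insert p H)"
    and witness: "p \<in> H \<Longrightarrow> witnessed p H"

lemma henkin_extension:
  assumes con: "consistent T" and T: "\<forall>p\<in>T. closed_fm n n p"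
  shows "\<exists>H. T \<subseteq> H \<and> henkin H"
proof -
  obtain f :: "nat \<Rightarrow> fm" where f: "surj f"
    using surj_from_nat by metis
  define P where "P k G \<longleftrightarrow> (k = 0 \<longrightarrow> G = T) \<and> consistent G \<and> (\<exists>n. \<forall>p\<in>G. closed_fm n n p)"
    for k :: nat and G
  define Q where "Q k G G' \<longleftrightarrow> G \<subseteq> G' \<and> (f k \<in> G' \<and> witnessed (f k) G' \<or> \<not> consistent (insert (f k) G))"
    for k G G'
  have "\<exists>G. P 0 G" using con T by (auto simp: P_def)
  moreover have "\<exists>G'. P (Suc k) G' \<and> Q k G G'" if "P k G" for G k
    
  proof -
    obtain n where "consistent G" "\<forall>p\<in>G. closed_fm n n p" using \<open>P k G\<close> by (auto simp: P_def)
    from henkin_step[OF this, of "f k"] show ?thesis unfolding P_def Q_def by blast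
  qed
  ultimately obtain G where G: "\<And>k. P k (G k) \<and> Q k (G k) (G (Suc k))"
    using dependent_nat_choice[of P Q] by metis
  define H where "H = (\<Union>k. G k)"
  have mono: "G k \<subseteq> G l" if "k \<le> l" for k l
    by (rule lift_Suc_mono_le[OF _ that]) (use G in \<open>auto simp: Q_def\<close>)
  have bound: "\<exists>k. F \<subseteq> G k" if "finite F" "F \<subseteq> H" for F
    using that
  proof (induction F)
    case (insert x F)
    then obtain k l where "F \<subseteq> G k" "x \<in> G l" by (auto simp: H_def)
    then have "insert x F \<subseteq> G (max k l)"
      using mono[of k "max k l"] mono[of l "max k l"] by auto
    then show ?case ..
  qed simp
  have conH: "consistent H"
  proof (rule ccontr)
    assume "\<not> consistent H"
    then obtain F where "finite F" "F \<subseteq> H" "F \<turnstile> Bot"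
      using derives_finite[of H Bot] unfolding consistent_def by blast
    moreover then obtain k where "F \<subseteq> G k" using bound by blast
    ultimately show False
      using G[of k] derives_mono by (auto simp: P_def consistent_def)
  qed
  have sub: "G k \<subseteq> H" for k by (auto simp: H_def)
  have dec: "p \<in> H \<and> witnessed p H \<or> \<not> consistent (insert p H)" for p
  proof -
    obtain k where k: "p = f k" using f by (metis surjD)
    have "Q k (G k) (G (Suc k))" using G by blast
    then consider "p \<in> G (Suc k)" "witnessed p (G (Suc k))" | "\<not> consistent (insert p (G k))"
      using k by (auto simp: Q_def)
    then show ?thesis
    proof cases
      case 1
      then show ?thesis using sub[of "Suc k"] unfolding witnessed_def by blast
    next
      case 2
      then show ?thesis using sub[of k] derives_mono[of "insert p (G k)" Bot "insert p H"]
        by (auto simp: consistent_def)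
    qed
  qed
  have "T \<subseteq> H" using sub[of 0] G[of 0] by (auto simp: P_def)
  moreover have "henkin H"
  proof
    fix p
    show "p \<in> H \<or> \<not> consistent (insert p H)" using dec by blast
    show "witnessed p H" if "p \<in> H"
      using dec[of p] conH that by (metis insert_absorb)
  qed (rule conH)
  ultimately show ?thesis by blast
qed

section \<open>The term model of a Henkin theory\<close>

context henkin
begin

lemma closed: "H \<turnstile> p \<Longrightarrow> p \<in> H"
  using con maximal[of p] derives_cut[of H p Bot] unfolding consistent_def by auto

lemma Bot_notin: "Bot \<notin> H"
  using con derives.Assm by (auto simp: consistent_def)

lemma mp: "Imp p q \<in> H \<Longrightarrow> p \<in> H \<Longrightarrow> q \<in> H"
  by (rule closed, rule derives.ImpE[of H p q]) (auto intro: derives.Assm)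

lemma Imp_iff: "Imp p q \<in> H \<longleftrightarrow> (p \<in> H \<longrightarrow> q \<in> H)"
proof
  assume *: "p \<in> H \<longrightarrow> q \<in> H"
  show "Imp p q \<in> H"
  proof (cases "p \<in> H")
    case True
    then have "insert p H \<turnstile> q" using * by (auto intro: derives.Assm)
    then show ?thesis by (rule closed[OF derives.ImpI])
  next
    case False
    then have "insert p H \<turnstile> Bot" using maximal by (auto simp: consistent_def)
    then have "insert p H \<turnstile> q"
      by (rule derives.Class[OF derives_mono]) auto
    then show ?thesis by (rule closed[OF derives.ImpI])
  qed
qed (auto intro: mp)

lemma AllN_iff: "AllN p \<in> H \<longleftrightarrow> (\<forall>t. instN t p \<in> H)"
  using witness[of "Neg (AllN p)"] Imp_iff Bot_notin closed[OF derives.AllNE[OF derives.Assm]]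
  unfolding witnessed_def by blast

lemma AllS_iff: "AllS p \<in> H \<longleftrightarrow> (\<forall>Y. instS Y p \<in> H)"
  using witness[of "Neg (AllS p)"] Imp_iff Bot_notin closed[OF derives.AllSE[OF derives.Assm]]
  unfolding witnessed_def by blast

lemma Eq_refl: "Eq t t \<in> H"
  by (intro closed derives.EqI)

lemma Eq_subst: "Eq t u \<in> H \<Longrightarrow> instN t p \<in> H \<Longrightarrow> instN u p \<in> H"
  by (rule closed, rule derives.EqE[of H t u]) (auto intro: derives.Assm)

lemma Eq_sym: "Eq t u \<in> H \<Longrightarrow> Eq u t \<in> H"
  using Eq_subst[of t u "Eq (Var 0) (lift 1 t)"] Eq_refl
  by (simp add: instN_def tsubst_case_nat_lift)

lemma Eq_trans: "Eq t u \<in> H \<Longrightarrow> Eq u v \<in> H \<Longrightarrow> Eq t v \<in> H"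
  using Eq_subst[of u v "Eq (lift 1 t) (Var 0)"]
  by (simp add: instN_def tsubst_case_nat_lift)

lemma Eq_tsubst:
  "Eq t u \<in> H \<Longrightarrow> Eq (tsubst (case_nat t Var) a) (tsubst (case_nat u Var) a) \<in> H"
  using Eq_subst[of t u "Eq (lift 1 (tsubst (case_nat t Var) a)) a"] Eq_refl
  by (simp add: instN_def tsubst_case_nat_lift)

lemma Eq_cong2:
  assumes f: "f \<in> {Plus, Times, Exp}" and "Eq t t' \<in> H" "Eq u u' \<in> H"
  shows "Eq (f t u) (f t' u') \<in> H"
proof -
  have "Eq (f t u) (f t' u) \<in> H"
    using Eq_tsubst[OF assms(2), of "f (Var 0) (lift 1 u)"] f by (auto simp: tsubst_case_nat_lift)
  moreover have "Eq (f t' u) (f t' u') \<in> H"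
    using Eq_tsubst[OF assms(3), of "f (lift 1 t') (Var 0)"] f by (auto simp: tsubst_case_nat_lift)
  ultimately show ?thesis by (rule Eq_trans)
qed

lemma Less_cong:
  assumes "Eq t t' \<in> H" "Eq u u' \<in> H" "Less t u \<in> H"
  shows "Less t' u' \<in> H"
  using Eq_subst[OF assms(1), of "Less (Var 0) (lift 1 u)"] 
    Eq_subst[OF assms(2), of "Less (lift 1 t') (Var 0)"] assms(3)
  by (simp add: instN_def tsubst_case_nat_lift)

lemma Mem_cong: "Eq t t' \<in> H \<Longrightarrow> Mem t X \<in> H \<Longrightarrow> Mem t' X \<in> H"
  using Eq_subst[of t t' "Mem (Var 0) X"] by (simp add: instN_def)


lemma infinite_classes:
  assumes ax: "AllN (Neg (Eq (Plus (Var 0) One) Zero)) \<in> H"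
    "AllN (AllN (Eq (Plus (Var 1) One) (Plus (Var 0) One) \<^bold>\<longrightarrow> Eq (Var 1) (Var 0))) \<in> H"
  shows "infinite (range (\<lambda>t. {u. Eq t u \<in> H}))"
proof -
  define num where "num k = ((\<lambda>t. Plus t One) ^^ k) Zero" for k
  have zero: "Eq (Plus t One) Zero \<notin> H" for t
    using ax(1) Bot_notin unfolding AllN_iff by (auto simp: instN_def Imp_iff)
  have S: "Eq (Plus t One) (Plus u One) \<in> H \<Longrightarrow> Eq t u \<in> H" for t u
    using ax(2) unfolding AllN_iff
    by (auto simp: instN_def Imp_iff AllN_iff tsubst_case_nat_lift)
  have "Eq (num j) (num k) \<in> H \<Longrightarrow> j = k" for j k
  proof (induction j arbitrary: k)
    case 0
    then show ?case using zero Eq_sym by (cases k) (auto simp: num_def)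
  next
    case (Suc j)
    then show ?case using zero S by (cases k) (auto simp: num_def)
  qed
  then have "inj (\<lambda>k. {u. Eq (num k) u \<in> H})"
    using Eq_refl by (intro injI) (metis mem_Collect_eq)
  then have "infinite (range (\<lambda>k. {u. Eq (num k) u \<in> H}))"
    by (rule range_inj_infinite)
  then show ?thesis
    by (rule contrapos_nn) (auto elim!: finite_subset[rotated])
qed

lemma ex_model:
  assumes inf: "infinite (UNIV :: 'a :: countable set)"
    and ax: "AllN (Neg (Eq (Plus (Var 0) One) Zero)) \<in> H"
    "AllN (AllN (Eq (Plus (Var 1) One) (Plus (Var 0) One) \<^bold>\<longrightarrow> Eq (Var 1) (Var 0))) \<in> H"
  shows "\<exists>(M :: 'a model) e E. range E = msets M \<and> (\<forall>p. sat M e E p \<longleftrightarrow> p \<in> H)"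
proof -
  define c where "c t = {u. Eq t u \<in> H}" for t
  have c_eq: "c t = c u \<longleftrightarrow> Eq t u \<in> H" for t u
    unfolding c_def using Eq_refl Eq_sym Eq_trans by blast
  have "infinite (range c)" using infinite_classes[OF ax] by (simp add: c_def[abs_def])
  moreover have "countable (range c)" by simp
  ultimately have "bij_betw (to_nat_on (range c)) (range c) UNIV"
    using to_nat_on_infinite by blast
  moreover have "bij_betw (from_nat_into (UNIV :: 'a set)) UNIV UNIV"
    using inf by (intro bij_betw_from_nat_into) auto
  ultimately have bij: "bij_betw (from_nat_into (UNIV :: 'a set) \<circ> to_nat_on (range c)) (range c) UNIV"
    by (rule bij_betw_trans)
  \<comment> \<open>Equality is interpreted as identity, so \<open>q\<close> identifies exactly the
    terms that H declares equal. It is onto \<open>'a\<close> because both the set of classes and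
    the type are countably infinite.\<close>
  define q where "q t = (from_nat_into (UNIV :: 'a set) \<circ> to_nat_on (range c)) (c t)" for t
  have surj: "range q = UNIV"
    using bij_betw_imp_surj_on[OF bij] by (auto simp: q_def[abs_def] image_image)
  have q_eq: "q t = q u \<longleftrightarrow> Eq t u \<in> H" for t u
    using inj_on_eq_iff[OF bij_betw_imp_inj_on[OF bij], of "c t" "c u"]
    by (simp add: q_def c_eq[symmetric])
  define rep where "rep = inv q"
  have q_rep [simp]: "q (rep x) = x" for x
    using surj by (simp add: rep_def surj_f_inv_f)
  have rep_q: "Eq (rep (q t)) t \<in> H" for t
    by (simp flip: q_eq)
  define E where "E X = {q t |t. Mem t X \<in> H}" for X
  define M where "M = \<lparr>mzero = q Zero, mone = q One,
    mplus = (\<lambda>x y. q (Plus (rep x) (rep y))), mtimes = (\<lambda>x y. q (Times (rep x) (rep y))),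
    mexp = (\<lambda>x y. q (Exp (rep x) (rep y))), mless = (\<lambda>x y. Less (rep x) (rep y) \<in> H),
    msets = range E\<rparr>"
  have ev: "ev M (\<lambda>i. q (s i)) t = q (tsubst s t)" for s t
    by (induction t)
      (auto simp: M_def q_eq intro!: Eq_cong2[of Plus] Eq_cong2[of Times] Eq_cong2[of Exp] rep_q)
  have less: "Less (rep (q t)) (rep (q u)) \<in> H \<longleftrightarrow> Less t u \<in> H" for t u
    using Less_cong[OF rep_q rep_q] Less_cong[OF Eq_sym[OF rep_q] Eq_sym[OF rep_q]] by blast
  have mem: "q t \<in> E X \<longleftrightarrow> Mem t X \<in> H" for t X
    unfolding E_def by (auto simp: q_eq intro: Mem_cong[OF Eq_sym] Eq_refl)
  \<comment> \<open>The truth lemma, for arbitrary substitutions because going under a quantifier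
    replaces variable 0 by an arbitrary term or set variable.\<close>
  have "sat M (\<lambda>i. q (s i)) (\<lambda>X. E (r X)) p \<longleftrightarrow> fsubst s r p \<in> H" for s r p
  proof (induction p arbitrary: s r)
    case (AllN p)
    have "sat M (case_nat (q t) (\<lambda>i. q (s i))) (\<lambda>X. E (r X)) p \<longleftrightarrow>
        instN t (fsubst (case_nat (Var 0) (\<lambda>i. lift 1 (s i))) r p) \<in> H" for t
    proof -
      have "case_nat (q t) (\<lambda>i. q (s i)) = (\<lambda>i. q (case_nat t s i))"
        by (rule ext) (simp split: nat.split)
      moreover have "instN t (fsubst (case_nat (Var 0) (\<lambda>i. lift 1 (s i))) r p)
          = fsubst (case_nat t s) r p"
      proof -
        have "tsubst (case_nat t Var) \<circ> case_nat (Var 0) (\<lambda>i. lift 1 (s i)) = case_nat t s"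
          by (rule ext) (simp add: tsubst_case_nat_lift split: nat.split)
        then show ?thesis by (simp add: instN_def fsubst_fsubst)
      qed
      ultimately show ?thesis using AllN by simp
    qed
    then show ?case using surj by (simp add: AllN_iff) (metis surjD)
  next
    case (AllS p)
    have "sat M (\<lambda>i. q (s i)) (case_nat (E Y) (\<lambda>X. E (r X))) p \<longleftrightarrow>
        instS Y (fsubst s (case_nat 0 (\<lambda>X. Suc (r X))) p) \<in> H" for Y
    proof -
      have "case_nat (E Y) (\<lambda>X. E (r X)) = (\<lambda>X. E (case_nat Y r X))"
        by (rule ext) (simp split: nat.split)
      moreover have "instS Y (fsubst s (case_nat 0 (\<lambda>X. Suc (r X))) p) = fsubst s (case_nat Y r) p"
      proof -
        have "case_nat Y id \<circ> case_nat 0 (\<lambda>X. Suc (r X)) = case_nat Y r"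
          by (rule ext) (simp split: nat.split)
        then show ?thesis by (simp add: instS_def fsubst_fsubst comp_def)
      qed
      ultimately show ?thesis using AllS by simp
    qed
    moreover have "msets M = range E" by (simp add: M_def)
    ultimately show ?case by (simp add: AllS_iff)
  next
    case (Less t u)
    have "mless M = (\<lambda>x y. Less (rep x) (rep y) \<in> H)" by (simp add: M_def)
    then show ?case by (simp add: ev less)
  qed (auto simp: ev q_eq mem Imp_iff Bot_notin)
  from this[of Var id] have "sat M (\<lambda>i. q (Var i)) E p \<longleftrightarrow> p \<in> H" for p
    by simp
  moreover have "range E = msets M" by (simp add: M_def)
  ultimately show ?thesis by blast
qed

end


text \<open>The successor axioms make every model infinite, so that the canonical countable model can be
  carried over to a given countably infinite type.\<close>

theorem completeness:
  assumes inf: "infinite (UNIV :: 'a :: countable set)"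
    and ax: "basic_axioms \<subseteq> T" and T: "\<forall>q\<in>T. closed_fm 0 0 q" and p: "closed_fm 0 0 p"
    and valid: "\<And>M :: 'a model. M \<Turnstile> T \<Longrightarrow> M \<Turnstile> {p}"
  shows "T \<turnstile> p"
proof (rule ccontr)
  assume "\<not> (T \<turnstile> p)"
  then have "consistent (insert (Neg p) T)"
    using derives.Class by (auto simp: consistent_def)
  moreover have "\<forall>q\<in>insert (Neg p) T. closed_fm 0 0 q" using T p by auto
  ultimately obtain H where H: "insert (Neg p) T \<subseteq> H" "henkin H"
    using henkin_extension by metis
  interpret henkin H by fact
  have "\<exists>(M :: 'a model) e E. range E = msets M \<and> (\<forall>p. sat M e E p \<longleftrightarrow> p \<in> H)"
    using ax H(1) by (intro ex_model inf) (auto simp: basic_axioms_def Let_def)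
  then obtain M :: "'a model" and e E
    where M: "range E = msets M" "\<And>p. sat M e E p \<longleftrightarrow> p \<in> H" by blast
  have cl: "sat M e' E' q \<longleftrightarrow> q \<in> H" if "closed_fm 0 0 q" for q e' E'
    using sat_cong_closed[OF that, of e' e E' E M] M(2) by simp
  have "M \<Turnstile> T" unfolding models_def valid_def using M(1) cl T H(1) by auto
  then have "M \<Turnstile> {p}" by (rule valid)
  then have "sat M e E p" using M(1) by (simp add: models_def valid_def)
  then have "p \<in> H" using M(2) by simp
  moreover have "Neg p \<in> H" using H(1) by auto
  ultimately show False using mp Bot_notin by blast
qed

section \<open>The critical model\<close>

lemma sat_instN: "sat M e E (instN t p) = sat M (case_nat (ev M e t) e) E p"
proof -
  have "(\<lambda>i. ev M e (case_nat t Var i)) = case_nat (ev M e t) e"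
    by (rule ext) (simp split: nat.split)
  then show ?thesis by (simp add: instN_def sat_fsubst)
qed

lemma sat_induction_for:
  "sat M e E (induction_for p) \<longleftrightarrow>
    (sat M (case_nat (mzero M) e) E p \<longrightarrow>
     (\<forall>x. sat M (case_nat x e) E p \<longrightarrow> sat M (case_nat (mplus M x (mone M)) e) E p) \<longrightarrow>
     (\<forall>x. sat M (case_nat x e) E p))"
proof -
  have "(\<lambda>i. ev M (case_nat x e) (case_nat (Plus (Var 0) One) (\<lambda>i. Var (Suc i)) i))
      = case_nat (mplus M x (mone M)) e" for x
    by (rule ext) (simp split: nat.split)
  then show ?thesis
    unfolding induction_for_def sat.simps sat_instN sat_fsubst ev.simps id_apply by auto
qed

lemma sat_comprehension_for:
  "sat M e E (comprehension_for p q) \<longleftrightarrow>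
    ((\<forall>x. sat M (case_nat x e) E p = sat M (case_nat x e) E q) \<longrightarrow>
     (\<exists>X\<in>msets M. \<forall>x. x \<in> X \<longleftrightarrow> sat M (case_nat x e) E p))"
  unfolding comprehension_for_def liftS_def by (auto simp: sat_fsubst)

lemma models_induction:
  assumes "M \<Turnstile> (\<Union>p\<in>{p. C p}. closures (induction_for p))" "C p" "range E \<subseteq> msets M"
    "sat M (case_nat (mzero M) e) E p"
    "\<And>x. sat M (case_nat x e) E p \<Longrightarrow> sat M (case_nat (mplus M x (mone M)) e) E p"
  shows "sat M (case_nat x e) E p"
proof -
  obtain q where "q \<in> closures (induction_for p)" using closures_nonempty by blast
  then have "valid M (induction_for p)"
    using assms(1,2) valid_closures by (fastforce simp: models_def)
  then have "sat M e E (induction_for p)" using assms(3) by (simp add: valid_def)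
  then show ?thesis using assms(4,5) unfolding sat_induction_for by blast
qed

text \<open>A copy of \<open>nat\<close> without its arithmetic, leaving the arithmetical type
  classes free to be instantiated with the operations of a chosen model.\<close>

datatype elem = Elem (index: nat)

instance elem :: countable
  by countable_datatype

lemma elem_eq_iff: "x = y \<longleftrightarrow> index x = index y"
  by (cases x; cases y) simp

lemma infinite_elem: "infinite (UNIV :: elem set)"
  using range_inj_infinite[of Elem] finite_subset[of "range Elem" UNIV] by (auto simp: inj_def)

definition standard_model :: "elem model" where
  "standard_model = \<lparr>mzero = Elem 0, mone = Elem 1,
    mplus = (\<lambda>x y. Elem (index x + index y)), mtimes = (\<lambda>x y. Elem (index x * index y)),
    mexp = (\<lambda>x y. Elem (index x ^ index y)), mless = (\<lambda>x y. index x < index y), msets = UNIV\<rparr>"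

text \<open>Shows that the theory has some model on \<open>elem\<close>, without which the choice of
  \<open>crit\<close> would be unfounded.\<close>

lemma standard_model: "standard_model \<Turnstile> RCA0star"
proof -
  have ind: "valid standard_model (induction_for p)" for p
    unfolding valid_def sat_induction_for
  proof (intro allI impI)
    fix e E x
    assume *: "sat standard_model (case_nat (mzero standard_model) e) E p"
      "\<forall>x. sat standard_model (case_nat x e) E p \<longrightarrow>
        sat standard_model (case_nat (mplus standard_model x (mone standard_model)) e) E p"
    have "sat standard_model (case_nat (Elem n) e) E p" for n
    proof (induction n)
      case 0
      then show ?case using *(1) by (simp add: standard_model_def)
    next
      case (Suc n)
      then have "sat standard_model (case_nat (mplus standard_model (Elem n) (mone standard_model)) e) E p"
        using *(2) by blast
      then show ?case by (simp add: standard_model_def One_nat_def)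
    qed
    then show "sat standard_model (case_nat x e) E p" by (metis elem.exhaust)
  qed
  have comp: "valid standard_model (comprehension_for p q)" for p q
    unfolding valid_def sat_comprehension_for
    by (auto simp: standard_model_def intro!: exI[of _ "{x. P x}" for P])
  have basic: "\<forall>p\<in>basic_axioms. valid standard_model p"
    by (auto simp: basic_axioms_def Let_def valid_def standard_model_def elem_eq_iff less_Suc_eq
        One_nat_def)
  have "valid standard_model q" if "q \<in> RCA0star" for q
  proof -
    have "q \<in> basic_axioms \<or> (\<exists>p. q \<in> closures (induction_for p)) \<or>
        (\<exists>p p'. q \<in> closures (comprehension_for p p'))"
      using that unfolding RCA0star_def ISigma00_def Delta01_CA_def by auto
    then show ?thesis
    proof (elim disjE exE)
      assume "q \<in> basic_axioms"
      then show ?thesis using basic by blast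
    next
      fix p assume "q \<in> closures (induction_for p)"
      from valid_closures[OF this, of standard_model] ind show ?thesis by simp
    next
      fix p p' assume "q \<in> closures (comprehension_for p p')"
      from valid_closures[OF this, of standard_model] comp show ?thesis by simp
    qed
  qed
  then show ?thesis by (simp add: models_def standard_model_def)
qed

definition implications :: "'a model \<Rightarrow> bool" where
  "implications M \<longleftrightarrow>
    (M \<Turnstile> {Brown} \<longrightarrow> M \<Turnstile> {WeakBrown}) \<and> (M \<Turnstile> {WeakBrown} \<longrightarrow> M \<Turnstile> ISigma02) \<and>
    (M \<Turnstile> ISigma02 \<longrightarrow> M \<Turnstile> {PartitionRegularity}) \<and> (M \<Turnstile> {PartitionRegularity} \<longrightarrow> M \<Turnstile> {Brown})"

text \<open>A fixed model of \<open>RCA\<^sub>0\<^sup>*\<close> that is a counterexample to the chain of implications if there is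
  one.  Fixing it globally, rather than quantifying over models, allows its first-order part to be
  made an instance of the type classes of ordered semirings.\<close>

definition crit :: "elem model" where
  "crit = (SOME M. M \<Turnstile> RCA0star \<and> (implications M \<longrightarrow> (\<forall>M' :: elem model. M' \<Turnstile> RCA0star \<longrightarrow> implications M')))"

text \<open>An instance of the drinker principle: if some model violates the implications, it may be
  taken as \<open>crit\<close>; otherwise every model will do.\<close>

lemma crit: "crit \<Turnstile> RCA0star" "implications crit \<Longrightarrow> M \<Turnstile> RCA0star \<Longrightarrow> implications M" for M :: "elem model"
proof -
  have "\<exists>M :: elem model. M \<Turnstile> RCA0star \<and> (implications M \<longrightarrow> (\<forall>M' :: elem model. M' \<Turnstile> RCA0star \<longrightarrow> implications M'))"
    using standard_model by blast
  from someI_ex[OF this, folded crit_def]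
  show "crit \<Turnstile> RCA0star" "implications crit \<Longrightarrow> M \<Turnstile> RCA0star \<Longrightarrow> implications M" by blast+
qed

instantiation elem :: "{zero, one, plus, times, ord}"
begin

definition "0 = mzero crit"
definition "1 = mone crit"
definition "x + y = mplus crit x y"
definition "x * y = mtimes crit x y"
definition "x < y \<longleftrightarrow> mless crit x y"
definition "x \<le> y \<longleftrightarrow> x < y \<or> x = (y :: elem)"

instance ..

end

definition pw :: "elem \<Rightarrow> elem \<Rightarrow> elem" (infixr "\<up>" 80) where
  "x \<up> y = mexp crit x y"

definition sets :: "elem set set" where
  "sets = msets crit"

lemmas crit_folds = zero_elem_def[symmetric] one_elem_def[symmetric] plus_elem_def[symmetric]
  times_elem_def[symmetric] less_elem_def[symmetric] pw_def[symmetric] sets_def[symmetric]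

lemma basic:
  fixes x y :: elem
  shows "x + 1 \<noteq> 0" "x + 1 = y + 1 \<Longrightarrow> x = y" "x + 0 = x" "x + (y + 1) = x + y + 1"
    "x * 0 = 0" "x * (y + 1) = x * y + x" "\<not> x < 0" "x < y + 1 \<longleftrightarrow> x < y \<or> x = y"
    "x \<up> 0 = 1" "x \<up> (y + 1) = x \<up> y * x"
proof -
  obtain X where "X \<in> msets crit" using crit(1) by (auto simp: models_def)
  then have "\<forall>p\<in>basic_axioms. sat crit e (\<lambda>_. X) p" for e
    using crit(1) by (simp add: models_def valid_def RCA0star_def)
  note ax = this[unfolded basic_axioms_def Let_def, simplified, unfolded crit_folds]
  show "x + 1 \<noteq> 0" "x + 1 = y + 1 \<Longrightarrow> x = y" "x + 0 = x" "x + (y + 1) = x + y + 1"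
    "x * 0 = 0" "x * (y + 1) = x * y + x" "\<not> x < 0" "x < y + 1 \<longleftrightarrow> x < y \<or> x = y"
    "x \<up> 0 = 1" "x \<up> (y + 1) = x \<up> y * x"
    using ax by metis+
qed

section \<open>Bounded definability\<close>

text \<open>Predicates and functions of a sequence of arguments, given by bounded formulas and by terms
  with parameters: a variable of the formula stands for an argument or for a constant.\<close>

definition arg :: "((nat \<Rightarrow> elem) \<Rightarrow> elem) \<Rightarrow> bool" where
  "arg f \<longleftrightarrow> (\<exists>k. f = (\<lambda>v. v k)) \<or> (\<exists>c. f = (\<lambda>v. c))"

definition dtm :: "((nat \<Rightarrow> elem) \<Rightarrow> elem) \<Rightarrow> bool" where
  "dtm f \<longleftrightarrow> (\<exists>t \<pi>. (\<forall>i. arg (\<pi> i)) \<and> (\<forall>v. f v = ev crit (\<lambda>i. \<pi> i v) t))"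

definition dfm :: "((nat \<Rightarrow> elem) \<Rightarrow> bool) \<Rightarrow> bool" where
  "dfm P \<longleftrightarrow> (\<exists>p \<pi> E. Sigma00 p \<and> (\<forall>i. arg (\<pi> i)) \<and> range E \<subseteq> sets \<and>
    (\<forall>v. P v = sat crit (\<lambda>i. \<pi> i v) E p))"

lemma Sigma00_fsubst: "Sigma00 p \<Longrightarrow> Sigma00 (fsubst s r p)"
proof (induction arbitrary: s r rule: Sigma00.induct)
  case (6 p t)
  have "fsubst s r (AllB t p) = AllB (tsubst s t) (fsubst (case_nat (Var 0) (\<lambda>i. lift 1 (s i))) r p)"
    by (simp add: AllB_def tsubst_lift1)
  then show ?case using 6 by (simp add: Sigma00.intros)
next
  case (7 p t)
  have "fsubst s r (ExB t p) = ExB (tsubst s t) (fsubst (case_nat (Var 0) (\<lambda>i. lift 1 (s i))) r p)"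
    by (simp add: ExB_def tsubst_lift1)
  then show ?case using 7 by (simp add: Sigma00.intros)
qed (auto intro: Sigma00.intros)

text \<open>Interleaves two assignments, so that two formulas with separate parameters can be read
  under one common assignment, via their even and odd variables.\<close>

definition mix :: "(nat \<Rightarrow> 'b) \<Rightarrow> (nat \<Rightarrow> 'b) \<Rightarrow> nat \<Rightarrow> 'b" where
  "mix f g i = (if even i then f (i div 2) else g (i div 2))"

lemma mix_simps [simp]: "mix f g (2 * i) = f i" "mix f g (Suc (2 * i)) = g i"
  by (auto simp: mix_def)

lemma arg_mix: "(\<And>i. arg (f i)) \<Longrightarrow> (\<And>i. arg (g i)) \<Longrightarrow> arg (mix f g i)"
  by (simp add: mix_def)

lemma range_mix: "range f \<subseteq> A \<Longrightarrow> range g \<subseteq> A \<Longrightarrow> range (mix f g) \<subseteq> A"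
  by (auto simp: mix_def)

lemma dtm_pair:
  assumes "dtm f" "dtm g"
  obtains t u \<pi> where "\<And>i. arg (\<pi> i)" "\<And>v. f v = ev crit (\<lambda>i. \<pi> i v) t"
    "\<And>v. g v = ev crit (\<lambda>i. \<pi> i v) u"
proof -
  obtain t \<pi> u \<rho> where *: "\<And>i. arg (\<pi> i)" "\<And>v. f v = ev crit (\<lambda>i. \<pi> i v) t"
    "\<And>i. arg (\<rho> i)" "\<And>v. g v = ev crit (\<lambda>i. \<rho> i v) u"
    using assms unfolding dtm_def by blast
  show thesis
    by (rule that[of "mix \<pi> \<rho>" "tsubst (\<lambda>i. Var (2 * i)) t" "tsubst (\<lambda>i. Var (Suc (2 * i))) u"])
      (auto simp: * arg_mix ev_tsubst)
qed

lemma dfm_pair: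
  assumes "dfm P" "dfm Q"
  obtains p q \<pi> E where "Sigma00 p" "Sigma00 q" "\<And>i. arg (\<pi> i)" "range E \<subseteq> sets"
    "\<And>v. P v = sat crit (\<lambda>i. \<pi> i v) E p" "\<And>v. Q v = sat crit (\<lambda>i. \<pi> i v) E q"
proof -
  obtain p \<pi> E where P: "Sigma00 p" "\<And>i. arg (\<pi> i)" "range E \<subseteq> sets"
    "\<And>v. P v = sat crit (\<lambda>i. \<pi> i v) E p"
    using assms(1) unfolding dfm_def by blast
  obtain q \<rho> F where Q: "Sigma00 q" "\<And>i. arg (\<rho> i)" "range F \<subseteq> sets"
    "\<And>v. Q v = sat crit (\<lambda>i. \<rho> i v) F q"
    using assms(2) unfolding dfm_def by blast
  show thesis
    by (rule that[of "fsubst (\<lambda>i. Var (2 * i)) (\<lambda>i. 2 * i) p"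
          "fsubst (\<lambda>i. Var (Suc (2 * i))) (\<lambda>i. Suc (2 * i)) q" "mix \<pi> \<rho>" "mix E F"])
      (simp_all add: P Q arg_mix range_mix sat_fsubst Sigma00_fsubst)
qed

definition app :: "nat \<Rightarrow> (nat \<Rightarrow> 'b) \<Rightarrow> (nat \<Rightarrow> 'b) \<Rightarrow> nat \<Rightarrow> 'b" where
  "app k u w i = (if i < k then u i else w (i - k))"

text \<open>Separates arguments from parameters: each \<open>\<pi> i\<close> either selects one of
  the first k slots or depends on w alone. After renaming the variables along
  \<open>\<sigma>\<close>, the first k of them are the arguments.\<close>

lemma arg_app:
  fixes \<pi> :: "nat \<Rightarrow> (nat \<Rightarrow> elem) \<Rightarrow> elem"
  assumes "\<And>i. arg (\<pi> i)"
  obtains \<sigma> \<rho> where "\<And>i. arg (\<rho> i)" "\<And>i u w. \<pi> i (app k u w) = app k u (\<lambda>j. \<rho> j w) (\<sigma> i)"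
proof -
  have "\<exists>s r. arg r \<and> (s < k \<or> s = k + i) \<and>
      (\<forall>u w. \<pi> i (app k u w) = (if s < k then u s else r w))" for i
    using assms[of i, unfolded arg_def]
  proof (elim disjE exE)
    fix j assume j: "\<pi> i = (\<lambda>v. v j)"
    show ?thesis
      by (rule exI[of _ "if j < k then j else k + i"], rule exI[of _ "\<lambda>w. w (j - k)"])
        (auto simp: j app_def arg_def)
  next
    fix c assume c: "\<pi> i = (\<lambda>v. c)"
    show ?thesis
      by (rule exI[of _ "k + i"], rule exI[of _ "\<lambda>w. c"]) (auto simp: c arg_def)
  qed
  then obtain \<sigma> \<rho> where *: "\<And>i. arg (\<rho> i)" "\<And>i. \<sigma> i < k \<or> \<sigma> i = k + i"
    "\<And>i u w. \<pi> i (app k u w) = (if \<sigma> i < k then u (\<sigma> i) else \<rho> i w)" by metis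
  show thesis
  proof (rule that[of \<rho> \<sigma>])
    show "\<pi> i (app k u w) = app k u (\<lambda>j. \<rho> j w) (\<sigma> i)" for i u w
      using *(2)[of i] by (auto simp: *(3) app_def)
  qed (rule *)
qed

text \<open>The axiom schemes act on variable 0 (and its neighbours) of a formula, so the k
  arguments have to become its first k variables while all other variables denote fixed
  parameters.\<close>

lemma dfm_sat:
  assumes "dfm P"
  obtains p e E where "Sigma00 p" "range E \<subseteq> sets" "\<And>u. P (app k u w) = sat crit (app k u e) E p"
proof -
  obtain p \<pi> E where *: "Sigma00 p" "\<And>i. arg (\<pi> i)" "range E \<subseteq> sets"
    "\<And>v. P v = sat crit (\<lambda>i. \<pi> i v) E p"
    using assms unfolding dfm_def by blast
  obtain \<sigma> \<rho> where "\<And>i u w. \<pi> i (app k u w) = app k u (\<lambda>j. \<rho> j w) (\<sigma> i)"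
    using arg_app[of \<pi> k] *(2) by metis
  then show thesis
    by (intro that[of "fsubst (\<lambda>i. Var (\<sigma> i)) id p" E "\<lambda>j. \<rho> j w"])
      (simp_all add: * sat_fsubst Sigma00_fsubst)
qed

lemma app_1: "app 1 (\<lambda>_. x) w = case_nat x w"
  by (rule ext) (simp add: app_def One_nat_def split: nat.split)

lemma app_3: "app 3 (case_nat x (case_nat y (\<lambda>_. z))) w = case_nat x (case_nat y (case_nat z w))"
  by (rule ext) (auto simp: app_def numeral_3_eq_3 split: nat.split)

named_theorems dfm_intros

lemma dtm_arg [dfm_intros]: "dtm (\<lambda>v. v k)" "dtm (\<lambda>v. c)"
proof -
  have "dtm f" if "arg f" for f
    unfolding dtm_def using that by (intro exI[of _ "Var 0"] exI[of _ "\<lambda>_. f"]) simp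
  then show "dtm (\<lambda>v. v k)" "dtm (\<lambda>v. c)" by (auto simp: arg_def)
qed

lemma dtm_op [dfm_intros]:
  assumes "dtm f" "dtm g"
  shows "dtm (\<lambda>v. f v + g v)" "dtm (\<lambda>v. f v * g v)" "dtm (\<lambda>v. f v \<up> g v)"
proof -
  obtain t u \<pi> where *: "\<And>i. arg (\<pi> i)" "\<And>v. f v = ev crit (\<lambda>i. \<pi> i v) t"
    "\<And>v. g v = ev crit (\<lambda>i. \<pi> i v) u"
    using dtm_pair[OF assms] by metis
  show "dtm (\<lambda>v. f v + g v)" unfolding dtm_def
    by (rule exI[of _ "Plus t u"], rule exI[of _ \<pi>]) (simp add: * crit_folds)
  show "dtm (\<lambda>v. f v * g v)" unfolding dtm_def
    by (rule exI[of _ "Times t u"], rule exI[of _ \<pi>]) (simp add: * crit_folds)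
  show "dtm (\<lambda>v. f v \<up> g v)" unfolding dtm_def
    by (rule exI[of _ "Exp t u"], rule exI[of _ \<pi>]) (simp add: * crit_folds)
qed

lemma dfm_rel [dfm_intros]:
  assumes "dtm f" "dtm g"
  shows "dfm (\<lambda>v. f v = g v)" "dfm (\<lambda>v. f v < g v)"
proof -
  obtain t u \<pi> where *: "\<And>i. arg (\<pi> i)" "\<And>v. f v = ev crit (\<lambda>i. \<pi> i v) t"
    "\<And>v. g v = ev crit (\<lambda>i. \<pi> i v) u"
    using dtm_pair[OF assms] by metis
  obtain X where X: "X \<in> sets" using crit(1) by (auto simp: models_def sets_def)
  show "dfm (\<lambda>v. f v = g v)" unfolding dfm_def using X
    by (intro exI[of _ "Eq t u"] exI[of _ \<pi>] exI[of _ "\<lambda>_. X"]) (auto simp: * Sigma00.intros)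
  show "dfm (\<lambda>v. f v < g v)" unfolding dfm_def using X
    by (intro exI[of _ "Less t u"] exI[of _ \<pi>] exI[of _ "\<lambda>_. X"])
      (auto simp: * crit_folds Sigma00.intros)
qed

lemma dfm_mem [dfm_intros]:
  assumes "X \<in> sets" "dtm f"
  shows "dfm (\<lambda>v. f v \<in> X)"
proof -
  obtain t \<pi> where *: "\<And>i. arg (\<pi> i)" "\<And>v. f v = ev crit (\<lambda>i. \<pi> i v) t"
    using assms(2) unfolding dtm_def by blast
  show ?thesis unfolding dfm_def using assms(1)
    by (intro exI[of _ "Mem t 0"] exI[of _ \<pi>] exI[of _ "\<lambda>_. X"]) (auto simp: * Sigma00.intros)
qed

lemma dfm_imp [dfm_intros]:
  assumes "dfm P" "dfm Q"
  shows "dfm (\<lambda>v. P v \<longrightarrow> Q v)"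
proof -
  obtain p q \<pi> E where *: "Sigma00 p" "Sigma00 q" "\<And>i. arg (\<pi> i)" "range E \<subseteq> sets"
    "\<And>v. P v = sat crit (\<lambda>i. \<pi> i v) E p" "\<And>v. Q v = sat crit (\<lambda>i. \<pi> i v) E q"
    using dfm_pair[OF assms] by metis
  show ?thesis unfolding dfm_def using *(1-4)
    by (intro exI[of _ "Imp p q"] exI[of _ \<pi>] exI[of _ E]) (auto simp: *(5,6) Sigma00.intros)
qed

lemma dfm_const [dfm_intros]: "dfm (\<lambda>v. b)"
proof -
  obtain X where X: "X \<in> sets" using crit(1) by (auto simp: models_def sets_def)
  show ?thesis unfolding dfm_def using X
    by (intro exI[of _ "if b then Neg Bot else Bot"] exI[of _ "\<lambda>_ v. v 0"] exI[of _ "\<lambda>_. X"])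
      (auto simp: arg_def Sigma00.intros)
qed

lemma dfm_not [dfm_intros]: "dfm P \<Longrightarrow> dfm (\<lambda>v. \<not> P v)"
  using dfm_imp[OF _ dfm_const[of False]] by simp

lemma dfm_or [dfm_intros]: "dfm P \<Longrightarrow> dfm Q \<Longrightarrow> dfm (\<lambda>v. P v \<or> Q v)"
  using dfm_imp[OF dfm_not] by (simp add: imp_conv_disj)

lemma dfm_and [dfm_intros]: "dfm P \<Longrightarrow> dfm Q \<Longrightarrow> dfm (\<lambda>v. P v \<and> Q v)"
  using dfm_not[OF dfm_imp[OF _ dfm_not]] by simp

lemma dfm_iff [dfm_intros]: "dfm P \<Longrightarrow> dfm Q \<Longrightarrow> dfm (\<lambda>v. P v = Q v)"
  using dfm_and[OF dfm_imp dfm_imp] by (simp add: iff_conv_conj_imp)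

lemma dfm_le [dfm_intros]: "dtm f \<Longrightarrow> dtm g \<Longrightarrow> dfm (\<lambda>v. f v \<le> g v)"
  unfolding less_eq_elem_def by (intro dfm_intros)

lemma dfm_all [dfm_intros]:
  assumes "dtm f" and P: "dfm (\<lambda>v. P (v 0) (\<lambda>i. v (Suc i)))"
  shows "dfm (\<lambda>v. \<forall>x<f v. P x v)"
proof -
  obtain t \<rho> where t: "\<And>i. arg (\<rho> i)" "\<And>v. f v = ev crit (\<lambda>i. \<rho> i v) t"
    using assms(1) unfolding dtm_def by blast
  obtain p \<pi> E where p: "Sigma00 p" "\<And>i. arg (\<pi> i)" "range E \<subseteq> sets"
    "\<And>v. P (v 0) (\<lambda>i. v (Suc i)) = sat crit (\<lambda>i. \<pi> i v) E p"
    using P unfolding dfm_def by blast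
  obtain \<sigma> \<tau> where \<tau>: "\<And>i. arg (\<tau> i)" "\<And>i u w. \<pi> i (app 1 u w) = app 1 u (\<lambda>j. \<tau> j w) (\<sigma> i)"
    using arg_app[of \<pi> 1] p(2) by metis
  have P_eq: "P x v = sat crit (\<lambda>i. case_nat x (\<lambda>j. \<tau> j v) (\<sigma> i)) E p" for x v
    using p(4)[of "case_nat x v"] by (simp flip: app_1 add: \<tau>(2)) (simp add: app_1)
  \<comment> \<open>The bound uses the even variables of \<open>mix \<rho> \<tau>\<close>. In the
    body, variable 0 is the quantified one, and \<open>Suc (Suc (2 * j))\<close> is the odd variable
    for \<open>\<tau> j\<close>, shifted by the quantifier.\<close>
  have "Sigma00 (AllB (tsubst (\<lambda>i. Var (2 * i)) t)
     (fsubst (\<lambda>i. case \<sigma> i of 0 \<Rightarrow> Var 0 | Suc j \<Rightarrow> Var (Suc (Suc (2 * j)))) id p))"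
    by (intro Sigma00.intros Sigma00_fsubst p)
  moreover have "(\<forall>x<f v. P x v) = sat crit (\<lambda>i. mix \<rho> \<tau> i v) E (AllB (tsubst (\<lambda>i. Var (2 * i)) t)
     (fsubst (\<lambda>i. case \<sigma> i of 0 \<Rightarrow> Var 0 | Suc j \<Rightarrow> Var (Suc (Suc (2 * j)))) id p))" for v
  proof -
    have "(\<lambda>i. ev crit (case_nat x (\<lambda>i. mix \<rho> \<tau> i v))
        (case \<sigma> i of 0 \<Rightarrow> Var 0 | Suc j \<Rightarrow> Var (Suc (Suc (2 * j)))))
      = (\<lambda>i. case_nat x (\<lambda>j. \<tau> j v) (\<sigma> i))" for x
      by (rule ext) (simp split: nat.split)
    then show ?thesis by (simp add: AllB_def sat_fsubst ev_lift1 ev_tsubst P_eq crit_folds t(2))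
  qed
  moreover have "\<forall>i. arg (mix \<rho> \<tau> i)" using t(1) \<tau>(1) arg_mix by blast
  ultimately show ?thesis unfolding dfm_def using p(3)
    by (intro exI[of _ "mix \<rho> \<tau>"] exI[of _ E] exI conjI) auto
qed

lemma dfm_ex [dfm_intros]:
  assumes "dtm f" "dfm (\<lambda>v. P (v 0) (\<lambda>i. v (Suc i)))"
  shows "dfm (\<lambda>v. \<exists>x<f v. P x v)"
  using dfm_not[OF dfm_all[OF assms(1) dfm_not[OF assms(2)]]] by simp

lemma bounded_induct [case_names dfm 0 step]:
  assumes "dfm (\<lambda>v. P (v 0))" "P 0" "\<And>x. P x \<Longrightarrow> P (x + 1)"
  shows "P x"
proof -
  obtain p e E where p: "Sigma00 p" "range E \<subseteq> sets" "\<And>u. P (app 1 u (\<lambda>_. 0) 0) = sat crit (app 1 u e) E p"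
    using dfm_sat[OF assms(1)] by metis
  have P: "P x = sat crit (case_nat x e) E p" for x
    using p(3)[of "\<lambda>_. x"] by (simp add: app_1) 
  show ?thesis unfolding P[of x]
  proof (rule models_induction[of _ Sigma00])
    show "crit \<Turnstile> (\<Union>p\<in>{p. Sigma00 p}. closures (induction_for p))"
      using crit(1) by (simp add: RCA0star_def ISigma00_def)
  qed (use p(1,2) assms(2,3) in \<open>simp_all add: P[symmetric] crit_folds\<close>)
qed

text \<open>The arguments appear in reverse order because z is bound innermost and so has index 0,
  while the induction variable has index 2.\<close>

lemma Sigma2_induct:
  assumes "crit \<Turnstile> ISigma02" "dfm (\<lambda>v. P (v 2) (v 1) (v 0))" "\<exists>y. \<forall>z. P 0 y z"
    "\<And>x. \<exists>y. \<forall>z. P x y z \<Longrightarrow> \<exists>y. \<forall>z. P (x + 1) y z"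
  shows "\<exists>y. \<forall>z. P x y z"
proof -
  obtain p e E where p: "Sigma00 p" "range E \<subseteq> sets"
    "\<And>u. P (app 3 u (\<lambda>_. 0) 2) (app 3 u (\<lambda>_. 0) 1) (app 3 u (\<lambda>_. 0) 0) = sat crit (app 3 u e) E p"
    using dfm_sat[OF assms(2)] by metis
  have P: "P x y z = sat crit (case_nat z (case_nat y (case_nat x e))) E p" for x y z
    using p(3)[of "case_nat z (case_nat y (\<lambda>_. x))"] by (simp add: app_3 numeral_2_eq_2)
  have "sat crit (case_nat x e) E (ExN (AllN p))"
  proof (rule models_induction[of _ Sigma02])
    show "crit \<Turnstile> (\<Union>p\<in>{p. Sigma02 p}. closures (induction_for p))"
      using assms(1) by (simp add: ISigma02_def)
    show "Sigma02 (ExN (AllN p))" using p(1) by (auto simp: Sigma02_def)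
  qed (use p(2) assms(3,4) in \<open>simp_all add: P[symmetric] crit_folds\<close>)
  then show ?thesis by (simp add: P[symmetric])
qed

text \<open>A bounded formula becomes both Sigma-1 and Pi-1 by a vacuous quantifier in front of the
  lifted formula, which makes comprehension for it an instance of the axiom.\<close>

lemma comprehension:
  assumes "dfm (\<lambda>v. P (v 0))"
  shows "{x. P x} \<in> sets"
proof -
  obtain p e E where p: "Sigma00 p" "range E \<subseteq> sets" "\<And>u. P (app 1 u (\<lambda>_. 0) 0) = sat crit (app 1 u e) E p"
    using dfm_sat[OF assms] by metis
  have P: "P x = sat crit (case_nat x e) E p" for x
    using p(3)[of "\<lambda>_. x"] by (simp add: app_1)
  define q where "q = fsubst (\<lambda>i. Var (Suc i)) id p"
  have q: "sat crit (case_nat y (case_nat x e)) E q = P x" for x y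
    by (simp add: q_def sat_fsubst P)
  have "Sigma00 q" unfolding q_def by (intro Sigma00_fsubst p)
  then have "Sigma01 (ExN q)" "Pi01 (AllN q)" by (auto simp: Sigma01_def Pi01_def)
  moreover obtain r where "r \<in> closures (comprehension_for (ExN q) (AllN q))"
    using closures_nonempty by blast
  ultimately have "valid crit (comprehension_for (ExN q) (AllN q))"
    using crit(1) valid_closures by (fastforce simp: models_def RCA0star_def Delta01_CA_def)
  then have "sat crit e E (comprehension_for (ExN q) (AllN q))"
    using p(2) by (simp add: valid_def sets_def)
  then obtain X where "X \<in> sets" "\<And>x. x \<in> X \<longleftrightarrow> P x"
    by (auto simp: sat_comprehension_for q sets_def)
  moreover then have "X = {x. P x}" by auto
  ultimately show ?thesis by simp
qed

section \<open>Arithmetic in the critical model\<close>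

lemma zero_add_elem: "0 + x = (x :: elem)"
proof (rule bounded_induct[of "\<lambda>x. 0 + x = x"])
  show "dfm (\<lambda>v. 0 + v 0 = v 0)" by (intro dfm_intros)
  show "0 + 0 = (0 :: elem)" by (rule basic)
  show "0 + (x + 1) = x + 1" if "0 + x = x" for x :: elem
    using that by (simp only: basic)
qed

lemma succ_add_elem: "x + 1 + y = x + y + (1 :: elem)"
proof (rule bounded_induct[of "\<lambda>y. x + 1 + y = x + y + 1"])
  show "dfm (\<lambda>v. x + 1 + v 0 = x + v 0 + 1)" by (intro dfm_intros)
  show "x + 1 + 0 = x + 0 + 1" by (simp only: basic)
  show "x + 1 + (y + 1) = x + (y + 1) + 1" if "x + 1 + y = x + y + 1" for y
    using that by (simp only: basic(4))
qed

lemma add_commute_elem: "x + y = y + (x :: elem)"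
proof (rule bounded_induct[of "\<lambda>x. x + y = y + x"])
  show "dfm (\<lambda>v. v 0 + y = y + v 0)" by (intro dfm_intros)
  show "0 + y = y + 0" by (simp only: basic zero_add_elem)
  show "x + 1 + y = y + (x + 1)" if "x + y = y + x" for x
    using succ_add_elem[of x y] that by (simp only: basic(4))
qed

lemma add_assoc_elem: "x + y + z = x + (y + (z :: elem))"
proof (rule bounded_induct[of "\<lambda>z. x + y + z = x + (y + z)"])
  show "dfm (\<lambda>v. x + y + v 0 = x + (y + v 0))" by (intro dfm_intros)
  show "x + y + 0 = x + (y + 0)" by (simp only: basic)
  show "x + y + (z + 1) = x + (y + (z + 1))" if "x + y + z = x + (y + z)" for z
    using that by (simp only: basic(4))
qed

instance elem :: comm_monoid_add
proof
  fix a b c :: elem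
  show "a + b + c = a + (b + c)" by (rule add_assoc_elem)
  show "a + b = b + a" by (rule add_commute_elem)
  show "0 + a = a" by (rule zero_add_elem)
qed

lemma zero_times_elem: "0 * x = (0 :: elem)"
proof (rule bounded_induct[of "\<lambda>x. 0 * x = 0"])
  show "dfm (\<lambda>v. 0 * v 0 = 0)" by (intro dfm_intros)
qed (simp_all add: basic(5,6))

lemma succ_times_elem: "(x + 1) * y = x * y + (y :: elem)"
proof (rule bounded_induct[of "\<lambda>y. (x + 1) * y = x * y + y"])
  show "dfm (\<lambda>v. (x + 1) * v 0 = x * v 0 + v 0)" by (intro dfm_intros)
qed (simp_all add: basic(5,6) ac_simps)

lemma times_commute_elem: "x * y = y * (x :: elem)"
proof (rule bounded_induct[of "\<lambda>x. x * y = y * x"])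
  show "dfm (\<lambda>v. v 0 * y = y * v 0)" by (intro dfm_intros)
qed (simp_all add: basic(5,6) zero_times_elem succ_times_elem)

lemma distrib_elem: "(x + y) * z = x * z + y * (z :: elem)"
proof (rule bounded_induct[of "\<lambda>z. (x + y) * z = x * z + y * z"])
  show "dfm (\<lambda>v. (x + y) * v 0 = x * v 0 + y * v 0)" by (intro dfm_intros)
qed (simp_all add: basic(5,6) ac_simps)

lemma times_assoc_elem: "x * y * z = x * (y * (z :: elem))"
proof (rule bounded_induct[of "\<lambda>z. x * y * z = x * (y * z)"])
  show "dfm (\<lambda>v. x * y * v 0 = x * (y * v 0))" by (intro dfm_intros)
next
  fix z assume *: "x * y * z = x * (y * z)"
  have "x * (y * z + y) = (y * z + y) * x" by (rule times_commute_elem)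
  also have "\<dots> = x * (y * z) + x * y"
    using times_commute_elem[of "y * z" x] times_commute_elem[of y x] by (simp add: distrib_elem)
  finally show "x * y * (z + 1) = x * (y * (z + 1))" using * by (simp only: basic(6))
qed (simp add: basic(5))

lemma one_times_elem: "1 * x = (x :: elem)"
  using succ_times_elem[of 0 x] by (simp add: zero_times_elem)

instance elem :: comm_semiring_1
proof
  fix a b c :: elem
  show "a * b * c = a * (b * c)" by (rule times_assoc_elem)
  show "a * b = b * a" by (rule times_commute_elem)
  show "1 * a = a" by (rule one_times_elem)
  show "(a + b) * c = a * c + b * c" by (rule distrib_elem)
  show "0 * a = 0" by (rule zero_times_elem)
  show "a * 0 = 0" by (rule basic)
  show "(0 :: elem) \<noteq> 1" using basic(1)[of 0] by simp
qed

lemma add_cancel_elem: "x + z = y + z \<Longrightarrow> x = (y :: elem)"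
proof -
  have "x + z = y + z \<longrightarrow> x = y"
  proof (rule bounded_induct[of "\<lambda>z. x + z = y + z \<longrightarrow> x = y"])
    show "dfm (\<lambda>v. x + v 0 = y + v 0 \<longrightarrow> x = y)" by (intro dfm_intros)
  next
    fix z show "x + z = y + z \<longrightarrow> x = y \<Longrightarrow> x + (z + 1) = y + (z + 1) \<longrightarrow> x = y"
      using basic(2)[of "x + z" "y + z"] by (simp add: add.assoc)
  qed simp
  then show "x + z = y + z \<Longrightarrow> x = y" by blast
qed

section \<open>Order and truncated subtraction\<close>

lemma zero_less_succ: "0 < y + (1 :: elem)"
proof (rule bounded_induct[of "\<lambda>y. 0 < y + 1"])
  show "dfm (\<lambda>v. 0 < v 0 + 1)" by (intro dfm_intros)
  show "0 < 0 + (1 :: elem)" using basic(8)[of 0 0] by blast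
  show "0 < y + 1 \<Longrightarrow> 0 < y + 1 + 1" for y :: elem using basic(8)[of 0 "y + 1"] by blast
qed

lemma succ_less_succ: "x < y \<Longrightarrow> x + 1 < y + (1 :: elem)"
proof -
  have "x < y \<longrightarrow> x + 1 < y + 1"
  proof (rule bounded_induct[of "\<lambda>y. x < y \<longrightarrow> x + 1 < y + 1"])
    show "dfm (\<lambda>v. x < v 0 \<longrightarrow> x + 1 < v 0 + 1)" by (intro dfm_intros)
  next
    fix y show "x < y \<longrightarrow> x + 1 < y + 1 \<Longrightarrow> x < y + 1 \<longrightarrow> x + 1 < y + 1 + 1"
      using basic(8)[of "x + 1" "y + 1"] basic(8)[of x y] by auto
  qed (simp add: basic(7,8))
  then show "x < y \<Longrightarrow> x + 1 < y + 1" by blast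
qed

lemma less_iff_elem: "x < y \<longleftrightarrow> (\<exists>z. y = x + z + (1 :: elem))"
proof
  \<comment> \<open>The difference z is confined below y so that the induction formula is
    bounded.\<close>
  have "x < y \<longrightarrow> (\<exists>z<y. y = x + z + 1)"
  proof (rule bounded_induct[of "\<lambda>y. x < y \<longrightarrow> (\<exists>z<y. y = x + z + 1)"])
    show "dfm (\<lambda>v. x < v 0 \<longrightarrow> (\<exists>z<v 0. v 0 = x + z + 1))" by (intro dfm_intros)
  next
    fix y assume *: "x < y \<longrightarrow> (\<exists>z<y. y = x + z + 1)"
    show "x < y + 1 \<longrightarrow> (\<exists>z<y + 1. y + 1 = x + z + 1)"
    proof
      assume "x < y + 1"
      then consider "x < y" | "x = y" using basic(8)[of x y] by blast
      then show "\<exists>z<y + 1. y + 1 = x + z + 1"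
      proof cases
        case 1
        then obtain z where "z < y" "y = x + z + 1" using * by blast
        moreover from this have "y + 1 = x + (z + 1) + 1" by (simp only: ac_simps)
        ultimately show ?thesis using succ_less_succ[of z y] by blast
      next
        case 2
        then show ?thesis using zero_less_succ[of y] by (intro exI[of _ 0]) simp
      qed
    qed
  qed (simp add: basic(7,8))
  then show "x < y \<Longrightarrow> \<exists>z. y = x + z + 1" by blast
  have "x < x + z + 1" for z
  proof (rule bounded_induct[of "\<lambda>z. x < x + z + 1"])
    show "dfm (\<lambda>v. x < x + v 0 + 1)" by (intro dfm_intros)
  next
    fix z assume "x < x + z + 1"
    moreover have "x + (z + 1) + 1 = x + z + 1 + 1" by (simp only: basic(4))
    ultimately show "x < x + (z + 1) + 1" using basic(8)[of x "x + z + 1"] by (simp only: simp_thms)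
  qed (simp add: basic(7,8))
  then show "\<exists>z. y = x + z + 1 \<Longrightarrow> x < y" by blast
qed

lemma zero_or_succ: "x = 0 \<or> (\<exists>y. x = y + (1 :: elem))"
  using less_iff_elem[of 0 x] basic(8)[of 0 x] zero_less_succ[of x] by auto

lemma less_linear_elem: "x < y \<or> x = y \<or> y < (x :: elem)"
proof (rule bounded_induct[of "\<lambda>y. x < y \<or> x = y \<or> y < x"])
  show "dfm (\<lambda>v. x < v 0 \<or> x = v 0 \<or> v 0 < x)" by (intro dfm_intros)
next
  show "x < 0 \<or> x = 0 \<or> 0 < x" using zero_or_succ[of x]
  proof (elim disjE exE)
    fix y assume "x = y + 1"
    then show ?thesis using zero_less_succ[of y] by (simp only: simp_thms)
  qed blast
next
  fix y assume *: "x < y \<or> x = y \<or> y < x"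
  have "x = y + 1 \<or> y + 1 < x" if lt: "y < x"
  proof -
    obtain z where z: "x = y + z + 1" using iffD1[OF less_iff_elem lt] by blast
    show ?thesis using zero_or_succ[of z]
    proof (elim disjE exE)
      assume "z = 0"
      then show ?thesis using z by (simp only: basic(3) simp_thms)
    next
      fix w assume "z = w + 1"
      then have "x = y + 1 + w + 1" using z by (simp only: ac_simps)
      then show ?thesis using less_iff_elem[of "y + 1" x] by blast
    qed
  qed
  with * show "x < y + 1 \<or> x = y + 1 \<or> y + 1 < x" using basic(8)[of x y] by blast
qed

lemma less_irrefl_elem: "\<not> x < (x :: elem)"
proof
  assume "x < x"
  from iffD1[OF less_iff_elem this] obtain z where "x = x + z + 1" by blast
  then have "0 + x = z + 1 + x" by (simp add: ac_simps)
  then have "0 = z + 1" by (rule add_cancel_elem)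
  then show False using basic(1)[of z] by simp
qed

lemma less_trans_elem: "x < y \<Longrightarrow> y < z \<Longrightarrow> x < (z :: elem)"
  unfolding less_iff_elem
proof (elim exE)
  fix u w assume "y = x + u + 1" "z = y + w + 1"
  then show "\<exists>v. z = x + v + 1" by (intro exI[of _ "u + w + 1"]) (simp add: ac_simps)
qed

instance elem :: linorder
proof
  fix x y z :: elem
  have asym: "\<not> b < a" if "a < b" for a b :: elem
    using that less_trans_elem[of a b a] less_irrefl_elem[of a] by blast
  show "(x < y) = (x \<le> y \<and> \<not> y \<le> x)" unfolding less_eq_elem_def
    using asym[of x y] less_irrefl_elem[of x] by auto
  show "x \<le> x" unfolding less_eq_elem_def by simp
  show "x \<le> y \<Longrightarrow> y \<le> z \<Longrightarrow> x \<le> z" unfolding less_eq_elem_def using less_trans_elem[of x y z] by auto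
  show "x \<le> y \<Longrightarrow> y \<le> x \<Longrightarrow> x = y" unfolding less_eq_elem_def using asym[of x y] by auto
  show "x \<le> y \<or> y \<le> x" unfolding less_eq_elem_def using less_linear_elem[of x y] by auto
qed

lemma le_iff_elem: "x \<le> y \<longleftrightarrow> (\<exists>z. y = x + (z :: elem))"
proof
  assume "x \<le> y"
  then consider "x < y" | "x = y" unfolding less_eq_elem_def by blast
  then show "\<exists>z. y = x + z"
  proof cases
    case 1
    then show ?thesis using less_iff_elem[of x y] add.assoc by metis
  next
    case 2
    then show ?thesis by (intro exI[of _ 0]) simp
  qed
next
  assume "\<exists>z. y = x + z"
  then obtain z where z: "y = x + z" ..
  show "x \<le> y" using zero_or_succ[of z]
  proof (elim disjE exE)
    fix w assume "z = w + 1"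
    then have "y = x + w + 1" using z by (simp only: ac_simps)
    then show ?thesis using less_iff_elem[of x y] unfolding less_eq_elem_def by blast
  qed (simp add: z)
qed

instantiation elem :: minus
begin

definition "x - y = (if y \<le> x then THE z. x = y + z else (0 :: elem))"

instance ..

end

lemma add_diff_elem: "x + y - x = (y :: elem)"
proof -
  have "x \<le> x + y" by (auto simp: le_iff_elem)
  moreover have "(THE z. x + y = x + z) = y"
    using add_cancel_elem[of _ x] by (auto simp: add.commute[of x])
  ultimately show ?thesis by (simp add: minus_elem_def)
qed

lemma diff_zero_elem: "\<not> y \<le> x \<Longrightarrow> x - y = (0 :: elem)"
  by (simp add: minus_elem_def)

lemma add_left_mono_elem: "x \<le> y \<Longrightarrow> z + x \<le> z + (y :: elem)"
  by (auto simp: le_iff_elem add.assoc)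

lemma add_left_le_elem: "z + x \<le> z + y \<longleftrightarrow> x \<le> (y :: elem)"
proof
  assume "z + x \<le> z + y"
  then obtain w where "z + y = z + x + w" by (auto simp: le_iff_elem)
  then have "y + z = x + w + z" by (simp add: ac_simps)
  then show "x \<le> y" using add_cancel_elem by (auto simp: le_iff_elem)
qed (rule add_left_mono_elem)

instance elem :: linordered_semidom
proof
  fix a b c :: elem
  show "a + b - a = b" by (rule add_diff_elem)
  show "a - b - c = a - (b + c)"
  proof (cases "b \<le> a")
    case True
    then obtain d where d: "a = b + d" by (auto simp: le_iff_elem)
    show ?thesis
    proof (cases "c \<le> d")
      case True
      then obtain e where "d = c + e" by (auto simp: le_iff_elem)
      then show ?thesis using d add_diff_elem[of "b + c" e] by (simp add: add_diff_elem add.assoc)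
    next
      case False
      then show ?thesis using d by (simp add: add_diff_elem diff_zero_elem add_left_le_elem)
    qed
  next
    case False
    moreover have "\<not> c \<le> 0 \<or> c = 0" by (simp add: less_eq_elem_def basic(7))
    moreover have "\<not> b + c \<le> a" using False by (auto simp: le_iff_elem add.assoc)
    ultimately show ?thesis using add_diff_elem[of 0 0] by (auto simp: diff_zero_elem)
  qed
  show "a * (b - c) = a * b - a * c"
  proof (cases "c \<le> b")
    case True
    then obtain d where "b = c + d" by (auto simp: le_iff_elem)
    then show ?thesis by (simp add: add_diff_elem distrib_left)
  next
    case False
    then have "b \<le> c" by simp
    then obtain d where d: "c = b + d" by (auto simp: le_iff_elem)
    show ?thesis
    proof (cases "a * c \<le> a * b")
      case True
      then have "a * c = a * b" using d by (intro antisym) (auto simp: le_iff_elem distrib_left)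
      then show ?thesis using False add_diff_elem[of "a * b" 0] by (simp add: diff_zero_elem)
    qed (use False in \<open>simp add: diff_zero_elem\<close>)
  qed
  show "a \<le> b \<Longrightarrow> c + a \<le> c + b" by (rule add_left_mono_elem)
  show "0 < (1 :: elem)" using zero_less_succ[of 0] by simp
  show "b \<le> a \<Longrightarrow> a - b + b = a" by (auto simp: le_iff_elem add_diff_elem) (rule add.commute)
  show "a \<noteq> 0 \<Longrightarrow> b \<noteq> 0 \<Longrightarrow> a * b \<noteq> 0"
    using zero_or_succ[of a] zero_or_succ[of b] basic(1)
    by (auto simp: distrib_left distrib_right simp flip: add.assoc)
  show "a < b \<Longrightarrow> 0 < c \<Longrightarrow> c * a < c * b"
  proof -
    assume "a < b" "0 < c"
    then obtain z w where "b = a + z + 1" "c = 0 + w + 1"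
      using less_iff_elem[of a b] less_iff_elem[of 0 c] by blast
    then have "c * b = c * a + (c * z + w) + 1" by (simp add: distrib_left ac_simps)
    then show "c * a < c * b" using less_iff_elem[of "c * a" "c * b"] by blast
  qed
qed


instance elem :: discrete_linordered_semidom
proof
  show "k < l \<longleftrightarrow> k + 1 \<le> l" for k l :: elem
    by (auto simp: less_iff_elem le_iff_elem ac_simps)
qed

text \<open>The ring of differences only serves to make the decision procedure for linear arithmetic
  available for elements of the model.\<close>

definition diffrel :: "elem \<times> elem \<Rightarrow> elem \<times> elem \<Rightarrow> bool" where
  "diffrel = (\<lambda>(x, y) (u, v). x + v = u + y)"

lemma diffrel_iff [simp]: "diffrel (x, y) (u, v) \<longleftrightarrow> x + v = u + y"
  by (simp add: diffrel_def)

lemma diffrel_trans: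
  fixes a b c d e f :: elem
  assumes "a + d = c + b" "c + f = e + d"
  shows "a + f = e + b"
proof -
  have "(a + f) + d = (a + d) + f" by (simp only: ac_simps)
  also have "\<dots> = (c + f) + b" by (simp only: assms ac_simps)
  also have "\<dots> = (e + b) + d" by (simp only: assms ac_simps)
  finally show ?thesis by simp
qed

quotient_type diff = "elem \<times> elem" / diffrel
  morphisms Rep_Diff Abs_Diff
proof (rule equivpI)
  show "reflp diffrel" by (auto simp: reflp_def)
  show "symp diffrel" by (auto simp: symp_def)
  show "transp diffrel" by (auto simp: transp_def intro: diffrel_trans)
qed

lemma add_eqs_elem: "x + v = u + y \<Longrightarrow> x' + v' = u' + y' \<Longrightarrow> x + x' + (v + v') = u + u' + (y + (y' :: elem))"
proof -
  assume "x + v = u + y" "x' + v' = u' + y'"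
  then have "x + v + (x' + v') = u + y + (u' + y')" by (simp only:)
  then show ?thesis by (simp only: ac_simps)
qed

instantiation diff :: comm_ring_1
begin

lift_definition zero_diff :: diff is "(0, 0)" .

lift_definition one_diff :: diff is "(1, 0)" .

lift_definition plus_diff :: "diff \<Rightarrow> diff \<Rightarrow> diff" is "\<lambda>(x, y) (u, v). (x + u, y + v)"
  by (unfold diffrel_def, clarify, rule add_eqs_elem)

lift_definition uminus_diff :: "diff \<Rightarrow> diff" is "\<lambda>(x, y). (y, x)"
  by (clarsimp simp: add.commute)

lift_definition minus_diff :: "diff \<Rightarrow> diff \<Rightarrow> diff" is "\<lambda>(x, y) (u, v). (x + v, y + u)"
  by (unfold diffrel_def, clarify, rule add_eqs_elem, assumption, simp only: add.commute)

lift_definition times_diff :: "diff \<Rightarrow> diff \<Rightarrow> diff"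
  is "\<lambda>(x, y) (u, v). (x * u + y * v, x * v + y * u)"
proof (unfold diffrel_def, clarify)
  fix s t u v w x y z :: elem
  assume "s + v = u + t" and "w + z = y + x"
  then have "(s + v) * w + (u + t) * x + u * (w + z) + v * (y + x) =
    (u + t) * w + (s + v) * x + u * (y + x) + v * (w + z)"
    by simp
  then have "(s * w + t * x) + (u * z + v * y) + (u * w + u * x + v * w + v * x)
      = (u * y + v * z) + (s * x + t * w) + (u * w + u * x + v * w + v * x)"
    by (simp only: algebra_simps)
  then show "(s * w + t * x) + (u * z + v * y) = (u * y + v * z) + (s * x + t * w)"
    by (rule add_right_imp_eq)
qed

instance
  by standard (transfer; clarsimp simp: algebra_simps)+

end

lemma diffrel_shift:
  fixes x y u v x' y' u' v' :: elem
  assumes "diffrel (x, y) (x', y')" "diffrel (u, v) (u', v')"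
  shows "x + v + (y' + v') = x' + v' + (y + v)" "u + y + (y' + v') = u' + y' + (y + v)"
proof -
  have "x + v + (y' + v') = (x + y') + (v + v')" by (simp only: ac_simps)
  also have "\<dots> = (x' + y) + (v + v')" using assms(1) by simp
  finally show "x + v + (y' + v') = x' + v' + (y + v)" by (simp only: ac_simps)
  have "u + y + (y' + v') = (u + v') + (y + y')" by (simp only: ac_simps)
  also have "\<dots> = (u' + v) + (y + y')" using assms(2) by simp
  finally show "u + y + (y' + v') = u' + y' + (y + v)" by (simp only: ac_simps)
qed

instantiation diff :: linorder
begin

lift_definition less_eq_diff :: "diff \<Rightarrow> diff \<Rightarrow> bool" is "\<lambda>(x, y) (u, v). x + v \<le> u + y"
proof (clarify)
  fix x y x' y' u v u' v'
  assume "diffrel (x, y) (x', y')" "diffrel (u, v) (u', v')"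
  from diffrel_shift[OF this] show "x + v \<le> u + y \<longleftrightarrow> x' + v' \<le> u' + y'"
    by (metis add_le_cancel_right)
qed

lift_definition less_diff :: "diff \<Rightarrow> diff \<Rightarrow> bool" is "\<lambda>(x, y) (u, v). x + v < u + y"
proof (clarify)
  fix x y x' y' u v u' v'
  assume "diffrel (x, y) (x', y')" "diffrel (u, v) (u', v')"
  from diffrel_shift[OF this] show "x + v < u + y \<longleftrightarrow> x' + v' < u' + y'"
    by (metis add_less_cancel_right)
qed

instance
proof
  fix i j k :: diff
  show "(i < j) = (i \<le> j \<and> \<not> j \<le> i)" by transfer auto
  show "i \<le> i" by transfer auto
  show "i \<le> j \<Longrightarrow> j \<le> i \<Longrightarrow> i = j" by transfer auto
  show "i \<le> j \<or> j \<le> i" by transfer auto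
  show "i \<le> j \<Longrightarrow> j \<le> k \<Longrightarrow> i \<le> k"
  proof transfer
    have "x1 + z2 \<le> z1 + x2" if "x1 + y2 \<le> y1 + x2" "y1 + z2 \<le> z1 + y2" for x1 x2 y1 y2 z1 z2 :: elem
    proof -
      have "x1 + z2 + (y1 + y2) = (x1 + y2) + (y1 + z2)" by (simp only: ac_simps)
      also have "\<dots> \<le> (y1 + x2) + (z1 + y2)" using that by (rule add_mono)
      also have "\<dots> = z1 + x2 + (y1 + y2)" by (simp only: ac_simps)
      finally show ?thesis by simp
    qed
    then show "\<And>i j k :: elem \<times> elem.
      (case i of (x, y) \<Rightarrow> \<lambda>(u, v). x + v \<le> u + y) j \<Longrightarrow>
      (case j of (x, y) \<Rightarrow> \<lambda>(u, v). x + v \<le> u + y) k \<Longrightarrow>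
      (case i of (x, y) \<Rightarrow> \<lambda>(u, v). x + v \<le> u + y) k"
      by (auto split: prod.splits)
  qed
qed

end

lift_definition emb :: "elem \<Rightarrow> diff" is "\<lambda>x. (x, 0)" .

lemma emb_add [simp]: "emb (x + y) = emb x + emb y"
  by transfer simp

lemma emb_mult [simp]: "emb (x * y) = emb x * emb y"
  by transfer simp

lemma emb_0 [simp]: "emb 0 = 0"
  by transfer simp

lemma emb_1 [simp]: "emb 1 = 1"
  by transfer simp

lemma add_less_add_iff: "x + v < u + y \<longleftrightarrow> (\<exists>z>0. u + y = x + z + (v :: elem))"
proof
  assume "x + v < u + y"
  then obtain z where "u + y = x + v + z + 1" using less_iff_elem[of "x + v" "u + y"] by blast
  then have "u + y = x + (z + 1) + v" by (simp only: ac_simps)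
  then show "\<exists>z>0. u + y = x + z + v" using zero_less_succ[of z] by blast
next
  assume "\<exists>z>0. u + y = x + z + v"
  then obtain z where z: "0 < z" "u + y = x + z + v" by blast
  have "x + v < x + v + z" using z(1) by simp
  also have "x + v + z = u + y" unfolding z(2) by (simp only: ac_simps)
  finally show "x + v < u + y" .
qed

text \<open>Positive elements of the ring are exactly the embedded positive elements of the model;
  compatibility of the order with sum and product is thus inherited.\<close>

lemma less_iff_emb: "i < j \<longleftrightarrow> (\<exists>z>0. j = i + emb z)"
  by (transfer, clarsimp split: prod.splits) (rule add_less_add_iff)

instantiation diff :: linordered_idom
begin

definition "\<bar>i :: diff\<bar> = (if i < 0 then - i else i)"

definition "sgn (i :: diff) = (if i = 0 then 0 else if 0 < i then 1 else - 1)"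

instance
proof
  fix i j k :: diff
  have less: "k + i < k + j" if "i < j" for i j
    using that unfolding less_iff_emb by (auto simp: add.assoc)
  show "i \<le> j \<Longrightarrow> k + i \<le> k + j"
    using less[of i j] by (auto simp: le_less)
  show "i < j \<Longrightarrow> 0 < k \<Longrightarrow> k * i < k * j"
  proof -
    assume "i < j" "0 < k"
    then obtain z w where "0 < z" "j = i + emb z" "0 < w" "k = emb w"
      unfolding less_iff_emb by auto
    then show ?thesis unfolding less_iff_emb
      by (intro exI[of _ "w * z"]) (simp add: distrib_left)
  qed
  show "\<bar>i\<bar> = (if i < 0 then -i else i)" by (simp only: abs_diff_def)
  show "sgn i = (if i = 0 then 0 else if 0 < i then 1 else - 1)" by (simp only: sgn_diff_def)
qed

end

lemma emb_2 [simp]: "emb 2 = 2"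
  using emb_add[of 1 1] by simp

lemma emb_nonneg: "0 \<le> emb x"
  by transfer (simp add: le_iff_elem)

lemma emb_eq: "x = y \<longleftrightarrow> emb x = emb y"
  by transfer simp

lemma emb_le: "x \<le> y \<longleftrightarrow> emb x \<le> emb y"
  by transfer simp

lemma emb_less: "x < y \<longleftrightarrow> emb x + 1 \<le> emb y"
  by transfer (simp add: less_iff_succ_less_eq)

text \<open>After \<open>rule ccontr\<close>, unfolding these turns premises and negated goal into
  inequalities over an ordered ring. Strictness becomes \<open>+ 1 \<le>\<close>, which puts the
  discreteness of the order within reach of \<open>linarith\<close>. Nonnegativity of embedded
  elements is lost in passing and is added through \<open>emb_nonneg\<close> where it
  matters.\<close>

lemmas diff_arith = not_less not_le emb_less emb_le emb_eq emb_add emb_mult emb_0 emb_1 emb_2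

section \<open>Substitution into bounded predicates, least and greatest elements\<close>

lemma dfm_subst:
  assumes P: "dfm P" and f: "\<And>i. i < k \<Longrightarrow> dtm (f i)"
  shows "dfm (\<lambda>v. P (app k (\<lambda>i. f i v) w))"
  using f
proof -
  obtain p e E where p: "Sigma00 p" "range E \<subseteq> sets"
    "\<And>u. P (app k u w) = sat crit (app k u e) E p"
    using dfm_sat[OF P, of k w] by metis
  have "\<forall>i. \<exists>t \<pi>. i < k \<longrightarrow> (\<forall>j. arg (\<pi> j)) \<and> (\<forall>v. f i v = ev crit (\<lambda>j. \<pi> j v) t)"
    using f unfolding dtm_def by blast
  then obtain t \<pi> where t: "\<And>i j. i < k \<Longrightarrow> arg (\<pi> i j)"
    "\<And>i v. i < k \<Longrightarrow> f i v = ev crit (\<lambda>j. \<pi> i j v) (t i)" by metis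
  \<comment> \<open>The pair (i, j) addresses the j-th parameter of the term \<open>t i\<close>, and
    (k, j) the j-th fixed parameter of the formula p, so that these families do not clash.\<close>
  define \<rho> where "\<rho> n = (case prod_decode n of (i, j) \<Rightarrow> if i < k then \<pi> i j else (\<lambda>v. e j))" for n
  have \<rho>: "arg (\<rho> n)" for n
    by (cases "prod_decode n") (auto simp: \<rho>_def t(1) arg_def[of "\<lambda>v. e _"])
  define s where "s i = (if i < k then tsubst (\<lambda>j. Var (prod_encode (i, j))) (t i)
      else Var (prod_encode (k, i - k)))" for i
  have "ev crit (\<lambda>n. \<rho> n v) (s i) = app k (\<lambda>i. f i v) e i" for i v
    by (simp add: s_def app_def ev_tsubst \<rho>_def t(2))
  then have "P (app k (\<lambda>i. f i v) w) = sat crit (\<lambda>n. \<rho> n v) E (fsubst s id p)" for v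
    by (simp add: p(3) sat_fsubst)
  then show ?thesis
    unfolding dfm_def using p(1,2) \<rho>
    by (intro exI[of _ "fsubst s id p"] exI[of _ \<rho>] exI[of _ E]) (simp add: Sigma00_fsubst)
qed

text \<open>Allows a predicate known only to be definable, or kept folded, to be applied to terms
  inside a larger definability goal.\<close>

lemma dfm1: "dfm (\<lambda>v. P (v 0)) \<Longrightarrow> dtm f \<Longrightarrow> dfm (\<lambda>v. P (f v))"
  using dfm_subst[of "\<lambda>v. P (v 0)" 1 "\<lambda>_. f"] by (simp add: app_def)

lemma dfm2: "dfm (\<lambda>v. P (v 0) (v 1)) \<Longrightarrow> dtm f \<Longrightarrow> dtm g \<Longrightarrow> dfm (\<lambda>v. P (f v) (g v))"
  using dfm_subst[of "\<lambda>v. P (v 0) (v 1)" 2 "case_nat f (\<lambda>_. g)"]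
  by (simp add: app_def split: nat.split)

lemma dfm3: "dfm (\<lambda>v. P (v 0) (v 1) (v 2)) \<Longrightarrow> dtm f \<Longrightarrow> dtm g \<Longrightarrow> dtm h \<Longrightarrow>
    dfm (\<lambda>v. P (f v) (g v) (h v))"
  using dfm_subst[of "\<lambda>v. P (v 0) (v 1) (v 2)" 3 "case_nat f (case_nat g (\<lambda>_. h))"]
  by (simp add: app_def numeral_2_eq_2 split: nat.split)

instance elem :: canonically_ordered_monoid_add
  by standard (rule le_iff_elem)

lemma less_succ_iff: "x < y + 1 \<longleftrightarrow> x \<le> (y :: elem)"
  by (simp only: less_iff_succ_less_eq add_le_cancel_right)

lemma less_succI: "x < y \<Longrightarrow> x < y + (1 :: elem)"
  by (simp add: less_succ_iff less_imp_le)

lemma succ_cases: obtains "x = 0" | y where "x = y + (1 :: elem)"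
  using zero_or_succ by blast

lemma least_elem:
  assumes P: "dfm (\<lambda>v. P (v 0))" "P x"
  obtains y where "P y" "\<And>z. z < y \<Longrightarrow> \<not> P z"
proof -
  \<comment> \<open>Searching below n makes the least number principle a bounded statement in
    n.\<close>
  have "(\<exists>y<n. P y) \<longrightarrow> (\<exists>y<n. P y \<and> (\<forall>z<y. \<not> P z))" for n
  proof (induction n rule: bounded_induct)
    case dfm
    show ?case
      by (intro dfm_intros dfm1[OF P(1)])
  next
    case (step n)
    show ?case
    proof
      assume "\<exists>y<n + 1. P y"
      show "\<exists>y<n + 1. P y \<and> (\<forall>z<y. \<not> P z)"
      proof (cases "\<exists>y<n. P y")
        case True
        then obtain y where "y < n" "P y \<and> (\<forall>z<y. \<not> P z)" using step by blast
        moreover from this have "y < n + 1" by (simp add: less_succ_iff)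
        ultimately show ?thesis by blast
      next
        case False
        with \<open>\<exists>y<n + 1. P y\<close> have "P n" unfolding less_succ_iff le_less by blast
        with False show ?thesis using less_succ_iff[of n n] by blast
      qed
    qed
  qed simp
  from this[of "x + 1"] P(2) show thesis using that less_succ_iff[of x x] by blast
qed

text \<open>The greatest element is the least upper bound u: if u did not satisfy P, its predecessor
  would be a smaller upper bound. Being an upper bound is a bounded property thanks to b.\<close>

lemma greatest_elem:
  assumes P: "dfm (\<lambda>v. P (v 0))" "P x" and b: "\<And>y. P y \<Longrightarrow> y \<le> b"
  obtains y where "P y" "\<And>z. P z \<Longrightarrow> z \<le> y"
proof -
  have "dfm (\<lambda>v. \<forall>y<b + 1. P y \<longrightarrow> y \<le> v 0)"
    by (intro dfm_intros dfm1[OF P(1)])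
  moreover have "\<forall>y<b + 1. P y \<longrightarrow> y \<le> b" using b by blast
  ultimately obtain u where u: "\<forall>y<b + 1. P y \<longrightarrow> y \<le> u"
      "\<And>z. z < u \<Longrightarrow> \<not> (\<forall>y<b + 1. P y \<longrightarrow> y \<le> z)"
    by (rule least_elem) blast
  have max: "y \<le> u" if "P y" for y using u(1) b that by (simp add: less_succ_iff)
  have "P u"
  proof (rule ccontr)
    assume "\<not> P u"
    then have less: "y < u" if "P y" for y using max that le_neq_trans by blast
    have "u \<noteq> 0" using less P(2) by auto
    then obtain w where w: "u = w + 1" using succ_cases by blast
    then have "y \<le> w" if "P y" for y using less[OF that] by (simp add: less_succ_iff)
    then show False using u(2)[of w] w less_succ_iff[of w w] by blast
  qed
  with max that show thesis by blast
qed

section \<open>Powers of two, division and parity\<close>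

lemma pw_add: "x \<up> (y + z) = x \<up> y * x \<up> z"
proof (induction z rule: bounded_induct)
  case dfm
  show ?case by (intro dfm_intros)
next
  case (step z)
  have "x \<up> (y + (z + 1)) = x \<up> (y + z) * x" by (simp only: basic(10) add.assoc[symmetric])
  with step show ?case by (simp only: basic(10) mult.assoc)
qed (simp add: basic(9))

lemma pw_pos: "0 < 2 \<up> x"
proof (induction x rule: bounded_induct)
  case dfm
  show ?case by (intro dfm_intros)
qed (simp_all add: basic(9,10))

lemma less_pw: "x < 2 \<up> x"
proof (induction x rule: bounded_induct)
  case dfm
  show ?case by (intro dfm_intros)
next
  case (step x)
  have "2 \<up> (x + 1) = 2 \<up> x * 2" by (rule basic(10))
  with step pw_pos[of x] show ?case by - (rule ccontr, unfold diff_arith, linarith)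
qed (simp add: basic(9))

lemma pw_mono: "x \<le> y \<Longrightarrow> 2 \<up> x \<le> 2 \<up> y"
proof -
  assume "x \<le> y"
  then obtain z where "y = x + z" by (auto simp: le_iff_elem)
  moreover have "1 \<le> 2 \<up> z" using pw_pos[of z] by (simp add: less_iff_succ_less_eq)
  ultimately show ?thesis using mult_left_mono[of 1 "2 \<up> z" "2 \<up> x"] by (simp add: pw_add)
qed

lemma pw_succ: "2 \<up> (x + 1) = 2 \<up> x + 2 \<up> x"
  by (simp only: basic(10) mult_2_right)

lemma division_elem:
  fixes x w :: elem
  assumes "0 < w"
  shows "\<exists>q<x + 1. \<exists>s<w. x = q * w + s"
proof (induction x rule: bounded_induct)
  case dfm
  show ?case by (intro dfm_intros)
next
  case 0
  show ?case using assms by (auto intro!: exI[of _ 0])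
next
  case (step x)
  then obtain q s where *: "q < x + 1" "s < w" "x = q * w + s" by blast
  show ?case
  proof (cases "s + 1 = w")
    case True
    have "x + 1 = q * w + (s + 1)" using *(3) by (simp only: add.assoc)
    then have "x + 1 = (q + 1) * w + 0" unfolding True by (simp add: distrib_right)
    moreover have "q + 1 < x + 1 + 1" using *(1) by (simp add: less_succ_iff)
    ultimately show ?thesis using assms by blast
  next
    case False
    then have "s + 1 < w" using *(2) less_iff_succ_less_eq[of s w] by (simp add: le_less)
    moreover have "q < x + 1 + 1" using *(1) by (rule less_succI)
    moreover have "x + 1 = q * w + (s + 1)" using *(3) by (simp add: algebra_simps)
    ultimately show ?thesis by blast
  qed
qed

lemma even_or_odd: "\<exists>q. x = 2 * q \<or> x = 2 * q + (1 :: elem)"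
proof -
  obtain q s where "s < 2" "x = q * 2 + s" using division_elem[of 2 x] by auto
  moreover have "s = 0 \<or> s = 1" using \<open>s < 2\<close> less_succ_iff[of s 1] less_succ_iff[of s 0]
    by (auto simp: le_less)
  ultimately show ?thesis by (auto simp: mult.commute)
qed

section \<open>Coding of finite sets in the critical model\<close>

definition fmem :: "elem \<Rightarrow> elem \<Rightarrow> bool" where
  "fmem x h \<longleftrightarrow> (\<exists>q<h + 1. \<exists>r<2 \<up> x. h = (2 * q + 1) * 2 \<up> x + r)"

lemma dfm_fmem [dfm_intros]: "dtm f \<Longrightarrow> dtm g \<Longrightarrow> dfm (\<lambda>v. fmem (f v) (g v))"
proof -
  have "dfm (\<lambda>v. fmem (v 0) (v 1))" unfolding fmem_def by (intro dfm_intros)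
  then show "dtm f \<Longrightarrow> dtm g \<Longrightarrow> ?thesis" by (rule dfm2)
qed


text \<open>The bound on q comes for free: the factor \<open>2 \<up> x\<close> is at least 1, so q
  cannot exceed h.\<close>

lemma fmem_iff: "fmem x h \<longleftrightarrow> (\<exists>q r. r < 2 \<up> x \<and> h = (2 * q + 1) * 2 \<up> x + r)"
proof
  assume "\<exists>q r. r < 2 \<up> x \<and> h = (2 * q + 1) * 2 \<up> x + r"
  then obtain q r where *: "r < 2 \<up> x" "h = (2 * q + 1) * 2 \<up> x + r" by blast
  have "1 \<le> 2 \<up> x" using pw_pos[of x] by (simp add: less_iff_succ_less_eq)
  then have "(2 * q + 1) * 1 \<le> (2 * q + 1) * 2 \<up> x" by (rule mult_left_mono) simp
  then have "q < h + 1" unfolding *(2) using emb_nonneg[of r] emb_nonneg[of q]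
    by - (rule ccontr, unfold diff_arith mult_1_right, linarith)
  with * show "fmem x h" unfolding fmem_def by blast
qed (auto simp: fmem_def)

lemma fmem_le: "fmem x h \<Longrightarrow> 2 \<up> x \<le> h"
proof -
  assume "fmem x h"
  then obtain q r where "h = (2 * q + 1) * 2 \<up> x + r" unfolding fmem_iff by blast
  then have "h = 2 * q * 2 \<up> x + 2 \<up> x + r" by (simp only: distrib_right mult_1)
  then have "h = 2 \<up> x + (2 * q * 2 \<up> x + r)" by (simp only: ac_simps)
  then show ?thesis by (auto simp: le_iff_elem)
qed

lemma fmem_less: "fmem x h \<Longrightarrow> x < h"
  by (rule order.strict_trans2[OF less_pw fmem_le])

lemma fmem_bound: "c < 2 \<up> n \<Longrightarrow> fmem x c \<Longrightarrow> x < n"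
proof (rule ccontr)
  assume *: "c < 2 \<up> n" "fmem x c" "\<not> x < n"
  then have "2 \<up> n \<le> 2 \<up> x" by (intro pw_mono) simp
  also have "\<dots> \<le> c" using *(2) by (rule fmem_le)
  finally show False using *(1) by simp
qed

text \<open>Adding \<open>2 \<up> n\<close> sets the digit n, which is still 0 in c. For x < n,
  \<open>2 \<up> n\<close> is an even multiple \<open>2 * K * A\<close> of
  \<open>A = 2 \<up> x\<close>, so it moves the witness q by K and leaves digit x alone.\<close>

lemma fmem_add_pw:
  assumes c: "c < 2 \<up> n"
  shows "fmem x (c + 2 \<up> n) \<longleftrightarrow> fmem x c \<or> x = n"
proof (cases x n rule: linorder_cases)
  case less
  then obtain k where n: "n = x + k + 1" using less_iff_elem[of x n] by blast
  define A K where "A = 2 \<up> x" and "K = 2 \<up> k"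
  have "2 \<up> n = 2 \<up> (x + k) * 2" unfolding n by (rule basic(10))
  then have pw: "2 \<up> n = 2 * K * A"
    unfolding A_def K_def pw_add by (simp only: ac_simps)
  have "(\<exists>q r. r < A \<and> c + 2 * K * A = (2 * q + 1) * A + r) \<longleftrightarrow>
      (\<exists>q r. r < A \<and> c = (2 * q + 1) * A + r)"
  proof
    assume "\<exists>q r. r < A \<and> c + 2 * K * A = (2 * q + 1) * A + r"
    then obtain q r where *: "r < A" "c + 2 * K * A = (2 * q + 1) * A + r" by blast
    have "K \<le> q"
    proof (rule ccontr)
      assume "\<not> K \<le> q"
      then have "q + 1 \<le> K" by (simp add: not_le less_iff_succ_less_eq)
      then obtain e where e: "K = q + 1 + e" by (auto simp: le_iff_elem)
      have "c + 2 * K * A = (2 * q + 1) * A + (A + (c + 2 * e * A))"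
        unfolding e by (simp add: algebra_simps mult_2 mult_2_right)
      then have "(2 * q + 1) * A + (A + (c + 2 * e * A)) = (2 * q + 1) * A + r"
        by (simp only: *(2))
      then have "A + (c + 2 * e * A) = r" by (rule add_left_imp_eq)
      then have "A \<le> r" by (auto simp: le_iff_elem)
      then show False using *(1) by simp
    qed
    then obtain p where p: "q = K + p" by (auto simp: le_iff_elem)
    have "c + 2 * K * A = (2 * p + 1) * A + r + 2 * K * A"
      using *(2) unfolding p by (simp add: algebra_simps)
    then have "c = (2 * p + 1) * A + r" by (rule add_right_imp_eq)
    with *(1) show "\<exists>q r. r < A \<and> c = (2 * q + 1) * A + r" by blast
  next
    assume "\<exists>q r. r < A \<and> c = (2 * q + 1) * A + r"
    then obtain q r where *: "r < A" "c = (2 * q + 1) * A + r" by blast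
    then have "c + 2 * K * A = (2 * (q + K) + 1) * A + r" by (simp add: algebra_simps)
    with *(1) show "\<exists>q r. r < A \<and> c + 2 * K * A = (2 * q + 1) * A + r" by blast
  qed
  moreover have "x \<noteq> n" using less by simp
  ultimately show ?thesis by (simp add: fmem_iff pw A_def)
next
  case equal
  then have "fmem x (c + 2 \<up> n)"
    unfolding fmem_iff using c by (intro exI[of _ 0] exI[of _ c]) (simp add: add.commute)
  then show ?thesis using equal by simp
next
  case greater
  then obtain k where x: "x = n + k + 1" using less_iff_elem[of n x] by blast
  have "2 \<up> n \<le> 2 \<up> (n + k)" by (rule pw_mono) simp
  then have "c + 2 \<up> n < 2 \<up> x" using c unfolding x pw_succ
    by - (rule ccontr, unfold diff_arith, linarith)
  then have "\<not> fmem x (c + 2 \<up> n)" using fmem_le[of x "c + 2 \<up> n"] by auto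
  moreover have "\<not> fmem x c" using fmem_bound[OF c, of x] greater by auto
  ultimately show ?thesis using greater by blast
qed

text \<open>Finite comprehension, by deciding one binary digit after the other. The bound
  \<open>2 \<up> n\<close> on the code is what makes this provable by bounded induction, and is
  where exponentiation enters.\<close>

lemma code_exists:
  assumes P: "dfm (\<lambda>v. P (v 0))"
  obtains c where "c < 2 \<up> n" "\<And>x. fmem x c \<longleftrightarrow> x < n \<and> P x"
proof -
  have "\<exists>c<2 \<up> n. \<forall>x<n. fmem x c \<longleftrightarrow> P x"
  proof (induction n rule: bounded_induct)
    case dfm
    show ?case by (intro dfm_intros dfm1[OF P])
  next
    case 0
    show ?case by (auto simp: basic(9) intro: exI[of _ 0])
  next
    case (step n)
    then obtain c where c: "c < 2 \<up> n" "\<And>x. x < n \<Longrightarrow> fmem x c \<longleftrightarrow> P x" by blast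
    have less: "c + 2 \<up> n < 2 \<up> (n + 1)" "c < 2 \<up> (n + 1)"
      using c(1) emb_nonneg[of "2 \<up> n"] by - (unfold pw_succ diff_arith, linarith+)
    have n: "\<not> fmem n c" using fmem_bound[OF c(1), of n] by auto
    show ?case
    proof (cases "P n")
      case True
      then have "\<forall>x<n + 1. fmem x (c + 2 \<up> n) \<longleftrightarrow> P x"
        using c(2) n by (auto simp: fmem_add_pw[OF c(1)] less_succ_iff le_less)
      with less(1) show ?thesis by blast
    next
      case False
      then have "\<forall>x<n + 1. fmem x c \<longleftrightarrow> P x"
        using c(2) n by (auto simp: less_succ_iff le_less)
      with less(2) show ?thesis by blast
    qed
  qed
  then show thesis using that fmem_bound by metis
qed

section \<open>Pairing, cardinality and the pigeonhole principle\<close>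

definition pr :: "elem \<Rightarrow> elem \<Rightarrow> elem" where
  "pr i j = (i + j) * (i + j) + i"

lemma dtm_pr [dfm_intros]: "dtm f \<Longrightarrow> dtm g \<Longrightarrow> dtm (\<lambda>v. pr (f v) (g v))"
  unfolding pr_def by (intro dfm_intros)

text \<open>With s = i + j, the code of (i, j) lies at or above the square of s and below the square
  of s + 1.\<close>

lemma pr_less_pr:
  assumes "i + j < i' + j'"
  shows "pr i j < pr i' j'"
proof -
  have "(i + j + 1) * (i + j + 1) \<le> (i' + j') * (i' + j')"
    using assms by (intro mult_mono) (simp_all add: less_iff_succ_less_eq)
  then have "(i + j) * (i + j) + (i + j) + (i + j) + 1 \<le> (i' + j') * (i' + j')"
    by (simp add: algebra_simps)
  then show ?thesis unfolding pr_def using emb_nonneg[of j] emb_nonneg[of i] emb_nonneg[of i']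
    by - (rule ccontr, unfold diff_arith, linarith)
qed

lemma pr_eq_iff [simp]: "pr i j = pr i' j' \<longleftrightarrow> i = i' \<and> j = j'"
proof
  assume eq: "pr i j = pr i' j'"
  then have "i + j = i' + j'" using pr_less_pr less_irrefl by (metis linorder_neqE)
  moreover from this have "i = i'" using eq by (simp add: pr_def)
  ultimately show "i = i' \<and> j = j'" by simp
qed simp

lemma pr_bound: "i \<le> n \<Longrightarrow> j \<le> n \<Longrightarrow> pr i j < (n + n) * (n + n) + n + 1"
  unfolding pr_def less_succ_iff by (intro add_mono mult_mono) simp_all

definition fcard :: "elem \<Rightarrow> elem \<Rightarrow> bool" where
  "fcard h m \<longleftrightarrow> (\<exists>f. (\<forall>i x. fmem (pr i x) f \<longrightarrow> i < m \<and> fmem x h) \<and>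
    (\<forall>i<m. \<exists>!x. fmem (pr i x) f) \<and> (\<forall>x. fmem x h \<longrightarrow> (\<exists>!i. fmem (pr i x) f)))"

text \<open>Turns a definable bijection into a coded one. Indices are below m and elements of h are
  below h, so \<open>n = m + h\<close> bounds the entries of all pairs to be coded.\<close>

lemma fcardI:
  assumes R: "dfm (\<lambda>v. R (v 0) (v 1))" "\<And>i. i < m \<Longrightarrow> \<exists>!x. R i x \<and> fmem x h"
    "\<And>x. fmem x h \<Longrightarrow> \<exists>!i. i < m \<and> R i x"
  shows "fcard h m"
proof -
  define n where "n = m + h"
  have "dfm (\<lambda>v. \<exists>i<m. \<exists>x<h. v 0 = pr i x \<and> R i x \<and> fmem x h)"
    by (intro dfm_intros dfm2[OF R(1)])
  from code_exists[OF this, of "(n + n) * (n + n) + n + 1"]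
  obtain f where "f < 2 \<up> ((n + n) * (n + n) + n + 1)" and f: "\<And>p. fmem p f \<longleftrightarrow> p < (n + n) * (n + n) + n + 1 \<and>
    (\<exists>i<m. \<exists>x<h. p = pr i x \<and> R i x \<and> fmem x h)" by blast
  have "fmem (pr i x) f \<longleftrightarrow> i < m \<and> R i x \<and> fmem x h" for i x
  proof
    assume *: "i < m \<and> R i x \<and> fmem x h"
    then have "i < m" "x < h" using fmem_less[of x h] by simp_all
    then have "i \<le> n" "x \<le> n"
      using emb_nonneg[of m] emb_nonneg[of h] unfolding n_def
      by - (rule ccontr, unfold diff_arith, linarith)+
    then have "pr i x < (n + n) * (n + n) + n + 1" by (rule pr_bound)
    with * \<open>x < h\<close> show "fmem (pr i x) f" unfolding f by blast
  qed (auto simp: f)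
  note f_iff = this
  have "\<exists>!x. fmem (pr i x) f" if "i < m" for i
    using R(2)[OF that] that by (simp add: f_iff)
  moreover have "\<exists>!i. fmem (pr i x) f" if "fmem x h" for x
    using R(3)[OF that] that by (simp add: f_iff)
  ultimately show ?thesis unfolding fcard_def by (intro exI[of _ f]) (simp add: f_iff)
qed

text \<open>The induction on j shrinks both sides by one and quantifies over all relations with
  codes below a fixed bound, since the relation changes at every step. Only totality and injectivity
  are assumed; values may be multiple.\<close>

lemma pigeonhole:
  assumes f: "\<And>i. i \<le> k \<Longrightarrow> \<exists>y<a + k. a \<le> y \<and> fmem (pr i y) f"
    "\<And>i j y. i \<le> k \<Longrightarrow> j \<le> k \<Longrightarrow> fmem (pr i y) f \<Longrightarrow> fmem (pr j y) f \<Longrightarrow> i = j"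
  shows False
proof -
  define n where "n = a + k"
  \<comment> \<open>L exceeds the codes of all relevant pairs, so every modified relation has a code
    below \<open>2 \<up> L\<close>; the summant f puts the given relation below that bound
    too.\<close>
  define L where "L = (n + n) * (n + n) + n + 1 + f"
  have L: "pr i y < L" if "i \<le> k" "y < a + k" for i y
  proof -
    have "pr i y < (n + n) * (n + n) + n + 1"
      using that by (intro pr_bound) (auto simp: n_def intro: add_increasing)
    also have "\<dots> \<le> L" by (simp add: L_def)
    finally show ?thesis .
  qed
  have "j < k + 1 \<longrightarrow> (\<forall>f<2 \<up> L.
    \<not> ((\<forall>i<j + 1. \<exists>y<a + j. a \<le> y \<and> fmem (pr i y) f) \<and>
      (\<forall>i<j + 1. \<forall>i'<j + 1. \<forall>y<a + j. fmem (pr i y) f \<longrightarrow> fmem (pr i' y) f \<longrightarrow> i = i')))" for j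
  proof (induction j rule: bounded_induct)
    case dfm
    show ?case by (intro dfm_intros)
  next
    case 0
    show ?case
    proof (intro impI allI notI, elim conjE)
      fix f assume "\<forall>i<0 + 1. \<exists>y<a + 0. a \<le> y \<and> fmem (pr i y) f"
      from this[rule_format, of 0] show False by auto
    qed
  next
    case (step j)
    show ?case
    proof (intro impI allI notI, elim conjE)
      fix f
      assume j: "j + 1 < k + 1" and tot: "\<forall>i<j + 1 + 1. \<exists>y<a + (j + 1). a \<le> y \<and> fmem (pr i y) f"
        and inj: "\<forall>i<j + 1 + 1. \<forall>i'<j + 1 + 1. \<forall>y<a + (j + 1).
          fmem (pr i y) f \<longrightarrow> fmem (pr i' y) f \<longrightarrow> i = i'"
      have suc: "x < a + (j + 1) \<longleftrightarrow> x \<le> a + j" for x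
        using less_succ_iff[of x "a + j"] by (simp add: add.assoc)
      have "j < k" using j by simp
      obtain v where v: "v \<le> a + j" "a \<le> v" "fmem (pr (j + 1) v) f"
        using tot[rule_format, of "j + 1"] by (auto simp: suc)
      \<comment> \<open>To remove index \<open>j + 1\<close> and the top value \<open>a + j\<close>,
        indices that took the top value are sent to v, a value of \<open>j + 1\<close>. By
        injectivity no smaller index had the value v.\<close>
      have "dfm (\<lambda>w. \<exists>i<j + 1. \<exists>y<a + j. w 0 = pr i y \<and>
          (fmem (pr i y) f \<or> fmem (pr i (a + j)) f \<and> y = v))"
        by (intro dfm_intros)
      from code_exists[OF this, of L]
      obtain g where g: "g < 2 \<up> L" "\<And>p. fmem p g \<longleftrightarrow> p < L \<and>
        (\<exists>i<j + 1. \<exists>y<a + j. p = pr i y \<and> (fmem (pr i y) f \<or> fmem (pr i (a + j)) f \<and> y = v))"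
        by blast
      have g_iff: "fmem (pr i y) g \<longleftrightarrow> fmem (pr i y) f \<or> fmem (pr i (a + j)) f \<and> y = v"
        if "i < j + 1" "y < a + j" for i y
      proof -
        have "i \<le> k" "y < a + k"
          using that \<open>j < k\<close> by - (rule ccontr, unfold diff_arith, linarith)+
        then show ?thesis using that L unfolding g(2) by auto
      qed
      have ne: "\<not> fmem (pr i v) f" if "i < j + 1" for i
        using inj[rule_format, of i "j + 1" v] v that less_succI[OF that] by (auto simp: suc)
      have "\<exists>y<a + j. a \<le> y \<and> fmem (pr i y) g" if i: "i < j + 1" for i
      proof -
        obtain y where y: "y \<le> a + j" "a \<le> y" "fmem (pr i y) f"
          using tot[rule_format, OF less_succI[OF i]] by (auto simp: suc)
        show ?thesis
        proof (cases "y = a + j")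
          case True
          then have "v \<noteq> a + j" using y(3) ne[OF i] by auto
          then have "v < a + j" using v(1) by simp
          then show ?thesis using v(2) y(3) True g_iff[OF i] by blast
        next
          case False
          then have "y < a + j" using y(1) by simp
          then show ?thesis using y(2,3) g_iff[OF i] by blast
        qed
      qed
      moreover have "i = i'" if "i < j + 1" "i' < j + 1" "y < a + j" "fmem (pr i y) g" "fmem (pr i' y) g"
        for i i' y
      proof -
        have le: "i < j + 1 + 1" "i' < j + 1 + 1" using that(1,2) by (auto intro: less_succI)
        have "y < a + (j + 1)" "a + j < a + (j + 1)" using that(3) by (simp_all add: suc)
        note inj' = inj[rule_format, OF le this(1)] inj[rule_format, OF le this(2)]
        have "fmem (pr i y) f \<or> fmem (pr i (a + j)) f \<and> y = v"
          "fmem (pr i' y) f \<or> fmem (pr i' (a + j)) f \<and> y = v"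
          using that(4,5) g_iff[OF that(1,3)] g_iff[OF that(2,3)] by blast+
        then show ?thesis using inj' ne[OF that(1)] ne[OF that(2)] by blast
      qed
      moreover have "\<not> ((\<forall>i<j + 1. \<exists>y<a + j. a \<le> y \<and> fmem (pr i y) g) \<and>
          (\<forall>i<j + 1. \<forall>i'<j + 1. \<forall>y<a + j. fmem (pr i y) g \<longrightarrow> fmem (pr i' y) g \<longrightarrow> i = i'))"
        using step g(1) less_succI[OF \<open>j < k\<close>] by blast
      ultimately show False by blast
    qed
  qed
  from this[of k] have "\<forall>f<2 \<up> L.
    \<not> ((\<forall>i<k + 1. \<exists>y<a + k. a \<le> y \<and> fmem (pr i y) f) \<and>
      (\<forall>i<k + 1. \<forall>i'<k + 1. \<forall>y<a + k. fmem (pr i y) f \<longrightarrow> fmem (pr i' y) f \<longrightarrow> i = i'))"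
    by simp
  moreover have "f < 2 \<up> L"
  proof -
    have "f < 2 \<up> f" by (rule less_pw)
    also have "\<dots> \<le> 2 \<up> L" by (rule pw_mono) (simp add: L_def)
    finally show ?thesis .
  qed
  moreover have "\<forall>i<k + 1. \<exists>y<a + k. a \<le> y \<and> fmem (pr i y) f"
    using f(1) by (simp add: less_succ_iff)
  moreover have "\<forall>i<k + 1. \<forall>i'<k + 1. \<forall>y<a + k. fmem (pr i y) f \<longrightarrow> fmem (pr i' y) f \<longrightarrow> i = i'"
    using f(2) by (simp add: less_succ_iff)
  ultimately show False by blast
qed

text \<open>Converts a count into a length: for m > k the coded bijection would inject k + 1 indices
  into an interval of k numbers.\<close>

lemma fcard_le:
  assumes h: "fcard h m" "\<And>x. fmem x h \<Longrightarrow> a \<le> x \<and> x < a + k"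
  shows "m \<le> k"
proof (rule ccontr)
  assume "\<not> m \<le> k"
  then have le: "i < m" if "i \<le> k" for i using that by auto
  obtain f where f: "\<forall>i x. fmem (pr i x) f \<longrightarrow> i < m \<and> fmem x h"
    "\<forall>i<m. \<exists>!x. fmem (pr i x) f" "\<forall>x. fmem x h \<longrightarrow> (\<exists>!i. fmem (pr i x) f)"
    using h(1) unfolding fcard_def by (elim exE conjE) (rule that)
  show False
  proof (rule pigeonhole[of k a f])
    show "\<exists>y<a + k. a \<le> y \<and> fmem (pr i y) f" if i: "i \<le> k" for i
    proof -
      obtain y where y: "fmem (pr i y) f" using f(2) le[OF i] by (meson ex1_implies_ex)
      then have "a \<le> y \<and> y < a + k" using f(1) by (intro h(2)) simp
      with y show ?thesis by blast
    qed
    show "i = j" if "fmem (pr i y) f" "fmem (pr j y) f" for i j y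
    proof -
      have "fmem y h" using f(1) that(1) by simp
      then have "\<exists>!i. fmem (pr i y) f" using f(3) by simp
      with that show ?thesis by (elim ex1E) metis
    qed
  qed
qed

section \<open>Meaning of the formalized notions in the critical model\<close>

lemma sat_AllB: "sat M e E (AllB t p) \<longleftrightarrow> (\<forall>x. mless M x (ev M e t) \<longrightarrow> sat M (case_nat x e) E p)"
  by (simp add: AllB_def ev_lift1)

lemma sat_ExB: "sat M e E (ExB t p) \<longleftrightarrow> (\<exists>x. mless M x (ev M e t) \<and> sat M (case_nat x e) E p)"
  by (simp add: ExB_def ev_lift1)

lemma sat_Ex1N: "sat M e E (Ex1N p) \<longleftrightarrow> (\<exists>!x. sat M (case_nat x e) E p)"
proof -
  have "(\<lambda>i. ev M (case_nat x (case_nat y e)) (case_nat (Var 0) (\<lambda>i. Var (i + 2)) i)) = case_nat x e"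
    for x y by (rule ext) (simp split: nat.split)
  then have "sat M e E (Ex1N p) \<longleftrightarrow> (\<exists>y. \<forall>x. sat M (case_nat x e) E p \<longleftrightarrow> x = y)"
    unfolding Ex1N_def sat.simps sat_fsubst by auto
  then show ?thesis by (auto simp: Ex1_def)
qed

lemma ev_lift2: "ev M (case_nat x (case_nat y e)) (lift 2 t) = ev M e t"
  by (simp add: ev_lift)

lemma ev_lift3: "ev M (case_nat x (case_nat y (case_nat z e))) (lift 3 t) = ev M e t"
  by (simp add: ev_lift numeral_3_eq_3)

lemmas sat_simps = sat_AllB sat_ExB sat_Ex1N ev_lift1 ev_lift2 ev_lift3 crit_folds Two_def Pairing_def
  Let_def pr_def[symmetric]

lemma sat_FMem: "sat crit e E (FMem x h) = fmem (ev crit e x) (ev crit e h)"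
  by (simp add: FMem_def sat_simps fmem_def)

lemma sat_FCard: "sat crit e E (FCard h m) = fcard (ev crit e h) (ev crit e m)"
  by (simp add: FCard_def sat_simps fcard_def sat_FMem)

lemma sat_Leq: "sat crit e E (Leq t u) \<longleftrightarrow> ev crit e t \<le> ev crit e u"
  by (auto simp: Leq_def sat_simps le_less)

lemma sat_FCard_ge: "sat crit e E (FCard_ge h n) \<longleftrightarrow> (\<exists>m. fcard (ev crit e h) m \<and> ev crit e n \<le> m)"
  by (simp add: FCard_ge_def sat_FCard sat_Leq sat_simps)

lemma sat_FCard_le: "sat crit e E (FCard_le h n) \<longleftrightarrow> (\<exists>m. fcard (ev crit e h) m \<and> m \<le> ev crit e n)"
  by (simp add: FCard_le_def sat_FCard sat_Leq sat_simps)

lemma sat_FSubset: "sat crit e E (FSubset h X) \<longleftrightarrow> (\<forall>x. fmem x (ev crit e h) \<longrightarrow> x \<in> E X)"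
  by (simp add: FSubset_def sat_FMem sat_simps)

text \<open>The quantifier is bounded by y so that the definability rules apply to the
  notion.\<close>

definition consec :: "elem \<Rightarrow> elem \<Rightarrow> elem \<Rightarrow> bool" where
  "consec h x y \<longleftrightarrow> fmem x h \<and> fmem y h \<and> x < y \<and> (\<forall>z<y. fmem z h \<longrightarrow> z \<le> x)"

lemma sat_Consecutive:
  "sat crit e E (Consecutive h x y) = consec (ev crit e h) (ev crit e x) (ev crit e y)"
  by (auto simp: Consecutive_def sat_FMem sat_simps consec_def not_less)

definition gaps :: "elem \<Rightarrow> elem \<Rightarrow> bool" where
  "gaps h d \<longleftrightarrow> (\<forall>x y. consec h x y \<longrightarrow> y \<le> x + d)"

lemma sat_Gaps_le: "sat crit e E (Gaps_le h d) = gaps (ev crit e h) (ev crit e d)"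
  by (simp add: Gaps_le_def gaps_def sat_Consecutive sat_Leq sat_simps)

definition gapsize :: "elem \<Rightarrow> elem \<Rightarrow> bool" where
  "gapsize h g \<longleftrightarrow> (if \<exists>m. fcard h m \<and> m \<le> 1 then g = 1
    else (\<exists>x y. consec h x y \<and> y = x + g) \<and> gaps h g)"

lemma sat_GapSize_le:
  "sat crit e E (GapSize_le h d) \<longleftrightarrow> (\<exists>g. gapsize (ev crit e h) g \<and> g \<le> ev crit e d)"
  by (auto simp: GapSize_le_def GapSize_def gapsize_def sat_Gaps_le sat_Consecutive sat_Leq
      sat_FCard_le sat_simps)

definition syndetic_on :: "elem set \<Rightarrow> elem \<Rightarrow> elem \<Rightarrow> bool" where
  "syndetic_on X n d \<longleftrightarrow> (\<exists>h. (\<forall>x. fmem x h \<longrightarrow> x \<in> X) \<and> (\<exists>m. fcard h m \<and> n \<le> m) \<and> gaps h d)"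

lemma sat_PiecewiseSyndetic:
  "sat crit e E (PiecewiseSyndetic X) \<longleftrightarrow> (\<exists>d. \<forall>n. syndetic_on (E X) n d)"
  by (simp add: PiecewiseSyndetic_def syndetic_on_def sat_FSubset sat_FCard_ge sat_Gaps_le sat_simps)

lemma sat_Homogeneous:
  "sat crit e E (Homogeneous C H) \<longleftrightarrow> (\<exists>c. \<forall>x\<in>E H. pr x c \<in> E C)"
  by (auto simp: Homogeneous_def sat_simps)

lemma sat_FHomogeneous:
  "sat crit e E (FHomogeneous C h) \<longleftrightarrow> (\<exists>c. \<forall>x. fmem x (ev crit e h) \<longrightarrow> pr x c \<in> E C)"
  by (auto simp: FHomogeneous_def sat_simps sat_FMem)

definition partition :: "elem set \<Rightarrow> elem set \<Rightarrow> elem \<Rightarrow> bool" where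
  "partition X Z r \<longleftrightarrow> (\<forall>x. x \<in> X \<longleftrightarrow> (\<exists>i<r. pr x i \<in> Z)) \<and>
    (\<forall>x i j. i < r \<longrightarrow> j < r \<longrightarrow> pr x i \<in> Z \<longrightarrow> pr x j \<in> Z \<longrightarrow> i = j)"

lemma sat_Partition: "sat crit e E (Partition X Z r) \<longleftrightarrow> partition (E X) (E Z) (ev crit e r)"
  unfolding partition_def by (simp add: Partition_def sat_simps) blast

definition coloring :: "elem set \<Rightarrow> elem \<Rightarrow> bool" where
  "coloring C r \<longleftrightarrow> (\<forall>p\<in>C. \<exists>x c. c < r \<and> p = pr x c) \<and> (\<forall>x. \<exists>!c. c < r \<and> pr x c \<in> C)"

lemma sat_Coloring: "sat crit e E (Coloring C r) \<longleftrightarrow> coloring (E C) (ev crit e r)"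
  unfolding coloring_def by (auto simp: Coloring_def sat_simps)

lemma valid_iff:
  assumes "\<And>e E. sat crit e E p \<longleftrightarrow> Q"
  shows "valid crit p \<longleftrightarrow> Q"
proof -
  obtain X where "X \<in> msets crit" using crit(1) by (auto simp: models_def)
  then have "range (\<lambda>_ :: nat. X) \<subseteq> msets crit" by auto
  then show ?thesis using assms unfolding valid_def by blast
qed

lemma valid_Brown:
  "valid crit Brown \<longleftrightarrow> (\<forall>r. \<forall>C\<in>sets. coloring C r \<longrightarrow>
    (\<exists>H\<in>sets. (\<exists>c. \<forall>x\<in>H. pr x c \<in> C) \<and> (\<exists>d. \<forall>n. syndetic_on H n d)))"
  unfolding Brown_def
  by (rule valid_iff) (simp add: sat_Coloring sat_Homogeneous sat_PiecewiseSyndetic crit_folds)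


lemma valid_PartitionRegularity:
  "valid crit PartitionRegularity \<longleftrightarrow> (\<forall>r. \<forall>X\<in>sets. \<forall>Z\<in>sets.
    (\<exists>d. \<forall>n. syndetic_on X n d) \<and> partition X Z r \<longrightarrow>
    (\<exists>i<r. \<exists>Y\<in>sets. (\<forall>x. x \<in> Y \<longleftrightarrow> pr x i \<in> Z) \<and> (\<exists>d. \<forall>n. syndetic_on Y n d)))"
proof -
  have "(P \<longrightarrow> Q) \<and> (Q \<longrightarrow> P) \<longleftrightarrow> (P \<longleftrightarrow> Q)" for P Q by blast
  then show ?thesis by - (rule valid_iff, simp add: PartitionRegularity_def sat_Partition sat_PiecewiseSyndetic sat_simps)
qed


lemma valid_WeakBrown:
  "valid crit WeakBrown \<longleftrightarrow> (\<forall>r. \<forall>C\<in>sets. coloring C r \<longrightarrow>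
    (\<exists>d. \<forall>n. \<exists>h. (\<exists>c. \<forall>x. fmem x h \<longrightarrow> pr x c \<in> C) \<and> (\<exists>m. fcard h m \<and> n \<le> m) \<and> (\<exists>g. gapsize h g \<and> g \<le> d)))"
  unfolding WeakBrown_def
  by (rule valid_iff) (simp add: sat_Coloring sat_FHomogeneous sat_FCard_ge sat_GapSize_le sat_simps)

section \<open>Piecewise syndetic sets and windows\<close>

text \<open>A set with at least n elements spans at least n numbers from its least element a on. For
  b in that range, the last element x at or below b is b itself or has a next element, which lies
  beyond b but within d of x. The length d + 1 keeps windows nonempty when d = 0.\<close>

lemma windows_of_gaps:
  assumes h: "fcard h m" "n \<le> m" "0 < n" and gaps: "gaps h d"
  obtains a where "\<And>b. a \<le> b \<Longrightarrow> b < a + n \<Longrightarrow> \<exists>x. b \<le> x \<and> x < b + (d + 1) \<and> fmem x h"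
proof -
  have d1: "dfm (\<lambda>v. fmem (v 0) h)" by (intro dfm_intros)
  have "\<exists>x. fmem x h"
  proof (rule ccontr)
    assume "\<not> (\<exists>x. fmem x h)"
    then have "m \<le> 0" using fcard_le[OF h(1), of 0 0] by blast
    then show False using h by simp
  qed
  then obtain x0 where x0: "fmem x0 h" ..
  obtain a where a: "fmem a h" "\<And>z. z < a \<Longrightarrow> \<not> fmem z h" by (rule least_elem[OF d1 x0]) blast
  obtain z where z: "fmem z h" "\<And>y. fmem y h \<Longrightarrow> y \<le> z"
    by (rule greatest_elem[OF d1 x0, of h]) (use fmem_less less_imp_le in blast)+
  obtain k where k: "z = a + k" using z(2)[OF a(1)] by (auto simp: le_iff_elem)
  have "m \<le> k + 1"
  proof (rule fcard_le[OF h(1), of a])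
    fix x assume "fmem x h"
    then have "\<not> x < a" "x \<le> z" using a(2)[of x] z(2)[of x] by auto
    then show "a \<le> x \<and> x < a + (k + 1)" using less_succ_iff[of x "a + k"] by (simp add: k add.assoc)
  qed
  then have nk: "n \<le> k + 1" using h(2) by simp
  show thesis
  proof (rule that)
    fix b assume b: "a \<le> b" "b < a + n"
    have "b \<le> z" using b(2) nk unfolding k by - (rule ccontr, unfold diff_arith, linarith)
    have "dfm (\<lambda>v. fmem (v 0) h \<and> v 0 \<le> b)" by (intro dfm_intros)
    then obtain x where x: "fmem x h" "x \<le> b" "\<And>y. fmem y h \<Longrightarrow> y \<le> b \<Longrightarrow> y \<le> x"
      using greatest_elem[of "\<lambda>x. fmem x h \<and> x \<le> b" a b] a(1) b(1) by metis
    show "\<exists>x. b \<le> x \<and> x < b + (d + 1) \<and> fmem x h"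
    proof (cases "x = b")
      case True
      have "b < b + (d + 1)" using less_iff_elem[of b "b + (d + 1)"] by (auto simp: add.assoc)
      then show ?thesis using x(1) True by blast
    next
      case False
      then have "x < b" using x(2) by simp
      have "dfm (\<lambda>v. fmem (v 0) h \<and> x < v 0)" by (intro dfm_intros)
      moreover have "fmem z h \<and> x < z" using z(1) \<open>x < b\<close> \<open>b \<le> z\<close> by auto
      ultimately obtain y where y: "fmem y h" "x < y" "\<And>w. w < y \<Longrightarrow> \<not> (fmem w h \<and> x < w)"
        using least_elem[of "\<lambda>y. fmem y h \<and> x < y" z] by metis
      have "consec h x y" unfolding consec_def using x(1) y by (auto simp: not_less)
      then have "y \<le> x + d" using gaps by (simp add: gaps_def)
      moreover have "b < y" using x(3)[OF y(1)] y(2) by (metis leI leD)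
      ultimately have "b \<le> y" "y < b + (d + 1)" using \<open>x < b\<close>
        by - (rule ccontr, unfold diff_arith, linarith)+
      then show ?thesis using y(1) by blast
    qed
  qed
qed

text \<open>Piecewise syndeticity without cardinalities: in arbitrarily long intervals X meets every
  window of length d.\<close>

definition windows :: "elem set \<Rightarrow> elem \<Rightarrow> bool" where
  "windows X d \<longleftrightarrow> (\<forall>n. \<exists>a. \<forall>b. a \<le> b \<longrightarrow> b < a + n \<longrightarrow> (\<exists>x<b + d. b \<le> x \<and> x \<in> X))"

lemma windows_of_syndetic:
  assumes "\<And>n. syndetic_on X n d"
  shows "windows X (d + 1)"
  unfolding windows_def
proof
  fix n
  show "\<exists>a. \<forall>b. a \<le> b \<longrightarrow> b < a + n \<longrightarrow> (\<exists>x<b + (d + 1). b \<le> x \<and> x \<in> X)"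
  proof (cases "n = 0")
    case True
    then show ?thesis by (auto simp: not_le)
  next
    case False
    obtain h m where h: "\<forall>x. fmem x h \<longrightarrow> x \<in> X" "fcard h m" "n \<le> m" "gaps h d"
      using assms[of n] unfolding syndetic_on_def by (elim exE conjE) (rule that)
    have "0 < n" using False by (simp add: zero_less_iff_neq_zero)
    from windows_of_gaps[OF h(2,3) this h(4)]
    obtain a where "\<And>b. a \<le> b \<Longrightarrow> b < a + n \<Longrightarrow> \<exists>x. b \<le> x \<and> x < b + (d + 1) \<and> fmem x h" by blast
    then show ?thesis using h(1) by (intro exI[of _ a]) blast
  qed
qed

lemma times_window:
  fixes j k e x :: elem
  assumes "j < k" "x < a + j * e + e"
  shows "x < a + k * e"
proof -
  obtain z where "k = j + z + 1" using assms(1) less_iff_elem by metis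
  then have "a + k * e = a + j * e + e + z * e" by (simp add: algebra_simps)
  then show ?thesis using assms(2) by (simp add: add_strict_increasing2 less_le_trans)
qed

text \<open>A long interval is cut into n blocks of length e, and \<open>R j x\<close> picks the
  least element x of X in block j. The map from j to x counts the chosen set, and neighbours in it
  come from adjacent blocks, hence the gap bound e + e.\<close>

lemma syndetic_of_windows:
  assumes X: "X \<in> sets" and win: "windows X e"
  shows "syndetic_on X n (e + e)"
proof -
  obtain a0 where "\<forall>b. a0 \<le> b \<longrightarrow> b < a0 + 1 \<longrightarrow> (\<exists>x<b + e. b \<le> x \<and> x \<in> X)"
    using win unfolding windows_def by blast
  then obtain x0 where "x0 < a0 + e" "a0 \<le> x0" using less_succ_iff[of a0 a0] by blast
  then have e: "0 < e" by - (rule ccontr, unfold diff_arith, linarith)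
  obtain a where a: "\<And>b. a \<le> b \<Longrightarrow> b < a + n * e \<Longrightarrow> \<exists>x<b + e. b \<le> x \<and> x \<in> X"
    using win unfolding windows_def by blast
  define R where "R j x \<longleftrightarrow> x < a + j * e + e \<and> a + j * e \<le> x \<and> x \<in> X \<and>
    (\<forall>z<x. a + j * e \<le> z \<longrightarrow> z \<notin> X)" for j x
  have R_dfm: "dfm (\<lambda>v. R (v 0) (v 1))"
    unfolding R_def by (intro dfm_intros dfm_mem[OF X])
  have R_ex: "\<exists>x. R j x" if "j < n" for j
  proof -
    have "a + j * e < a + n * e" using times_window[OF that, of "a + j * e" a e] e by simp
    then obtain x where x: "x < a + j * e + e" "a + j * e \<le> x" "x \<in> X" using a[of "a + j * e"] by auto
    have "dfm (\<lambda>v. a + j * e \<le> v 0 \<and> v 0 \<in> X)" by (intro dfm_intros dfm_mem[OF X])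
    then obtain y where "a + j * e \<le> y" "y \<in> X" "\<And>z. z < y \<Longrightarrow> \<not> (a + j * e \<le> z \<and> z \<in> X)"
      using least_elem[of "\<lambda>y. a + j * e \<le> y \<and> y \<in> X" x] x by metis
    moreover from this have "y \<le> x" using x by (metis leI)
    ultimately show ?thesis using x(1) unfolding R_def by (intro exI[of _ y]) auto
  qed
  have R_less: "x < y" if "R j x" "R k y" "j < k" for j k x y
    using times_window[OF that(3), of x a e] that(1,2) unfolding R_def by auto
  have R_fun: "x = y" if "R j x" "R j y" for j x y
    using that unfolding R_def by (cases x y rule: linorder_cases) auto
  have R_inj: "j = k" if "R j x" "R k x" for j k x
    using R_less[OF that] R_less[OF that(2,1)] by (cases j k rule: linorder_cases) auto
  have "dfm (\<lambda>v. \<exists>j<n. R j (v 0))" by (intro dfm_intros dfm2[OF R_dfm])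
  from code_exists[OF this, of "a + n * e"]
  obtain h where "h < 2 \<up> (a + n * e)" and h: "\<And>x. fmem x h \<longleftrightarrow> x < a + n * e \<and> (\<exists>j<n. R j x)"
    by blast
  have h_iff: "fmem x h \<longleftrightarrow> (\<exists>j<n. R j x)" for x
  proof
    assume "\<exists>j<n. R j x"
    moreover from this obtain j where "j < n" "x < a + j * e + e" unfolding R_def by blast
    then have "x < a + n * e" by (rule times_window)
    ultimately show "fmem x h" by (simp add: h)
  qed (simp add: h)
  have "fcard h n"
  proof (rule fcardI[OF R_dfm])
    fix i assume "i < n"
    then obtain x where x: "R i x" using R_ex by blast
    with \<open>i < n\<close> have "fmem x h" unfolding h_iff by blast
    with x show "\<exists>!x. R i x \<and> fmem x h"
      by (intro ex1I[of _ x] conjI) (auto elim: R_fun[OF _ x])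
  next
    fix x assume "fmem x h"
    then obtain j where "j < n" "R j x" unfolding h_iff by blast
    then show "\<exists>!i. i < n \<and> R i x"
      by (intro ex1I[of _ j] conjI) (auto elim: R_inj[OF _ \<open>R j x\<close>])
  qed
  moreover have "gaps h (e + e)"
    unfolding gaps_def
  proof (intro allI impI)
    fix x y assume xy: "consec h x y"
    then obtain j k where j: "j < n" "R j x" and k: "k < n" "R k y"
      unfolding consec_def h_iff by blast
    have "x < y" using xy by (simp add: consec_def)
    then have "j < k"
      using R_less[OF k(2) j(2)] R_fun[of j x y] j(2) k(2) by (cases j k rule: linorder_cases) auto
    \<comment> \<open>Otherwise the element chosen from block j + 1 would lie strictly between x and
      y.\<close>
    have "k \<le> j + 1"
    proof (rule ccontr)
      assume "\<not> k \<le> j + 1"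
      then have jk: "j + 1 < k" by simp
      then have jn: "j + 1 < n" using k(1) by (rule less_trans)
      then obtain u where u: "R (j + 1) u" using R_ex by blast
      have "x < u" "u < y" using R_less[OF j(2) u] R_less[OF u k(2) jk] less_succ_iff[of j j] by simp_all
      moreover have "fmem u h" unfolding h_iff using u jn by blast
      ultimately show False using xy unfolding consec_def by (meson leD)
    qed
    moreover have "j + 1 \<le> k" using \<open>j < k\<close> less_iff_succ_less_eq[of j k] by simp
    ultimately have "k = j + 1" by simp
    then have "y < a + j * e + (e + e)" using k(2) by (simp add: R_def algebra_simps)
    moreover have "a + j * e \<le> x" using j(2) by (simp add: R_def)
    ultimately show "y \<le> x + (e + e)" by - (rule ccontr, unfold diff_arith, linarith)
  qed
  moreover have "\<forall>x. fmem x h \<longrightarrow> x \<in> X" unfolding h_iff R_def by blast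
  ultimately show ?thesis unfolding syndetic_on_def by blast
qed


section \<open>Sigma-2 induction implies partition regularity\<close>

text \<open>The induction on i shows that for some D, whenever X meets all windows of length d in an
  interval, the parts with index at least i together meet all windows of length D inside it.  If
  part i misses a window of length D in every interval of length n, then D is replaced by n + D.\<close>

lemma partition_regularity:
  assumes ind: "crit \<Turnstile> ISigma02" and X: "X \<in> sets" and Z: "Z \<in> sets"
    and win: "windows X d" and part: "partition X Z r"
  shows "\<exists>i<r. \<exists>D. windows {x. pr x i \<in> Z} D"
proof (rule ccontr)
  assume "\<not> ?thesis"
  then have neg: "\<not> windows {x. pr x i \<in> Z} D" if "i < r" for i D using that by blast
  define H where "H a n \<longleftrightarrow> (\<forall>b<a + n. a \<le> b \<longrightarrow> (\<exists>x<b + d. b \<le> x \<and> x \<in> X))" for a n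
  define G where "G i D a n \<longleftrightarrow> (\<forall>b<a + n. a \<le> b \<and> b + D \<le> a + n \<longrightarrow>
      (\<exists>x<b + D. b \<le> x \<and> (\<exists>j<r. i \<le> j \<and> pr x j \<in> Z)))" for i D a n
  \<comment> \<open>The common bound z on a and n merges two unbounded quantifiers into one and
    keeps P bounded. The guard \<open>i \<le> r\<close> is there because the induction runs through
    all i.\<close>
  define P where "P i D z \<longleftrightarrow> (i \<le> r \<longrightarrow> (\<forall>a<z. \<forall>n<z. H a n \<longrightarrow> G i D a n))" for i D z
  have "\<exists>D. \<forall>z. P r D z"
  proof (rule Sigma2_induct[OF ind])
    show "dfm (\<lambda>v. P (v 2) (v 1) (v 0))"
      unfolding P_def H_def G_def by (intro dfm_intros dfm_mem[OF X] dfm_mem[OF Z])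
    show "\<exists>D. \<forall>z. P 0 D z"
      using part unfolding P_def H_def G_def partition_def by (intro exI[of _ d]) simp
  next
    fix i assume "\<exists>D. \<forall>z. P i D z"
    then obtain D where D: "\<And>z. P i D z" by blast
    show "\<exists>D. \<forall>z. P (i + 1) D z"
    proof (cases "i + 1 \<le> r")
      case False
      then show ?thesis unfolding P_def by simp
    next
      case True
      then have "i < r" using less_iff_succ_less_eq[of i r] by simp
      \<comment> \<open>The failure of \<open>windows\<close> for part i and length D provides one
        n0 such that every interval of length n0 contains the start of a window missed by part
        i.\<close>
      then obtain n0 where n0: "\<And>a. \<exists>b. a \<le> b \<and> b < a + n0 \<and>
          \<not> (\<exists>x<b + D. b \<le> x \<and> pr x i \<in> Z)"
        using neg[of i D] unfolding windows_def by auto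
      have "P (i + 1) (n0 + D) z" for z
        unfolding P_def
      proof (intro impI allI)
        fix a n assume an: "a < z" "n < z" "H a n"
        have hit: "G i D a n" using D[of z] an \<open>i < r\<close> by (simp add: P_def less_imp_le)
        show "G (i + 1) (n0 + D) a n"
          unfolding G_def
        proof (intro impI allI, elim conjE)
          fix b assume b: "b < a + n" "a \<le> b" "b + (n0 + D) \<le> a + n"
          obtain c where c: "b \<le> c" "c < b + n0" "\<not> (\<exists>x<c + D. c \<le> x \<and> pr x i \<in> Z)"
            using n0[of b] by blast
          have "c < a + n" "a \<le> c" "c + D \<le> a + n"
            using b c(1,2) emb_nonneg[of D] by - (rule ccontr, unfold diff_arith, linarith)+
          then obtain x j where x: "x < c + D" "c \<le> x" "j < r" "i \<le> j" "pr x j \<in> Z"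
            using hit unfolding G_def by blast
          have "j \<noteq> i" using c(3) x by blast
          then have "i < j" using x(4) by simp
          then have "i + 1 \<le> j" by (simp only: less_iff_succ_less_eq)
          moreover have "x < b + (n0 + D)" "b \<le> x"
            using x(1,2) c(1,2) by - (rule ccontr, unfold diff_arith, linarith)+
          ultimately show "\<exists>x<b + (n0 + D). b \<le> x \<and> (\<exists>j<r. i + 1 \<le> j \<and> pr x j \<in> Z)"
            using x(3,5) by blast
        qed
      qed
      then show ?thesis by blast
    qed
  qed
  then obtain D where D: "\<And>z. P r D z" by blast
  \<comment> \<open>An interval of length D + 1 has room for a window of length D. At stage r a hit
    in that window would belong to a part j with both j < r and r \<le> j.\<close>
  obtain a where a: "\<And>b. a \<le> b \<Longrightarrow> b < a + (D + 1) \<Longrightarrow> \<exists>x<b + d. b \<le> x \<and> x \<in> X"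
    using win unfolding windows_def by metis
  have *: "a < a + (D + 1) + 1" "D + 1 < a + (D + 1) + 1" "a < a + (D + 1)" "a + D \<le> a + (D + 1)"
    using emb_nonneg[of a] emb_nonneg[of D] by - (rule ccontr, unfold diff_arith, linarith)+
  have "H a (D + 1)" unfolding H_def using a by blast
  then have "G r D a (D + 1)" using D[of "a + (D + 1) + 1"] *(1,2) unfolding P_def by blast
  then obtain j where "j < r" "r \<le> j" using *(3,4) unfolding G_def by blast
  then show False by simp
qed

section \<open>Weak Brown's lemma implies Sigma-2 induction\<close>

lemma division_unique:
  fixes q q' w s s' :: elem
  assumes "q * w + s = q' * w + s'" "s < w" "s' < w"
  shows "q = q'"
proof -
  have "\<not> q < q'" if "q * w + s = q' * w + s'" "s < w" for q q' s s'
  proof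
    assume "q < q'"
    moreover have "q * w + s < 0 + q * w + w" using that(2) by simp
    ultimately have "q * w + s < 0 + q' * w" by (rule times_window)
    then show False unfolding that(1) by simp
  qed
  from this[of q s q' s'] this[of q' s' q s] assms show ?thesis by auto
qed

lemma double_neq_double_succ: "2 * p \<noteq> 2 * p' + (1 :: elem)"
proof
  assume *: "2 * p = 2 * p' + 1"
  then have "p * 2 + 0 = p' * 2 + 1" by (simp add: mult.commute)
  then have "p = p'" by (rule division_unique) simp_all
  with * show False by simp
qed

text \<open>Says that the quotient of x by w is odd.\<close>

definition odd_block :: "elem \<Rightarrow> elem \<Rightarrow> bool" where
  "odd_block w x \<longleftrightarrow> (\<exists>q<x + 1. \<exists>s<w. x = (2 * q + 1) * w + s)"

lemma odd_block_iff:
  assumes "s < w" "x = q * w + s"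
  shows "odd_block w x \<longleftrightarrow> (\<exists>p. q = 2 * p + 1)"
proof
  assume "odd_block w x"
  then obtain p s' where "s' < w" "x = (2 * p + 1) * w + s'" unfolding odd_block_def by blast
  then have "q = 2 * p + 1" using assms by (intro division_unique[of q w s _ s']) auto
  then show "\<exists>p. q = 2 * p + 1" ..
next
  assume "\<exists>p. q = 2 * p + 1"
  then obtain p where p: "q = 2 * p + 1" ..
  have "1 \<le> w" using assms(1) by - (rule ccontr, unfold diff_arith, use emb_nonneg[of s] in linarith)
  then have "(2 * p + 1) * 1 \<le> (2 * p + 1) * w" by (rule mult_left_mono) simp
  then have "p < x + 1" unfolding assms(2) p using emb_nonneg[of s] emb_nonneg[of p]
    by - (rule ccontr, unfold diff_arith mult_1_right, linarith)
  then show "odd_block w x" unfolding odd_block_def using assms p by blast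
qed

lemma odd_block_alternates:
  assumes "0 < w" "q * w \<le> x" "x < q * w + w" "(q + 1) * w \<le> y" "y < (q + 1) * w + w"
  shows "odd_block w x \<longleftrightarrow> \<not> odd_block w y"
proof -
  obtain s s' where s: "x = q * w + s" "y = (q + 1) * w + s'" using assms by (auto simp: le_iff_elem)
  then have "s < w" "s' < w" using assms by auto
  then have "odd_block w x \<longleftrightarrow> (\<exists>p. q = 2 * p + 1)" "odd_block w y \<longleftrightarrow> (\<exists>p. q + 1 = 2 * p + 1)"
    using odd_block_iff s by blast+
  moreover obtain p where "q = 2 * p \<or> q = 2 * p + 1" using even_or_odd by blast
  moreover have "2 * p + 1 \<noteq> 2 * p'" for p p' :: elem using double_neq_double_succ[of p' p] by simp
  ultimately show ?thesis using double_neq_double_succ by auto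
qed

text \<open>Weak Brown's lemma with the gap size relaxed to a bound on gaps, the form in which it is
  applied.\<close>

definition weak_brown :: bool where
  "weak_brown \<longleftrightarrow> (\<forall>r. \<forall>C\<in>sets. coloring C r \<longrightarrow> (\<exists>d. \<forall>n. \<exists>h.
    (\<exists>c. \<forall>x. fmem x h \<longrightarrow> pr x c \<in> C) \<and> (\<exists>m. fcard h m \<and> n \<le> m) \<and> gaps h d))"

text \<open>A point x gets the colour coding the set of all i such that x lies in a block of odd number,
  the blocks having the current value of the i-th approximation as their length.  A homogeneous set
  with gaps bounded by d meets two neighbouring blocks of any limit length above d, and these
  have different colours.\<close>

lemma weak_brown_limits:
  assumes wb: weak_brown and W: "dfm (\<lambda>v. W (v 0) (v 1) (v 2))"
  obtains d where "\<And>i w x0. i < r \<Longrightarrow> (\<And>x w'. x0 \<le> x \<Longrightarrow> W i x w' \<longleftrightarrow> w' = w) \<Longrightarrow> w \<le> d"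
proof -
  \<comment> \<open>The bound on w keeps B bounded; a limit w is not cut off once x has reached
    it.\<close>
  define B where "B i x \<longleftrightarrow> (\<exists>w<x + 1. W i x w \<and> odd_block w x)" for i x
  define A where "A x c \<longleftrightarrow> (\<forall>i<r. fmem i c \<longleftrightarrow> B i x)" for x c
  \<comment> \<open>A colour code is constrained only in its digits below r, so the least suitable
    code is taken to make the colour unique. The number of colours is
    \<open>2 \<up> r\<close>.\<close>
  define C where "C = {p. \<exists>x<p + 1. \<exists>c<2 \<up> r. p = pr x c \<and> A x c \<and> (\<forall>c'<c. \<not> A x c')}"
  have A_dfm: "dfm (\<lambda>v. A (v 0) (v 1))"
    unfolding A_def B_def odd_block_def by (intro dfm_intros dfm3[OF W])
  have C: "C \<in> sets"
    unfolding C_def by (intro comprehension dfm_intros dfm2[OF A_dfm])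
  have C_iff: "pr x c \<in> C \<longleftrightarrow> c < 2 \<up> r \<and> A x c \<and> (\<forall>c'<c. \<not> A x c')" for x c
  proof -
    have "x < pr x c + 1" unfolding less_succ_iff pr_def by simp
    then show ?thesis unfolding C_def by auto
  qed
  have "\<exists>!c. c < 2 \<up> r \<and> pr x c \<in> C" for x
  proof -
    have "dfm (\<lambda>v. B (v 0) x)"
      unfolding B_def odd_block_def by (intro dfm_intros dfm3[OF W])
    from code_exists[OF this, of r] obtain c0 where "c0 < 2 \<up> r" "\<And>i. fmem i c0 \<longleftrightarrow> i < r \<and> B i x"
      by blast
    then have "A x c0" by (simp add: A_def)
    moreover have "dfm (\<lambda>v. A x (v 0))" by (intro dfm2[OF A_dfm] dfm_intros)
    ultimately obtain c where c: "A x c" "\<And>c'. c' < c \<Longrightarrow> \<not> A x c'" using least_elem by metis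
    then have "c \<le> c0" using \<open>A x c0\<close> by (metis leI)
    then have "c < 2 \<up> r" using \<open>c0 < 2 \<up> r\<close> by simp
    then show ?thesis unfolding C_iff using c by (intro ex1I[of _ c]) (auto, metis linorder_neqE)
  qed
  moreover have "\<forall>p\<in>C. \<exists>x c. c < 2 \<up> r \<and> p = pr x c" unfolding C_def by blast
  ultimately have "coloring C (2 \<up> r)" by (simp add: coloring_def)
  then obtain d where d: "\<And>n. \<exists>h. (\<exists>c. \<forall>x. fmem x h \<longrightarrow> pr x c \<in> C) \<and> (\<exists>m. fcard h m \<and> n \<le> m) \<and> gaps h d"
    using wb C unfolding weak_brown_def by blast
  show thesis
  proof (rule that, rule ccontr)
    fix i w x0
    assume i: "i < r" and lim: "\<And>x w'. x0 \<le> x \<Longrightarrow> W i x w' \<longleftrightarrow> w' = w" and "\<not> w \<le> d"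
    then have "d < w" by simp
    then have dw: "d + 1 \<le> w" by (simp add: less_iff_succ_less_eq)
    have w: "0 < w" using \<open>d < w\<close> by (rule le_less_trans[rotated]) simp
    \<comment> \<open>Beyond a + x0 + w the approximation has settled. The next two block boundaries
      come at most 2w later, so they lie within n of a. A window of length d + 1 \<le> w at each of
      them stays inside its block.\<close>
    define n where "n = x0 + w + w + w + 1"
    obtain h c m where h: "\<forall>x. fmem x h \<longrightarrow> pr x c \<in> C" "fcard h m" "n \<le> m" "gaps h d"
      using d[of n] by (elim exE conjE) (rule that)
    have "0 < n" unfolding n_def by (rule zero_less_succ)
    from windows_of_gaps[OF h(2,3) this h(4)]
    obtain a where a: "\<And>b. a \<le> b \<Longrightarrow> b < a + n \<Longrightarrow> \<exists>x. b \<le> x \<and> x < b + (d + 1) \<and> fmem x h" by blast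
    obtain q s where qs: "s < w" "a + (x0 + w) = q * w + s"
      using division_elem[OF w, of "a + (x0 + w)"] by blast
    have q1: "(q + 1) * w = q * w + w" by (simp add: distrib_right)
    have q2: "(q + 1 + 1) * w = q * w + w + w" by (simp add: distrib_right)
    have "a \<le> (q + 1) * w" "(q + 1) * w < a + n" "a \<le> (q + 1 + 1) * w" "(q + 1 + 1) * w < a + n"
      unfolding q1 q2 n_def using qs w emb_nonneg[of s] emb_nonneg[of x0]
      by - (rule ccontr, unfold diff_arith, linarith)+
    then obtain x y where x: "(q + 1) * w \<le> x" "x < (q + 1) * w + (d + 1)" "fmem x h"
      and y: "(q + 1 + 1) * w \<le> y" "y < (q + 1 + 1) * w + (d + 1)" "fmem y h"
      using a by meson
    have "x < (q + 1) * w + w" "y < (q + 1 + 1) * w + w"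
      using x(2) y(2) dw by - (rule ccontr, unfold diff_arith, linarith)+
    then have alt: "odd_block w x \<longleftrightarrow> \<not> odd_block w y"
      using odd_block_alternates[OF w] x(1) y(1) by blast
    have "x0 + w \<le> x" "x0 + w \<le> y"
      using x(1) y(1) qs w emb_nonneg[of a] unfolding q1 q2
      by - (rule ccontr, unfold diff_arith, linarith)+
    moreover have B: "B i u \<longleftrightarrow> odd_block w u" if "x0 + w \<le> u" for u
    proof -
      have "x0 \<le> u" "w < u + 1"
        using that emb_nonneg[of x0] emb_nonneg[of w] by - (rule ccontr, unfold diff_arith, linarith)+
      then show ?thesis unfolding B_def using lim[OF \<open>x0 \<le> u\<close>] by auto
    qed
    moreover have "fmem i c \<longleftrightarrow> B i u" if "fmem u h" for u
      using h(1) that i unfolding C_iff A_def by blast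
    ultimately show False using alt x(3) y(3) by blast
  qed
qed

text \<open>The approximation at stage x is the least witness below x, so the limits are the least
  witnesses.\<close>

lemma strong_bounding:
  assumes wb: weak_brown and Q: "dfm (\<lambda>v. Q (v 0) (v 1))"
  obtains d where "\<And>i y. i < r \<Longrightarrow> Q i y \<Longrightarrow> \<exists>y<d + 1. Q i y"
proof -
  define W where "W i x w \<longleftrightarrow> Q i w \<and> w < x + 1 \<and> (\<forall>y<w. \<not> Q i y)" for i x w
  have "dfm (\<lambda>v. W (v 0) (v 1) (v 2))"
    unfolding W_def by (intro dfm_intros dfm2[OF Q])
  then obtain d where d: "\<And>i w x0. i < r \<Longrightarrow> (\<And>x w'. x0 \<le> x \<Longrightarrow> W i x w' \<longleftrightarrow> w' = w) \<Longrightarrow> w \<le> d"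
    using weak_brown_limits[OF wb, of W r] by metis
  show thesis
  proof (rule that)
    fix i y assume "i < r" "Q i y"
    have "dfm (\<lambda>v. Q i (v 0))" by (intro dfm2[OF Q] dfm_intros)
    then obtain w where w: "Q i w" "\<And>z. z < w \<Longrightarrow> \<not> Q i z"
      using least_elem[of "Q i" y] \<open>Q i y\<close> by metis
    have "w \<le> d"
    proof (rule d[OF \<open>i < r\<close>])
      fix x w' assume "w \<le> x"
      then show "W i x w' \<longleftrightarrow> w' = w"
        unfolding W_def using w by (cases w' w rule: linorder_cases) (auto simp: less_succ_iff)
    qed
    then show "\<exists>y<d + 1. Q i y" using w(1) less_succ_iff[of w d] by blast
  qed
qed

text \<open>Here the approximation at stage x is the least y that has not been refuted below x.\<close>

lemma weak_brown_Sigma2_bound: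
  assumes wb: weak_brown and P: "dfm (\<lambda>v. P (v 0) (v 1) (v 2))"
  obtains b where "\<And>i y. i < r \<Longrightarrow> \<forall>z. P i y z \<Longrightarrow> \<exists>y<b + 1. \<forall>z. P i y z"
proof -
  define W where "W i x w \<longleftrightarrow> (\<forall>z<x. P i w z) \<and> (\<forall>y<w. \<not> (\<forall>z<x. P i y z))" for i x w
  have "dfm (\<lambda>v. W (v 0) (v 1) (v 2))"
    unfolding W_def by (intro dfm_intros dfm3[OF P])
  then obtain b where b: "\<And>i w x0. i < r \<Longrightarrow> (\<And>x w'. x0 \<le> x \<Longrightarrow> W i x w' \<longleftrightarrow> w' = w) \<Longrightarrow> w \<le> b"
    using weak_brown_limits[OF wb, of W r] by metis
  show thesis
  proof (rule that)
    fix i y assume i: "i < r" and y: "\<forall>z. P i y z"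
    \<comment> \<open>Strong bounding over the candidates u \<le> y gives one d such that every
      candidate with any counterexample has one at or below d. The least candidate that survives up
      to d is therefore never refuted.\<close>
    have "dfm (\<lambda>v. \<not> P i (v 0) (v 1))" by (intro dfm_intros dfm3[OF P])
    then obtain d where d: "\<And>u z. u < y + 1 \<Longrightarrow> \<not> P i u z \<Longrightarrow> \<exists>z<d + 1. \<not> P i u z"
      using strong_bounding[OF wb, of "\<lambda>u z. \<not> P i u z" "y + 1"] by metis
    have "dfm (\<lambda>v. \<forall>z<d + 1. P i (v 0) z)" by (intro dfm_intros dfm3[OF P])
    then obtain w where w: "\<forall>z<d + 1. P i w z" "\<And>u. u < w \<Longrightarrow> \<not> (\<forall>z<d + 1. P i u z)"
      using least_elem[of "\<lambda>u. \<forall>z<d + 1. P i u z" y] y by metis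
    have "w \<le> y" using w(2)[of y] y by (metis leI)
    then have Pw: "P i w z" for z using d[of w z] w(1) by (auto simp: less_succ_iff)
    have "w \<le> b"
    proof (rule b[OF i])
      fix x w' assume x: "d + 1 \<le> x"
      have below: "\<not> (\<forall>z<x. P i u z)" if "u < w" for u
        using w(2)[OF that] x by (meson less_le_trans)
      show "W i x w' \<longleftrightarrow> w' = w"
        unfolding W_def using Pw below by (cases w' w rule: linorder_cases) auto
    qed
    then show "\<exists>y<b + 1. \<forall>z. P i y z" using Pw less_succ_iff[of w b] by blast
  qed
qed

text \<open>Up to x, the Sigma-2 property is made equivalent to a bounded one: b bounds the
  witnesses y, and d is so large that checking z \<le> d decides whether P i y z holds for all z.
  Bounded induction then applies.\<close>

lemma weak_brown_Sigma2_induct: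
  assumes wb: weak_brown and P: "dfm (\<lambda>v. P (v 0) (v 1) (v 2))" and zero: "\<exists>y. \<forall>z. P 0 y z"
    and step: "\<And>i. \<exists>y. \<forall>z. P i y z \<Longrightarrow> \<exists>y. \<forall>z. P (i + 1) y z"
  shows "\<exists>y. \<forall>z. P x y z"
proof -
  obtain b where b: "\<And>i y. i < x + 1 \<Longrightarrow> \<forall>z. P i y z \<Longrightarrow> \<exists>y<b + 1. \<forall>z. P i y z"
    using weak_brown_Sigma2_bound[OF wb P, of "x + 1"] by metis
  define n where "n = x + b"
  \<comment> \<open>The pair (i, y) is packed into one number k because strong bounding takes a
    single index; \<open>n = x + b\<close> bounds both entries.\<close>
  define Q where "Q k z \<longleftrightarrow> (\<exists>i<x + 1. \<exists>y<b + 1. k = pr i y \<and> \<not> P i y z)" for k z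
  have "dfm (\<lambda>v. Q (v 0) (v 1))"
    unfolding Q_def by (intro dfm_intros dfm3[OF P])
  then obtain d where d: "\<And>k z. k < (n + n) * (n + n) + n + 1 \<Longrightarrow> Q k z \<Longrightarrow> \<exists>z<d + 1. Q k z"
    using strong_bounding[OF wb, of Q "(n + n) * (n + n) + n + 1"] by metis
  have fin: "\<forall>z. P i y z" if iy: "i < x + 1" "y < b + 1" and P: "\<forall>z<d + 1. P i y z" for i y
  proof (rule ccontr)
    assume "\<not> (\<forall>z. P i y z)"
    then obtain z where "Q (pr i y) z" unfolding Q_def using iy by blast
    moreover have "pr i y < (n + n) * (n + n) + n + 1"
      using iy by (intro pr_bound) (auto simp: less_succ_iff n_def intro: add_increasing add_increasing2)
    ultimately obtain z where "z < d + 1" "Q (pr i y) z" using d by blast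
    then show False using P unfolding Q_def by auto
  qed
  have main: "i < x + 1 \<longrightarrow> (\<exists>y<b + 1. \<forall>z<d + 1. P i y z)" for i
  proof (induction i rule: bounded_induct)
    case dfm
    show ?case by (intro dfm_intros dfm3[OF P])
  next
    case 0
    show ?case using zero b[of 0] by blast
  next
    case (step i)
    show ?case
    proof
      assume i: "i + 1 < x + 1"
      then have "i < x + 1" using less_succI by simp
      then have "\<exists>y. \<forall>z. P i y z" using step fin by blast
      then have "\<exists>y. \<forall>z. P (i + 1) y z" by (rule assms(4))
      then show "\<exists>y<b + 1. \<forall>z<d + 1. P (i + 1) y z" using b[OF i] by blast
    qed
  qed
  then show ?thesis using main[of x] fin[of x] less_succ_iff[of x x] by blast
qed

lemma weak_brown_ISigma02:
  assumes weak_brown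
  shows "crit \<Turnstile> ISigma02"
proof -
  have "valid crit (induction_for p)" if p: "Sigma02 p" for p
    unfolding valid_def sat_induction_for
  proof (intro allI impI)
    fix e E x
    obtain q where q: "Sigma00 q" "p = ExN (AllN q)" using p by (auto simp: Sigma02_def)
    assume E: "range E \<subseteq> msets crit" and 0: "sat crit (case_nat (mzero crit) e) E p"
      and step: "\<forall>x. sat crit (case_nat x e) E p \<longrightarrow> sat crit (case_nat (mplus crit x (mone crit)) e) E p"
    define P where "P x y z \<longleftrightarrow> sat crit (case_nat z (case_nat y (case_nat x e))) E q" for x y z
    have sat: "sat crit (case_nat x e) E p \<longleftrightarrow> (\<exists>y. \<forall>z. P x y z)" for x
      by (simp add: q(2) P_def)
    have "dfm (\<lambda>v. P (v 0) (v 1) (v 2))"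
      unfolding dfm_def
    proof (intro exI conjI allI)
      \<comment> \<open>Variables 0, 1, 2 of q stand for z, y, x, the reverse of the argument order
        of P; the remaining ones are parameters from e.\<close>
      define \<pi> where "\<pi> i = (case i of 0 \<Rightarrow> \<lambda>v. v 2 | Suc i \<Rightarrow> (case i of 0 \<Rightarrow> \<lambda>v. v 1
        | Suc i \<Rightarrow> (case i of 0 \<Rightarrow> \<lambda>v. v 0 | Suc i \<Rightarrow> \<lambda>v :: nat \<Rightarrow> elem. e i)))" for i
      show "arg (\<pi> i)" for i by (auto simp: \<pi>_def arg_def split: nat.split)
      show "Sigma00 q" by (rule q)
      show "range E \<subseteq> sets" using E by (simp add: sets_def)
      show "P (v 0) (v 1) (v 2) = sat crit (\<lambda>i. \<pi> i v) E q" for v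
      proof -
        have "case_nat (v 2) (case_nat (v 1) (case_nat (v 0) e)) = (\<lambda>i. \<pi> i v)"
          by (rule ext) (simp add: \<pi>_def split: nat.split)
        then show ?thesis by (simp add: P_def)
      qed
    qed
    from weak_brown_Sigma2_induct[OF assms this] show "sat crit (case_nat x e) E p"
      using 0 step unfolding sat crit_folds by blast
  qed
  moreover have "msets crit \<noteq> {}" using crit(1) by (simp add: models_def)
  ultimately show ?thesis unfolding models_def ISigma02_def using valid_closures by auto
qed

section \<open>The remaining implications\<close>

text \<open>In the exceptional case of at most one element there are no two consecutive elements, so
  any bound holds vacuously.\<close>

lemma gaps_of_gapsize:
  assumes "gapsize h g" "g \<le> d"
  shows "gaps h d"
proof (cases "\<exists>m. fcard h m \<and> m \<le> 1")
  case True
  then obtain m f where m: "m \<le> 1" and f: "\<forall>i x. fmem (pr i x) f \<longrightarrow> i < m \<and> fmem x h"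
    "\<forall>i<m. \<exists>!x. fmem (pr i x) f" "\<forall>x. fmem x h \<longrightarrow> (\<exists>!i. fmem (pr i x) f)"
    unfolding fcard_def by (elim exE conjE) (rule that)
  have zero: "i = 0" if "i < m" for i using that m less_succ_iff[of i 0] by (simp add: less_le_trans)
  have "x = y" if "fmem x h" "fmem y h" for x y
  proof -
    have "fmem (pr 0 u) f \<and> 0 < m" if "fmem u h" for u
      using f(1,3) that zero by (metis ex1_implies_ex)
    with that f(2) show ?thesis by (metis (no_types))
  qed
  then show ?thesis unfolding gaps_def consec_def by (metis less_irrefl)
next
  case False
  then have "gaps h g" using assms(1) by (simp add: gapsize_def)
  then show ?thesis using assms(2) unfolding gaps_def by (meson add_left_mono order.trans)
qed

text \<open>With two or more elements the set of gaps is nonempty and bounded by d, hence has a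
  greatest member. The bound d + 1 covers the convention that tiny sets have gap size 1, also for d
  = 0.\<close>

lemma gapsize_exists:
  assumes gaps: "gaps h d"
  shows "\<exists>g\<le>d + 1. gapsize h g"
proof (cases "\<exists>m. fcard h m \<and> m \<le> 1")
  case True
  then show ?thesis by (intro exI[of _ 1]) (simp add: gapsize_def)
next
  case False
  have mem: "dfm (\<lambda>v. fmem (v 0) h)" by (intro dfm_intros)
  have ne: "\<exists>x. fmem x h"
  proof (rule ccontr)
    assume "\<not> (\<exists>x. fmem x h)"
    then have "fcard h 0" by (intro fcardI[of "\<lambda>_ _. True"] dfm_intros) auto
    then show False using False by auto
  qed
  obtain x where x: "fmem x h" "\<And>z. z < x \<Longrightarrow> \<not> fmem z h"
    using ne least_elem[OF mem] by metis
  have "\<exists>y. fmem y h \<and> x < y"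
  proof (rule ccontr)
    assume "\<not> (\<exists>y. fmem y h \<and> x < y)"
    then have eq: "fmem y h \<longleftrightarrow> y = x" for y using x by (metis linorder_neqE)
    have "i = 0" if "i < 1" for i :: elem using that less_succ_iff[of i 0] by simp
    then have "fcard h 1" by (intro fcardI[of "\<lambda>_ _. True"] dfm_intros) (auto simp: eq intro!: exI[of _ 0])
    then show False using False by auto
  qed
  moreover have "dfm (\<lambda>v. fmem (v 0) h \<and> x < v 0)" by (intro dfm_intros)
  ultimately obtain y where y: "fmem y h" "x < y" "\<And>w. w < y \<Longrightarrow> \<not> (fmem w h \<and> x < w)"
    using least_elem[of "\<lambda>y. fmem y h \<and> x < y"] by metis
  then have "consec h x y" unfolding consec_def using x(1) by (auto simp: not_less)
  obtain g0 where "y = x + g0" using y(2) le_iff_elem[of x y] by auto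
  have consec_less: "u < h" "w < h" if "consec h u w" for u w
    using that fmem_less unfolding consec_def by blast+
  \<comment> \<open>Elements of h are below h, which bounds u and w and makes the set of gaps
    definable.\<close>
  define G where "G g \<longleftrightarrow> (\<exists>u<h. \<exists>w<h. consec h u w \<and> w = u + g)" for g
  have G_iff: "G g \<longleftrightarrow> (\<exists>u. consec h u (u + g))" for g
    unfolding G_def using consec_less by blast
  have "dfm (\<lambda>v. G (v 0))" unfolding G_def consec_def by (intro dfm_intros)
  moreover have "G g0" using \<open>consec h x y\<close> \<open>y = x + g0\<close> unfolding G_iff by blast
  moreover have le: "g \<le> d" if "G g" for g
  proof -
    obtain u where "consec h u (u + g)" using \<open>G g\<close> unfolding G_iff by blast
    then have "u + g \<le> u + d" using gaps unfolding gaps_def by blast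
    then show ?thesis by simp
  qed
  ultimately obtain g where g: "G g" "\<And>g'. G g' \<Longrightarrow> g' \<le> g"
    by (rule greatest_elem) (assumption, erule that, blast)
  have "gaps h g"
    unfolding gaps_def
  proof (intro allI impI)
    fix u w assume uw: "consec h u w"
    then obtain g' where w: "w = u + g'" unfolding consec_def using le_iff_elem[of u w] by auto
    then have "g' \<le> g" using uw by (intro g(2)) (auto simp: G_iff)
    then show "w \<le> u + g" by (simp add: w)
  qed
  then have "gapsize h g" unfolding gapsize_def using False g(1) by (auto simp: G_iff)
  moreover have "g \<le> d + 1" using le[OF g(1)] by (rule order.trans) simp
  ultimately show ?thesis by blast
qed

lemma weak_brown_if_valid: "valid crit WeakBrown \<Longrightarrow> weak_brown"
  unfolding valid_WeakBrown weak_brown_def by (meson gaps_of_gapsize)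

lemma models_singleton: "crit \<Turnstile> {p} \<longleftrightarrow> valid crit p"
  using crit(1) by (simp add: models_def)

lemma Brown_WeakBrown:
  assumes "valid crit Brown"
  shows "valid crit WeakBrown"
  unfolding valid_WeakBrown
proof (intro allI ballI impI)
  fix r C assume C: "C \<in> sets" "coloring C r"
  obtain H c d where H: "\<forall>x\<in>H. pr x c \<in> C" "\<And>n. syndetic_on H n d"
    using assms[unfolded valid_Brown, rule_format, OF C] by blast
  have "\<exists>h. (\<exists>c. \<forall>x. fmem x h \<longrightarrow> pr x c \<in> C) \<and> (\<exists>m. fcard h m \<and> n \<le> m) \<and>
      (\<exists>g. gapsize h g \<and> g \<le> d + 1)" for n
  proof -
    obtain h where h: "\<forall>x. fmem x h \<longrightarrow> x \<in> H" "\<exists>m. fcard h m \<and> n \<le> m" "gaps h d"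
      using H(2)[of n] unfolding syndetic_on_def by (elim exE conjE) (rule that, auto)
    have "\<forall>x. fmem x h \<longrightarrow> pr x c \<in> C" using h(1) H(1) by blast
    then show ?thesis using h(2) gapsize_exists[OF h(3)] by blast
  qed
  then show "\<exists>d. \<forall>n. \<exists>h. (\<exists>c. \<forall>x. fmem x h \<longrightarrow> pr x c \<in> C) \<and> (\<exists>m. fcard h m \<and> n \<le> m) \<and>
      (\<exists>g. gapsize h g \<and> g \<le> d)" by blast
qed

lemma ISigma02_PartitionRegularity:
  assumes "crit \<Turnstile> ISigma02"
  shows "valid crit PartitionRegularity"
  unfolding valid_PartitionRegularity
proof (intro allI ballI impI, elim conjE exE)
  fix r X Z d
  assume X: "X \<in> sets" and Z: "Z \<in> sets" and d: "\<forall>n. syndetic_on X n d" and part: "partition X Z r"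
  have "windows X (d + 1)" using d by (intro windows_of_syndetic) blast
  then obtain i D where i: "i < r" and D: "windows {x. pr x i \<in> Z} D"
    using partition_regularity[OF assms X Z _ part] by blast
  have Y: "{x. pr x i \<in> Z} \<in> sets" by (intro comprehension dfm_mem[OF Z] dfm_intros)
  have "\<exists>Y\<in>sets. (\<forall>x. x \<in> Y \<longleftrightarrow> pr x i \<in> Z) \<and> (\<exists>d. \<forall>n. syndetic_on Y n d)"
    using syndetic_of_windows[OF Y D] by (intro bexI[OF _ Y] conjI exI[of _ "D + D"]) simp_all
  with i show "\<exists>i<r. \<exists>Y\<in>sets. (\<forall>x. x \<in> Y \<longleftrightarrow> pr x i \<in> Z) \<and> (\<exists>d. \<forall>n. syndetic_on Y n d)" by blast
qed

text \<open>The graph of a colouring, read as a family of colour classes, is itself a partition of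
  the whole set of numbers, and every class is homogeneous.\<close>

lemma PartitionRegularity_Brown:
  assumes "valid crit PartitionRegularity"
  shows "valid crit Brown"
  unfolding valid_Brown
proof (intro allI ballI impI)
  fix r C assume C: "C \<in> sets" and col: "coloring C r"
  have "{x :: elem. True} \<in> sets" by (intro comprehension dfm_intros)
  then have U: "UNIV \<in> sets" by simp
  have "windows UNIV 1"
    unfolding windows_def using less_succ_iff by blast
  then have "\<forall>n. syndetic_on UNIV n (1 + 1)" using syndetic_of_windows[OF U] by blast
  moreover have "partition UNIV C r"
    using col unfolding coloring_def partition_def by blast
  ultimately obtain i Y where "i < r" "Y \<in> sets" "\<forall>x. x \<in> Y \<longleftrightarrow> pr x i \<in> C" "\<exists>d. \<forall>n. syndetic_on Y n d"
    using assms U C unfolding valid_PartitionRegularity by blast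
  then show "\<exists>H\<in>sets. (\<exists>c. \<forall>x\<in>H. pr x c \<in> C) \<and> (\<exists>d. \<forall>n. syndetic_on H n d)" by blast
qed

lemma implications_crit: "implications crit"
  unfolding implications_def models_singleton
  using Brown_WeakBrown weak_brown_if_valid weak_brown_ISigma02 ISigma02_PartitionRegularity
    PartitionRegularity_Brown by blast

lemma closed_RCA0star: "p \<in> RCA0star \<union> ISigma02 \<Longrightarrow> closed_fm 0 0 p"
  unfolding RCA0star_def ISigma00_def ISigma02_def Delta01_CA_def
  by (auto simp: basic_axioms_def Let_def dest: closed_closures)

lemma closed_statements:
  "closed_fm 0 0 Brown" "closed_fm 0 0 PartitionRegularity" "closed_fm 0 0 WeakBrown"
  by (simp_all add: Brown_def PartitionRegularity_def WeakBrown_def Coloring_def Partition_def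
      Homogeneous_def FHomogeneous_def PiecewiseSyndetic_def GapSize_le_def GapSize_def Gaps_le_def
      Consecutive_def FSubset_def FCard_ge_def FCard_le_def FCard_def FMem_def Pairing_def Two_def
      Ex1N_def AllB_def ExB_def Leq_def lift_def Let_def)

text \<open>By the choice of \<open>crit\<close>, a violation in any model would already show up in
  \<open>crit\<close>.\<close>

lemma implications_model: "M \<Turnstile> RCA0star \<Longrightarrow> implications M" for M :: "elem model"
  using crit(2) implications_crit by blast

lemma derives_RCA0star:
  assumes "\<forall>q\<in>A. closed_fm 0 0 q" "closed_fm 0 0 p"
    and "\<And>M :: elem model. implications M \<Longrightarrow> M \<Turnstile> A \<Longrightarrow> M \<Turnstile> {p}"
  shows "RCA0star \<union> A \<turnstile> p"
proof (rule completeness[OF infinite_elem])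
  show "basic_axioms \<subseteq> RCA0star \<union> A" by (auto simp: RCA0star_def)
  show "\<forall>q\<in>RCA0star \<union> A. closed_fm 0 0 q" using assms(1) closed_RCA0star by auto
  show "M \<Turnstile> {p}" if "M \<Turnstile> RCA0star \<union> A" for M :: "elem model"
    using that assms(3) implications_model by simp
qed (rule assms)

lemma equivalent_over_RCA0star:
  assumes "\<forall>q\<in>A. closed_fm 0 0 q" "\<forall>q\<in>B. closed_fm 0 0 q"
    and "\<And>M :: elem model. implications M \<Longrightarrow> M \<Turnstile> A \<longleftrightarrow> M \<Turnstile> B"
  shows "equivalent_over RCA0star A B"
proof -
  have sub: "M \<Turnstile> C \<Longrightarrow> q \<in> C \<Longrightarrow> M \<Turnstile> {q}" for M :: "elem model" and C q
    by (auto simp: models_def)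
  have "RCA0star \<union> A \<turnstile> q" if "q \<in> B" for q
    using assms(1,2) that by (intro derives_RCA0star sub[OF _ that]) (auto simp: assms(3))
  moreover have "RCA0star \<union> B \<turnstile> q" if "q \<in> A" for q
    using assms(1,2) that by (intro derives_RCA0star sub[OF _ that]) (auto simp: assms(3))
  ultimately show ?thesis by (simp add: equivalent_over_def)
qed

lemma derives_Iff:
  assumes "equivalent_over T {p} {q}"
  shows "T \<turnstile> Iff p q"
proof -
  have "insert p T \<turnstile> q" "insert q T \<turnstile> p"
    using assms by (simp_all add: equivalent_over_def)
  then have "T \<turnstile> Imp p q" "T \<turnstile> Imp q p" by (simp_all add: derives.ImpI)
  then have *: "insert r T \<turnstile> Imp p q" "insert r T \<turnstile> Imp q p" for r
    by (simp_all add: derives_mono subset_insertI)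
  \<comment> \<open>With the connectives unfolded, \<open>Iff p q\<close> is the negation of
    \<open>?r\<close>, so it suffices to refute \<open>?r\<close>.\<close>
  let ?r = "Imp (Imp p q) (Neg (Imp q p))"
  have "insert ?r T \<turnstile> ?r" by (simp add: derives.Assm)
  from derives.ImpE[OF derives.ImpE[OF this *(1)] *(2)] show ?thesis by (rule derives.ImpI)
qed

theorem theorem5p5:
  "equivalent_over RCA0star ISigma02 {Brown} \<and>
   equivalent_over RCA0star ISigma02 {PartitionRegularity} \<and>
   equivalent_over RCA0star ISigma02 {WeakBrown} \<and>
   (RCA0star \<turnstile> Iff Brown PartitionRegularity) \<and>
   (RCA0star \<turnstile> Iff Brown WeakBrown) \<and>
   (RCA0star \<turnstile> Iff PartitionRegularity WeakBrown)"
  using closed_statements closed_RCA0star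
  by (intro conjI derives_Iff equivalent_over_RCA0star) (auto simp: implications_def)

end
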